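(* Let $l\geq 1$ be an odd integer and $p\ge l^2+3l+5$ a prime. Let $q\ge \frac{(p+l)p}{2}$ be a prime satisfying $(l+2)q\equiv 2\pmod p$. Then $M(p;q)=\frac{p+l+2}{2}$.
   Context: For a positive integer $n$, let $\Phi_n(x)=\sum_{k}a_n(k)x^k$ be the $n$-th cyclotomic polynomial and $A(n)=\max\{|a_n(k)|:k\ge0\}$. For primes $p<q$, $M(p;q)=\max\{A(pqr): r \text{ prime}, r>q\}$. *)

theory Defs
  imports Complex_Main "HOL-Computational_Algebra.Polynomial" "HOL-Number_Theory.Totient"
begin

definition cyclotomic_poly :: "nat \<Rightarrow> complex poly" where
  "cyclotomic_poly n = (\<Prod>k\<in>totatives n. [:- cis (2 * pi * real k / real n), 1:])"

definition cyclotomic_height :: "nat \<Rightarrow> real" where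
  "cyclotomic_height n = Max {norm (coeff (cyclotomic_poly n) k) | k. True}"

text \<open>The index set below is infinite, but for primes p < q the set of values is finite,
  since the heights are integers and the height of the polynomial for p q r is at most p.\<close>

definition ternary_height_max :: "nat \<Rightarrow> nat \<Rightarrow> real" where
  "ternary_height_max p q = Max {cyclotomic_height (p * q * r) | r. prime r \<and> q < r}"

end

theory Submission
  imports Defs "HOL-Computational_Algebra.Polynomial_FPS" "HOL-Analysis.Analysis"
    "HOL-Number_Theory.Number_Theory"
begin

text \<open>
  Let \<open>Q = (p + l + 2) / 2\<close>, the inverse of \<open>q\<close> modulo \<open>p\<close>, and let \<open>\<rho>\<close> be the inverse of \<open>r\<close>.
  Following Kaplan, a coefficient of the ternary polynomial is a sum of \<open>p\<close> differences
  \<open>e u v - e (u - \<rho>) v\<close> of truncated binary coefficients, where \<open>u\<close> runs through all residues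
  modulo \<open>p\<close>. For fixed \<open>v\<close> the function \<open>e\<close> is monotone along a unimodal order of the residues that does
  not depend on \<open>v\<close>, so the sum is bounded by the number of ascents and by the number of descents
  of the rotation by \<open>\<rho>\<close>, and both are at most \<open>Q\<close>.

  The value \<open>- Q\<close> is attained for \<open>\<rho>\<close> congruent to \<open>q\<close> or \<open>- q\<close>, where \<open>u\<close> moves by one from each
  difference to the next, if \<open>v\<close> moves by the integer part \<open>d\<close> of \<open>(p - Q) q / ((Q - 1) p)\<close>. The bound
  \<open>q \<ge> (p + l) p / 2\<close> makes \<open>d\<close> accurate enough, and \<open>p \<ge> l\<^sup>2 + 3 l + 5\<close> gives
  \<open>l + 2 \<le> \<rho> \<le> p - Q\<close>. These requirements fix \<open>r\<close> modulo \<open>p q\<close>, and Dirichlet's theorem on primes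
  in arithmetic progressions, for a product of two primes as modulus, provides \<open>r\<close>.
\<close>

section \<open>Real Dirichlet series\<close>

text \<open>For \<open>\<rho> \<le> p - Q\<close> the descents of the rotation are exactly the
  \<open>Q\<close> residues from \<open>\<rho>\<close> to \<open>Q + \<rho> - 1\<close>, so the
  value \<open>- Q\<close> forces each of them to contribute \<open>- 1\<close>. In the construction
  the shifted pair survives the truncation, the unshifted one does not, and \<open>v\<close> stays
  below \<open>R\<close>. Too large a step \<open>d\<close> drives \<open>v\<close> beyond
  \<open>R\<close>; too small a step lets unshifted pairs survive. Rounding \<open>d\<close> down
  loses less than \<open>(Q - 1) * p\<close>, which the bound on \<open>q\<close> makes at most
  \<open>q\<close>, and \<open>l + 2 \<le> \<rho>\<close> pays for this loss. As
  \<open>(l + 2) * \<rho>\<close> differs by 2 from a positive multiple of \<open>p\<close>, this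
  lower bound on \<open>\<rho>\<close> follows from \<open>p > (l + 1) * (l + 2) + 2\<close>, whence
  the quadratic bound on \<open>p\<close>. The truncation point is free only if
  \<open>r > p * q\<close>, so the residue class must contain large primes. In Dirichlet's theorem
  only real \<open>s\<close> occurs, and the obstacle is nonvanishing at 1: an inequality of 3-4-1
  type settles characters with nonprincipal square, while real characters need a separate
  argument.\<close>

lemma abel_summation_bound:
  fixes a f :: "nat \<Rightarrow> real"
  assumes B: "\<And>M. \<bar>\<Sum>n<M. a n\<bar> \<le> B"
    and f: "\<And>n. m \<le> n \<Longrightarrow> f (Suc n) \<le> f n" "\<And>n. m \<le> n \<Longrightarrow> 0 \<le> f n"
  shows "\<bar>\<Sum>n=m..<M. a n * f n\<bar> \<le> 2 * B * f m"
proof (cases "m \<le> M")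
  case True
  define T where "T k = (\<Sum>n=m..<k. a n)" for k
  have T: "\<bar>T k\<bar> \<le> 2 * B" for k
  proof (cases "m \<le> k")
    case True
    then have "T k = (\<Sum>n<k. a n) - (\<Sum>n<m. a n)"
      using sum_diff_nat_ivl[of 0 m k a] by (simp add: T_def atLeast0LessThan)
    then show ?thesis using B[of k] B[of m] by linarith
  qed (use B[of 0] in \<open>simp add: T_def\<close>)
  have "(\<Sum>n=m..<M. a n * f n) = T M * f M + (\<Sum>n=m..<M. T (Suc n) * (f n - f (Suc n)))"
    using True
  proof (induction M rule: dec_induct)
    case (step k)
    have "T (Suc k) = T k + a k" using step by (simp add: T_def)
    then show ?case using step by (simp add: algebra_simps)
  qed (simp add: T_def)
  also have "\<bar>\<dots>\<bar> \<le> 2 * B * f M + (\<Sum>n=m..<M. 2 * B * (f n - f (Suc n)))"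
  proof (rule order_trans[OF abs_triangle_ineq] add_mono)+
    show "\<bar>T M * f M\<bar> \<le> 2 * B * f M"
      using T[of M] f(2)[OF True] by (simp add: abs_mult mult_right_mono)
    have "\<bar>T (Suc n) * (f n - f (Suc n))\<bar> \<le> 2 * B * (f n - f (Suc n))" if "m \<le> n" for n
      using T[of "Suc n"] f(1)[OF that] by (simp add: abs_mult mult_right_mono)
    then show "\<bar>\<Sum>n=m..<M. T (Suc n) * (f n - f (Suc n))\<bar> \<le> (\<Sum>n=m..<M. 2 * B * (f n - f (Suc n)))"
      by (intro order_trans[OF sum_abs] sum_mono) auto
  qed
  also have "(\<Sum>n=m..<M. 2 * B * (f n - f (Suc n))) = 2 * B * (f m - f M)"
    using sum_Suc_diff'[OF True, of "\<lambda>n. - f n"] by (simp flip: sum_distrib_left)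
  finally show ?thesis by (simp add: algebra_simps)
next
  case False
  then show ?thesis using B[of 0] f(2)[of m] by simp
qed

lemma summable_ln_powr:
  assumes "1 < (s::real)"
  shows "summable (\<lambda>n. ln (real n) * real n powr - s)"
proof (rule summable_comparison_test')
  define e where "e = (s - 1) / 2"
  have e: "0 < e" "e - s < - 1" using assms by (auto simp: e_def field_simps)
  show "summable (\<lambda>n. (1 / e) * real n powr (e - s))"
    using e by (intro summable_mult) (simp add: summable_real_powr_iff)
  fix n :: nat assume "1 \<le> n"
  then have "ln (real n) \<le> real n powr e / e" using e by (intro ln_powr_bound) auto
  then have "ln (real n) * real n powr - s \<le> (real n powr e / e) * real n powr - s"
    by (rule mult_right_mono) simp
  also have "\<dots> = (1 / e) * real n powr (e - s)" by (simp add: powr_diff powr_minus_divide)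
  finally show "norm (ln (real n) * real n powr - s) \<le> (1 / e) * real n powr (e - s)"
    using \<open>1 \<le> n\<close> by (simp only: real_norm_def) (subst abs_of_nonneg, auto)
qed

lemma summable_powr: "1 < (s::real) \<Longrightarrow> summable (\<lambda>n. real n powr - s)"
  by (simp add: summable_real_powr_iff)

text \<open>\<open>ln x / x\<close> decreases only from \<open>exp 1\<close> on, so 3 is the first
  admissible integer; the remaining factor \<open>n powr (1 - s)\<close> is nonincreasing because
  \<open>1 \<le> s\<close>.\<close>

lemma ln_powr_antimono:
  assumes "1 \<le> (s::real)" "3 \<le> n"
  shows "ln (real (Suc n)) * real (Suc n) powr - s \<le> ln (real n) * real n powr - s"
proof -
  have eq: "ln (real k) * real k powr - s = (ln (real k) / real k) * real k powr (1 - s)" if "1 \<le> k" for k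
    using that by (simp add: powr_diff powr_minus field_simps)
  have "exp 1 \<le> real n" using assms exp_le by linarith
  then have "ln (real (Suc n)) / real (Suc n) \<le> ln (real n) / real n"
    by (intro ln_x_over_x_mono) auto
  moreover have "real (Suc n) powr (1 - s) \<le> real n powr (1 - s)"
    using assms by (intro powr_mono2') auto
  ultimately have "(ln (real (Suc n)) / real (Suc n)) * real (Suc n) powr (1 - s) \<le>
      (ln (real n) / real n) * real n powr (1 - s)"
    by (rule mult_mono) (use assms in auto)
  then show ?thesis using eq[of n] eq[of "Suc n"] assms by linarith
qed

text \<open>The point is uniformity in \<open>s\<close>, down to and including 1. Abel summation
  covers \<open>n \<ge> 3\<close>; the terms 0 and 1 vanish (\<open>ln 0 = 0\<close> by convention),
  and the term 2 is at most 1.\<close>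

lemma partial_ln_series_bound:
  fixes a :: "nat \<Rightarrow> real"
  assumes a: "\<And>n. \<bar>a n\<bar> \<le> 1" and B: "\<And>M. \<bar>\<Sum>n<M. a n\<bar> \<le> B" and s: "1 \<le> s"
  shows "\<bar>\<Sum>n<M. a n * (ln (real n) * real n powr - s)\<bar> \<le> 1 + 2 * B"
proof -
  let ?f = "\<lambda>n. ln (real n) * real n powr - s"
  have B0: "0 \<le> B" using B[of 0] by simp
  have f2: "\<bar>?f 2\<bar> \<le> 1"
  proof -
    have "2 powr - s \<le> 2 powr (0::real)" using s by (intro powr_mono) auto
    then show ?thesis using ln_2_less_1 by (simp add: abs_mult mult_le_one)
  qed
  have f3: "?f 3 \<le> 1"
  proof -
    have "(3::real) powr - s \<le> 3 powr (- 1)" using s by (intro powr_mono) auto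
    then have "(3::real) powr - s \<le> 1 / 3" by (simp add: powr_minus_divide)
    moreover have "ln (3::real) \<le> 3" using ln_bound[of 3] by simp
    ultimately have "ln 3 * 3 powr - s \<le> 3 * (1 / 3 :: real)" by (intro mult_mono) auto
    then show ?thesis by simp
  qed
  have "{..<M} = {..<min M 3} \<union> {3..<M}" by auto
  then have "(\<Sum>n<M. a n * ?f n) = (\<Sum>n<min M 3. a n * ?f n) + (\<Sum>n=3..<M. a n * ?f n)"
    by (metis (no_types, lifting) disjoint_iff finite_atLeastLessThan finite_lessThan lessThan_iff
        atLeastLessThan_iff min_less_iff_conj not_le sum.union_disjoint)
  moreover have "\<bar>\<Sum>n<min M 3. a n * ?f n\<bar> \<le> 1"
  proof -
    have "\<bar>\<Sum>n<min M 3. a n * ?f n\<bar> \<le> (\<Sum>n<min M 3. \<bar>a n * ?f n\<bar>)" by (rule sum_abs)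
    also have "\<dots> \<le> (\<Sum>n<3. \<bar>a n * ?f n\<bar>)" by (rule sum_mono2) auto
    also have "\<dots> = \<bar>a 2\<bar> * \<bar>?f 2\<bar>" by (simp add: eval_nat_numeral abs_mult)
    also have "\<dots> \<le> 1" using a[of 2] f2 by (intro mult_le_one) auto
    finally show ?thesis .
  qed
  moreover have "\<bar>\<Sum>n=3..<M. a n * ?f n\<bar> \<le> 2 * B * ?f 3"
    using abel_summation_bound[OF B, of 3 ?f M] ln_powr_antimono[OF s] by simp
  moreover have "2 * B * ?f 3 \<le> 2 * B * 1" using f3 B0 by (intro mult_left_mono) auto
  ultimately show ?thesis by linarith
qed

lemma ln_series_bound:
  fixes a :: "nat \<Rightarrow> real"
  assumes a: "\<And>n. \<bar>a n\<bar> \<le> 1" and B: "\<And>M. \<bar>\<Sum>n<M. a n\<bar> \<le> B" and s: "1 < s"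
  shows "\<bar>\<Sum>n. a n * (ln (real n) * real n powr - s)\<bar> \<le> 1 + 2 * B"
proof -
  have "summable (\<lambda>n. a n * (ln (real n) * real n powr - s))"
    using a by (intro summable_comparison_test'[OF summable_ln_powr[OF s], of 1])
      (auto simp: abs_mult intro!: mult_left_le_one_le)
  then have "(\<lambda>M. \<bar>\<Sum>n<M. a n * (ln (real n) * real n powr - s)\<bar>) \<longlonglongrightarrow>
      \<bar>\<Sum>n. a n * (ln (real n) * real n powr - s)\<bar>"
    by (intro tendsto_rabs summable_LIMSEQ)
  then show ?thesis using partial_ln_series_bound[OF a B, of s] s by (intro LIMSEQ_le_const2) auto
qed

lemma summable_dirichlet_1:
  fixes a :: "nat \<Rightarrow> real"
  assumes B: "\<And>M. \<bar>\<Sum>n<M. a n\<bar> \<le> B"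
  shows "summable (\<lambda>n. a n / real n)"
  unfolding summable_Cauchy
proof (intro allI impI)
  fix e :: real assume "0 < e"
  obtain m0 :: nat where m0: "2 * B / e < real m0" using reals_Archimedean2 by blast
  have "norm (\<Sum>n=m..<k. a n / real n) < e" if "Suc m0 \<le> m" for m k
  proof -
    have "\<bar>\<Sum>n=m..<k. a n * (1 / real n)\<bar> \<le> 2 * B * (1 / real m)"
      using that by (intro abel_summation_bound[OF B]) (auto simp: field_simps)
    also have "\<dots> < e" using m0 that \<open>0 < e\<close> by (simp add: field_simps)
       (smt (verit, best) mult_left_mono of_nat_le_iff of_nat_Suc mult.commute)
    finally show ?thesis by simp
  qed
  then show "\<exists>N. \<forall>m\<ge>N. \<forall>n. norm (\<Sum>k=m..<n. a k / real k) < e" by blast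
qed

text \<open>At 1 the series may converge only conditionally. The mean value theorem is therefore
  applied to the partial sums, whose derivatives are bounded uniformly, before passing to the
  limit.\<close>

lemma dirichlet_series_near_1:
  fixes a :: "nat \<Rightarrow> real"
  assumes a: "\<And>n. \<bar>a n\<bar> \<le> 1" and B: "\<And>M. \<bar>\<Sum>n<M. a n\<bar> \<le> B" and s: "1 < s"
  shows "\<bar>(\<Sum>n. a n * real n powr - s) - (\<Sum>n. a n / real n)\<bar> \<le> (1 + 2 * B) * (s - 1)"
proof -
  define Z where "Z M t = (\<Sum>n<M. a n * real n powr - t)" for M t
  have "\<bar>Z M s - Z M 1\<bar> \<le> (1 + 2 * B) * (s - 1)" for M
  proof -
    have "((\<lambda>t. real n powr - t) has_real_derivative - (ln (real n) * real n powr - t)) (at t)" for n t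
      by (cases "n = 0") (auto intro!: derivative_eq_intros)
    then have "(Z M has_real_derivative (\<Sum>n<M. a n * - (ln (real n) * real n powr - t))) (at t)" for t
      unfolding Z_def by (intro DERIV_sum DERIV_cmult)
    then obtain t where t: "1 < t" "t < s"
      "Z M s - Z M 1 = (s - 1) * (\<Sum>n<M. a n * - (ln (real n) * real n powr - t))"
      using MVT2[OF s, of "Z M" "\<lambda>t. \<Sum>n<M. a n * - (ln (real n) * real n powr - t)"] by blast
    then have "\<bar>Z M s - Z M 1\<bar> = (s - 1) * \<bar>\<Sum>n<M. a n * (ln (real n) * real n powr - t)\<bar>"
      using s by (simp add: abs_mult sum_negf)
    also have "\<dots> \<le> (s - 1) * (1 + 2 * B)"
      using s t by (intro mult_left_mono partial_ln_series_bound[OF a B]) auto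
    finally show ?thesis by (simp add: mult.commute)
  qed
  moreover have "(\<lambda>M. \<bar>Z M s - Z M 1\<bar>) \<longlonglongrightarrow> \<bar>(\<Sum>n. a n * real n powr - s) - (\<Sum>n. a n / real n)\<bar>"
  proof (intro tendsto_rabs tendsto_diff)
    have "summable (\<lambda>n. a n * real n powr - s)"
      using a by (intro summable_comparison_test'[OF summable_powr[OF s], of 1])
        (auto simp: abs_mult intro!: mult_left_le_one_le)
    then show "(\<lambda>M. Z M s) \<longlonglongrightarrow> (\<Sum>n. a n * real n powr - s)"
      unfolding Z_def by (rule summable_LIMSEQ)
    have "a n / real n = a n * real n powr - 1" for n
      by (cases "n = 0") (auto simp: powr_minus_divide)
    then show "(\<lambda>M. Z M 1) \<longlonglongrightarrow> (\<Sum>n. a n / real n)"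
      using summable_LIMSEQ[OF summable_dirichlet_1[OF B]] by (simp add: Z_def)
  qed
  ultimately show ?thesis by (intro LIMSEQ_le_const2) auto
qed

lemma dirichlet_series_has_derivative:
  fixes a :: "nat \<Rightarrow> real"
  assumes a: "\<And>n. \<bar>a n\<bar> \<le> 1" and s: "1 < s"
  shows "((\<lambda>t. \<Sum>n. a n * real n powr - t) has_real_derivative
    - (\<Sum>n. a n * (ln (real n) * real n powr - s))) (at s)"
proof -
  \<comment> \<open>Termwise differentiation needs one summable majorant on a neighbourhood of
    \<open>s\<close>; the midpoint between 1 and \<open>s\<close> provides it.\<close>
  define s0 where "s0 = (1 + s) / 2"
  have s0: "1 < s0" "s0 < s" using s by (auto simp: s0_def)
  let ?f = "\<lambda>n t. a n * real n powr - t" and ?f' = "\<lambda>n t. a n * - (ln (real n) * real n powr - t)"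
  have "((\<lambda>t. \<Sum>n. ?f n t) has_real_derivative (\<Sum>n. ?f' n s)) (at s)"
  proof (rule has_field_derivative_series'(2)[of "{s0..}"])
    show "convex {s0..}" by simp
    have der: "((\<lambda>t. real n powr - t) has_real_derivative - (ln (real n) * real n powr - t)) (at t)" for n t
      by (cases "n = 0") (auto intro!: derivative_eq_intros)
    show "(?f n has_real_derivative ?f' n t) (at t within {s0..})" for n t
      by (rule DERIV_cmult[OF has_field_derivative_at_within[OF der]])
    show "uniformly_convergent_on {s0..} (\<lambda>n t. \<Sum>i<n. ?f' i t)"
    proof (rule Weierstrass_m_test'[OF _ summable_ln_powr[OF s0(1)]])
      fix n t assume t: "t \<in> {s0..}"
      have "\<bar>a n\<bar> * \<bar>ln (real n) * real n powr - t\<bar> \<le> 1 * (ln (real n) * real n powr - s0)"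
      proof (cases "n = 0")
        case False
        have "\<bar>ln (real n) * real n powr - t\<bar> = ln (real n) * real n powr - t"
          using False by (intro abs_of_nonneg) auto
        also have "\<dots> \<le> ln (real n) * real n powr - s0"
          using False t by (intro mult_left_mono powr_mono) auto
        finally show ?thesis using a[of n] by (intro mult_mono) auto
      qed simp
      then show "norm (?f' n t) \<le> ln (real n) * real n powr - s0" by (simp add: abs_mult)
    qed
    show "s \<in> {s0..}" using s0 by simp
    show "summable (\<lambda>n. ?f n s)"
      using a by (intro summable_comparison_test'[OF summable_powr[OF s], of 1])
        (auto simp: abs_mult intro!: mult_left_le_one_le)
    show "s \<in> interior {s0..}" using s0 by (simp add: interior_Ici[of s0 "s0 - 1"])
  qed
  moreover have "summable (\<lambda>n. a n * (ln (real n) * real n powr - s))"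
    using a by (intro summable_comparison_test'[OF summable_ln_powr[OF s], of 1])
      (auto simp: abs_mult intro!: mult_left_le_one_le)
  ultimately show ?thesis by (simp add: suminf_minus)
qed

text \<open>Comparison with the integral of \<open>x powr - s\<close>, carried out by the mean value
  theorem so that the bounds telescope.\<close>

lemma sum_powr_tail_bound:
  assumes "1 < (s::real)"
  shows "(\<Sum>n=2..<M. real n powr - s) \<le> 1 / (s - 1)"
proof -
  have step: "real (Suc n) powr - s \<le> (real n powr (1 - s) - real (Suc n) powr (1 - s)) / (s - 1)"
    if n: "1 \<le> n" for n
  proof -
    have "((\<lambda>x. x powr (1 - s)) has_real_derivative (1 - s) * x powr - s) (at x)" if "real n \<le> x" for x
      using that n by (auto intro!: derivative_eq_intros)
    then obtain x where x: "real n < x" "x < real (Suc n)"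
      "real (Suc n) powr (1 - s) - real n powr (1 - s) = (real (Suc n) - real n) * ((1 - s) * x powr - s)"
      using MVT2[of "real n" "real (Suc n)" "\<lambda>x. x powr (1 - s)" "\<lambda>x. (1 - s) * x powr - s"] by auto
    have "real (Suc n) powr - s \<le> x powr - s"
      using x n assms by (intro powr_mono2') auto
    also have "\<dots> = (real n powr (1 - s) - real (Suc n) powr (1 - s)) / (s - 1)"
      using x(3) assms by (simp add: field_simps)
    finally show ?thesis .
  qed
  show ?thesis
  proof (cases "2 \<le> M")
    case True
    have "(\<Sum>n=2..<M. real n powr - s) = (\<Sum>n=1..<M - 1. real (Suc n) powr - s)"
      using True sum.shift_bounds_nat_ivl[of "\<lambda>n. real n powr - s" 1 1 "M - 1"] by (simp add: numeral_2_eq_2)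
    also have "\<dots> \<le> (\<Sum>n=1..<M - 1. (real n powr (1 - s) - real (Suc n) powr (1 - s)) / (s - 1))"
      using step by (intro sum_mono) auto
    also have "\<dots> = (1 - real (M - 1) powr (1 - s)) / (s - 1)"
      using sum_Suc_diff'[of 1 "M - 1" "\<lambda>n. - (real n powr (1 - s))"] True
      by (simp flip: sum_divide_distrib)
    also have "\<dots> \<le> 1 / (s - 1)" using assms by (intro divide_right_mono) auto
    finally show ?thesis .
  qed (use assms in auto)
qed

section \<open>Dirichlet characters\<close>

text \<open>Dirichlet convolution as a regrouping: the pairs \<open>(a, b)\<close> are sorted by
  their product, and each product has finitely many divisors.\<close>

lemma has_sum_divisor_sums:
  fixes g :: "nat \<Rightarrow> nat \<Rightarrow> 'a :: {topological_comm_monoid_add, t3_space}"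
  assumes "((\<lambda>(a, b). g a b) has_sum S) ({1..} \<times> {1..})"
  shows "((\<lambda>n. \<Sum>d | d dvd n. g d (n div d)) has_sum S) {1..}"
proof (rule has_sum_SigmaD)
  have "((\<lambda>(a, b). g a b) has_sum S) ({1..} \<times> {1..}) \<longleftrightarrow>
      ((\<lambda>(n, d). g d (n div d)) has_sum S) (Sigma {1..} (\<lambda>n. {d. d dvd n}))"
    by (rule has_sum_reindex_bij_witness[where i = "\<lambda>(n, d). (d, n div d)" and j = "\<lambda>(a, b). (a * b, a)"])
      (auto elim!: dvdE)
  then show "((\<lambda>(n, d). g d (n div d)) has_sum S) (Sigma {1..} (\<lambda>n. {d. d dvd n}))"
    using assms by simp
  fix n :: nat assume "n \<in> {1..}"
  then have "finite {d. d dvd n}" by (intro finite_divisors_nat) auto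
  then show "((\<lambda>d. case (n, d) of (n, d) \<Rightarrow> g d (n div d)) has_sum (\<Sum>d | d dvd n. g d (n div d))) {d. d dvd n}"
    by (intro has_sum_finiteI) auto
qed

lemma has_sum_product_Times:
  fixes f g :: "nat \<Rightarrow> complex"
  assumes "summable (\<lambda>n. norm (f n))" "summable (\<lambda>n. norm (g n))" "f 0 = 0" "g 0 = 0"
  shows "((\<lambda>(a, b). f a * g b) has_sum (suminf f * suminf g)) ({1..} \<times> {1..})"
proof -
  have pos: "(h has_sum suminf h) {1..}" if "summable (\<lambda>n. norm (h n))" "h 0 = 0"
    for h :: "nat \<Rightarrow> 'b :: banach"
  proof -
    have "(h has_sum suminf h) UNIV"
      by (rule norm_summable_imp_has_sum[OF that(1) summable_sums[OF summable_norm_cancel[OF that(1)]]])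
    also have "?this \<longleftrightarrow> (h has_sum suminf h) {1..}"
      using that(2) by (intro has_sum_cong_neutral) (auto simp: Suc_le_eq)
    finally show ?thesis .
  qed
  have "(\<lambda>(a, b). norm (f a) * norm (g b)) summable_on ({1..} \<times> {1..})"
  proof (rule summable_on_SigmaI)
    show "((\<lambda>b. case (a, b) of (a, b) \<Rightarrow> norm (f a) * norm (g b)) has_sum
        norm (f a) * (\<Sum>n. norm (g n))) {1..}" for a
      using has_sum_cmult_right[OF pos[of "\<lambda>n. norm (g n)"]] assms by simp
    show "(\<lambda>a. norm (f a) * (\<Sum>n. norm (g n))) summable_on {1..}"
      using pos[of "\<lambda>n. norm (f n)"] assms by (intro summable_on_cmult_left) (auto simp: summable_on_def)
  qed auto
  then have "(\<lambda>(a, b). f a * g b) summable_on ({1..} \<times> {1..})"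
    by (rule abs_summable_summable[OF summable_on_cong[THEN iffD1], rotated]) (auto simp: norm_mult)
  then show ?thesis
  proof (rule has_sum_SigmaI[rotated 2])
    show "((\<lambda>b. case (a, b) of (a, b) \<Rightarrow> f a * g b) has_sum f a * suminf g) {1..}" for a
      using has_sum_cmult_right[OF pos[of g]] assms by simp
    show "((\<lambda>a. f a * suminf g) has_sum suminf f * suminf g) {1..}"
      using has_sum_cmult_left[OF pos[of f]] assms by simp
  qed
qed

section \<open>Dirichlet characters and their L-series for real \<open>s > 1\<close>\<close>

locale dirichlet_character =
  fixes N :: nat and \<psi> :: "nat \<Rightarrow> complex"
  assumes modulus: "1 < N"
    and mult: "\<psi> (a * b) = \<psi> a * \<psi> b"
    and periodic: "\<psi> (a + N) = \<psi> a"
    and unit: "coprime a N \<Longrightarrow> norm (\<psi> a) = 1"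
    and nonunit: "\<not> coprime a N \<Longrightarrow> \<psi> a = 0"
begin

lemma at_0 [simp]: "\<psi> 0 = 0"
  using modulus by (intro nonunit) auto

lemma at_1 [simp]: "\<psi> 1 = 1" "\<psi> (Suc 0) = 1"
proof -
  have "norm (\<psi> 1) = 1" by (rule unit) simp
  then have "\<psi> 1 \<noteq> 0" by auto
  moreover have "\<psi> 1 = \<psi> 1 * \<psi> 1" using mult[of 1 1] by simp
  ultimately show "\<psi> 1 = 1" by simp
  then show "\<psi> (Suc 0) = 1" by simp
qed

lemma norm_le_1: "norm (\<psi> a) \<le> 1"
  using unit[of a] nonunit[of a] by (cases "coprime a N") auto

lemma abs_Re_Im_le: "\<bar>Re (\<psi> a)\<bar> \<le> 1" "\<bar>Im (\<psi> a)\<bar> \<le> 1"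
  using norm_le_1[of a] abs_Re_le_cmod[of "\<psi> a"] abs_Im_le_cmod[of "\<psi> a"] by linarith+

lemma periodic_mult: "\<psi> (a + k * N) = \<psi> a"
proof (induction k)
  case (Suc k)
  then show ?case using periodic[of "a + k * N"] by (simp add: algebra_simps)
qed simp

lemma cong_eq:
  assumes "[a = b] (mod N)"
  shows "\<psi> a = \<psi> b"
proof -
  have "\<psi> c = \<psi> (c mod N)" for c
    using periodic_mult[of "c mod N" "c div N"] by (simp only: mod_div_mult_eq)
  then show ?thesis using assms by (metis Cong.cong_def)
qed

definition L :: "real \<Rightarrow> complex" where
  "L s = (\<Sum>n. \<psi> n * of_real (real n powr - s))"

text \<open>For \<open>s > 1\<close> this is minus the derivative of \<open>L\<close>, and
  \<open>L_mangoldt\<close> plays the role of minus the logarithmic derivative.\<close>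

definition L_ln :: "real \<Rightarrow> complex" where
  "L_ln s = (\<Sum>n. \<psi> n * of_real (ln (real n) * real n powr - s))"

definition L_mangoldt :: "real \<Rightarrow> complex" where
  "L_mangoldt s = (\<Sum>n. \<psi> n * of_real (mangoldt n * real n powr - s))"

lemma summable_norms:
  assumes "1 < s"
  shows "summable (\<lambda>n. norm (\<psi> n * of_real (real n powr - s)))"
    and "summable (\<lambda>n. norm (\<psi> n * of_real (ln (real n) * real n powr - s)))"
    and "summable (\<lambda>n. norm (\<psi> n * of_real (mangoldt n * real n powr - s)))"
proof -
  have le: "norm (norm (\<psi> n * of_real x)) \<le> x" if "0 \<le> x" for n x
    using norm_le_1[of n] that by (simp add: norm_mult mult_left_le_one_le)
  show "summable (\<lambda>n. norm (\<psi> n * of_real (real n powr - s)))"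
    by (rule summable_comparison_test'[OF summable_powr[OF assms] le]) auto
  show "summable (\<lambda>n. norm (\<psi> n * of_real (ln (real n) * real n powr - s)))"
    by (rule summable_comparison_test'[OF summable_ln_powr[OF assms] le, of 1]) auto
  show "summable (\<lambda>n. norm (\<psi> n * of_real (mangoldt n * real n powr - s)))"
  proof (rule summable_comparison_test'[OF summable_ln_powr[OF assms], of 1])
    fix n :: nat assume "1 \<le> n"
    then have "mangoldt n * real n powr - s \<le> ln (real n) * real n powr - s"
      by (intro mult_right_mono mangoldt_le) auto
    moreover have "0 \<le> mangoldt n * real n powr - s" by (simp add: mangoldt_nonneg)
    ultimately show "norm (norm (\<psi> n * of_real (mangoldt n * real n powr - s))) \<le> ln (real n) * real n powr - s"
      using le order_trans by blast
  qed
qed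

text \<open>\<open>\<psi>\<close> is completely multiplicative, so it factors out of every divisor
  sum and leaves the identity that \<open>mangoldt\<close> summed over the divisors of
  \<open>n\<close> gives \<open>ln n\<close>.\<close>

lemma L_mult_L_mangoldt:
  assumes "1 < s"
  shows "L_mangoldt s * L s = L_ln s"
proof -
  let ?f = "\<lambda>n. \<psi> n * of_real (mangoldt n * real n powr - s)" and ?g = "\<lambda>n. \<psi> n * of_real (real n powr - s)"
    and ?h = "\<lambda>n. \<psi> n * complex_of_real (ln (real n) * real n powr - s)"
  have "((\<lambda>n. \<Sum>d | d dvd n. ?f d * ?g (n div d)) has_sum (suminf ?f * suminf ?g)) {1..}"
    using summable_norms[OF assms] by (intro has_sum_divisor_sums has_sum_product_Times) auto
  moreover have "(\<Sum>d | d dvd n. ?f d * ?g (n div d)) = ?h n" if "n \<in> {1..}" for n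
  proof -
    have n: "0 < n" using that by simp
    have eq: "?f d * ?g (n div d) = \<psi> n * of_real (real n powr - s) * mangoldt d" if d: "d dvd n" for d
    proof -
      obtain k where k: "n = d * k" using d by (elim dvdE)
      then have "0 < d" "0 < k" using n by auto
      then have "real n powr - s = real d powr - s * real k powr - s" "n div d = k"
        by (auto simp: k powr_mult)
      then show ?thesis by (simp add: k mult)
    qed
    have "(\<Sum>d | d dvd n. ?f d * ?g (n div d)) =
        \<psi> n * of_real (real n powr - s) * (\<Sum>d | d dvd n. mangoldt d)"
      unfolding sum_distrib_left by (intro sum.cong refl eq) simp
    then show ?thesis using mangoldt_sum[of n, where 'a = complex] n by simp
  qed
  ultimately have "(?h has_sum (suminf ?f * suminf ?g)) {1..}"
    using has_sum_cong by (metis (mono_tags, lifting))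
  also have "?this \<longleftrightarrow> (?h has_sum (suminf ?f * suminf ?g)) UNIV"
    by (intro has_sum_cong_neutral) (auto simp: Suc_le_eq)
  finally have "?h sums (suminf ?f * suminf ?g)" by (rule has_sum_imp_sums)
  then show ?thesis unfolding L_def L_mangoldt_def L_ln_def by (rule sums_unique)
qed

lemma Re_Im_L:
  assumes "1 < s"
  shows "Re (L s) = (\<Sum>n. Re (\<psi> n) * real n powr - s)" "Im (L s) = (\<Sum>n. Im (\<psi> n) * real n powr - s)"
    "Re (L_ln s) = (\<Sum>n. Re (\<psi> n) * (ln (real n) * real n powr - s))"
    "Im (L_ln s) = (\<Sum>n. Im (\<psi> n) * (ln (real n) * real n powr - s))"
    "Re (L_mangoldt s) = (\<Sum>n. Re (\<psi> n) * (mangoldt n * real n powr - s))"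
  using summable_norms[OF assms, THEN summable_norm_cancel, THEN summable_sums, THEN sums_Re, THEN sums_unique]
    summable_norms[OF assms, THEN summable_norm_cancel, THEN summable_sums, THEN sums_Im, THEN sums_unique]
  unfolding L_def L_ln_def L_mangoldt_def by simp_all

text \<open>Growth of \<open>norm (L s)\<close> can be read off from
  \<open>Re (L_mangoldt s)\<close> without complex derivatives or logarithms. Nothing is divided by
  \<open>L\<close>, so zeros do no harm.\<close>

lemma norm_L_squared_has_derivative:
  assumes "1 < s"
  shows "((\<lambda>t. (norm (L t))\<^sup>2) has_real_derivative - 2 * (norm (L s))\<^sup>2 * Re (L_mangoldt s)) (at s)"
proof -
  let ?A = "\<lambda>t. \<Sum>n. Re (\<psi> n) * real n powr - t" and ?B = "\<lambda>t. \<Sum>n. Im (\<psi> n) * real n powr - t"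
  have A: "(?A has_real_derivative - Re (L_ln s)) (at s)"
    unfolding Re_Im_L[OF assms] by (rule dirichlet_series_has_derivative[OF abs_Re_Im_le(1) assms])
  have B: "(?B has_real_derivative - Im (L_ln s)) (at s)"
    unfolding Re_Im_L[OF assms] by (rule dirichlet_series_has_derivative[OF abs_Re_Im_le(2) assms])
  have "((\<lambda>t. (?A t)\<^sup>2 + (?B t)\<^sup>2) has_real_derivative
      2 * ?A s * - Re (L_ln s) + 2 * ?B s * - Im (L_ln s)) (at s)"
    by (auto intro!: derivative_eq_intros A B)
  also have "2 * ?A s * - Re (L_ln s) + 2 * ?B s * - Im (L_ln s) = - 2 * (norm (L s))\<^sup>2 * Re (L_mangoldt s)"
    unfolding Re_Im_L(1,2)[OF assms, symmetric] cmod_power2 L_mult_L_mangoldt[OF assms, symmetric]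
    by (simp add: algebra_simps power2_eq_square)
  finally show ?thesis
  proof (rule has_field_derivative_transform_within_open[where S = "{1<..}"])
    show "(?A t)\<^sup>2 + (?B t)\<^sup>2 = (norm (L t))\<^sup>2" if "t \<in> {1<..}" for t
      using that by (simp add: cmod_power2 Re_Im_L)
  qed (use assms in auto)
qed

text \<open>Valid for every character: it limits the growth near 1 to the order of
  \<open>1 / (s - 1)\<close> and keeps \<open>L 3\<close> away from 0.\<close>

lemma norm_L_minus_1_le:
  assumes "1 < s"
  shows "norm (L s - 1) \<le> 1 / (s - 1)"
proof -
  let ?f = "\<lambda>n. \<psi> n * complex_of_real (real n powr - s)"
  have "(\<lambda>M. \<Sum>n<M. ?f n) \<longlonglongrightarrow> L s"
    unfolding L_def by (rule summable_LIMSEQ[OF summable_norm_cancel[OF summable_norms(1)[OF assms]]])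
  then have "(\<lambda>M. norm ((\<Sum>n<M. ?f n) - 1)) \<longlonglongrightarrow> norm (L s - 1)"
    by (intro tendsto_norm tendsto_diff tendsto_const)
  moreover have "norm ((\<Sum>n<M. ?f n) - 1) \<le> 1 / (s - 1)" if "2 \<le> M" for M
  proof -
    have "(\<Sum>n<M. ?f n) = (\<Sum>n<2. ?f n) + (\<Sum>n=2..<M. ?f n)"
      using sum.atLeastLessThan_concat[of 0 2 M ?f] that by (simp add: atLeast0LessThan)
    then have "norm ((\<Sum>n<M. ?f n) - 1) = norm (\<Sum>n=2..<M. ?f n)"
      by (simp add: numeral_2_eq_2)
    also have "\<dots> \<le> (\<Sum>n=2..<M. real n powr - s)"
      using norm_le_1 by (intro sum_norm_le) (simp add: norm_mult mult_left_le_one_le)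
    also have "\<dots> \<le> 1 / (s - 1)" by (rule sum_powr_tail_bound[OF assms])
    finally show ?thesis .
  qed
  ultimately show ?thesis by (intro LIMSEQ_le_const2) (auto intro!: exI[of _ 2])
qed

end

section \<open>Nonvanishing at 1\<close>

text \<open>The arithmetic-geometric mean inequality for the powers \<open>y ^ (2 * i)\<close>,
  whose geometric mean over \<open>i \<le> n\<close> is \<open>y ^ n\<close>.\<close>

lemma geometric_sum_lower_bound:
  fixes y :: real
  assumes "0 \<le> y" "y \<le> 1"
  shows "real (Suc n) * y ^ n \<le> (\<Sum>i<Suc n. (y\<^sup>2) ^ i)" "real n * y ^ n \<le> (\<Sum>i<n. (y\<^sup>2) ^ i)"
proof -
  have g: "real (Suc n) * y ^ n \<le> 1 + real n * y ^ Suc n" for n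
  proof (induction n)
    case (Suc n)
    have "0 \<le> (1 - y) * (1 - y ^ Suc n)" using assms power_le_one[of y "Suc n"] by (intro mult_nonneg_nonneg) (simp_all del: power_Suc)
    moreover have "y * (real (Suc n) * y ^ n) \<le> y * (1 + real n * y ^ Suc n)"
      using Suc assms by (intro mult_left_mono) auto
    ultimately show ?case by (simp add: algebra_simps)
  qed simp
  show 1: "real (Suc n) * y ^ n \<le> (\<Sum>i<Suc n. (y\<^sup>2) ^ i)" for n
  proof (induction n)
    case (Suc n)
    have "(\<Sum>i<Suc (Suc n). (y\<^sup>2) ^ i) = 1 + y\<^sup>2 * (\<Sum>i<Suc n. (y\<^sup>2) ^ i)"
      by (subst sum.lessThan_Suc_shift) (simp add: sum_distrib_left distrib_left)
    also have "\<dots> \<ge> 1 + y\<^sup>2 * (real (Suc n) * y ^ n)"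
      using Suc by (intro add_left_mono mult_left_mono) auto
    also have "1 + y\<^sup>2 * (real (Suc n) * y ^ n) = 1 + real (Suc n) * y ^ Suc (Suc n)"
      by (simp add: power2_eq_square)
    finally show ?case using g[of "Suc n"] by linarith
  qed simp
  show "real n * y ^ n \<le> (\<Sum>i<n. (y\<^sup>2) ^ i)"
  proof (cases n)
    case (Suc m)
    have "y ^ Suc m \<le> y ^ m" using assms by (intro power_decreasing) auto
    then have "real (Suc m) * y ^ Suc m \<le> real (Suc m) * y ^ m" by (intro mult_left_mono) auto
    then show ?thesis unfolding Suc using 1[of m] by (rule order_trans)
  qed simp
qed

text \<open>With \<open>S n\<close> the geometric sum,
  \<open>(1 - x) * b n = 1 / n - x ^ n / S n\<close>, and monotonicity reduces to
  \<open>n * (n + 1) * x ^ n \<le> S n * S (Suc n)\<close>. This is the product of the two preceding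
  inequalities for \<open>y = sqrt x\<close>.\<close>

lemma lambert_coefficient_antimono:
  fixes x :: real
  assumes x: "0 < x" "x < 1" and n: "1 \<le> n"
  defines "b \<equiv> \<lambda>n. 1 / (real n * (1 - x)) - x ^ n / (1 - x ^ n)"
  shows "b (Suc n) \<le> b n" "0 \<le> b n"
proof -
  define S where "S m = (\<Sum>i<m. x ^ i)" for m
  have S: "1 - x ^ m = (1 - x) * S m" for m unfolding S_def by (rule one_diff_power_eq)
  have Spos: "0 < S m" if "1 \<le> m" for m
    unfolding S_def using that x by (intro sum_pos) (auto simp: lessThan_empty_iff)
  have b: "b m = (1 / real m - x ^ m / S m) / (1 - x)" for m
    unfolding b_def S using x by (simp add: diff_divide_distrib mult.commute)
  have "0 \<le> sqrt x" "sqrt x \<le> 1" "(sqrt x)\<^sup>2 = x" using x by auto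
  then have S1: "real (Suc n) * sqrt x ^ n \<le> S (Suc n)" and S2: "real n * sqrt x ^ n \<le> S n"
    using geometric_sum_lower_bound[of "sqrt x" n] by (auto simp: S_def)
  have "(real n * sqrt x ^ n) * (real (Suc n) * sqrt x ^ n) \<le> S n * S (Suc n)"
    using S1 S2 Spos[of n] n x by (intro mult_mono) auto
  moreover have "sqrt x ^ n * sqrt x ^ n = x ^ n"
    using x by (simp flip: power_mult_distrib)
  ultimately have SS: "real n * real (Suc n) * x ^ n \<le> S n * S (Suc n)"
    by (metis (no_types, opaque_lifting) mult.assoc mult.left_commute)
  have "S (Suc n) - x * S n = 1"
    unfolding S_def by (subst sum.lessThan_Suc_shift) (simp add: sum_distrib_left)
  then have "x ^ n / S n - x ^ Suc n / S (Suc n) = x ^ n / (S n * S (Suc n))"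
    using Spos[of n] Spos[of "Suc n"] n by (simp add: field_simps)
  also have "\<dots> \<le> 1 / (real n * real (Suc n))"
    using SS Spos[of n] Spos[of "Suc n"] n by (simp add: divide_simps mult_ac)
  also have "\<dots> = 1 / real n - 1 / real (Suc n)" using n by (simp add: field_simps)
  finally show "b (Suc n) \<le> b n" unfolding b using x by (intro divide_right_mono) auto
  have "x ^ n * real n \<le> S n"
  proof -
    have "(\<Sum>i<n. x ^ n) \<le> S n" unfolding S_def using x by (intro sum_mono power_decreasing) auto
    then show ?thesis by (simp add: mult.commute)
  qed
  then have "x ^ n / S n \<le> 1 / real n" using Spos[of n] n by (simp add: field_simps)
  then show "0 \<le> b n" unfolding b using x by simp
qed

section \<open>Real characters: nonvanishing through Lambert series\<close>

locale real_multiplicative =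
  fixes a :: "nat \<Rightarrow> real"
  assumes mult: "a (m * n) = a m * a n"
    and trivalued: "a n \<in> {- 1, 0, 1}"
    and one: "a 1 = 1"
    and zero: "a 0 = 0"
begin

definition dsum :: "nat \<Rightarrow> real" where "dsum m = (\<Sum>d | d dvd m. a d)"

lemma dsum_coprime_mult:
  assumes "coprime m n" "0 < m" "0 < n"
  shows "dsum (m * n) = dsum m * dsum n"
proof -
  have "dsum m * dsum n = (\<Sum>(d, e)\<in>{d. d dvd m} \<times> {e. e dvd n}. a (d * e))"
    by (simp add: dsum_def sum_product sum.cartesian_product mult)
  also have "\<dots> = dsum (m * n)"
    unfolding dsum_def
  proof (rule sum.reindex_bij_witness[where i = "\<lambda>d. (gcd d m, d div gcd d m)" and j = "\<lambda>(d, e). d * e"])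
    fix d assume d: "d \<in> {d. d dvd m * n}"
    show "(case (gcd d m, d div gcd d m) of (d, e) \<Rightarrow> d * e) = d" by simp
    define g where "g = gcd d m"
    have g: "g dvd d" "g dvd m" "0 < g" using assms by (auto simp: g_def)
    have "d div g dvd (m div g) * n"
    proof -
      obtain d' m' where d': "d = g * d'" "m = g * m'" using g by (auto elim!: dvdE)
      then have "g * d' dvd g * (m' * n)" using d by (simp add: mult.assoc)
      then show ?thesis using d' g(3) by simp
    qed
    moreover have "coprime (d div g) (m div g)" unfolding g_def
      using assms by (intro div_gcd_coprime) auto
    ultimately have "d div g dvd n" by (simp add: coprime_dvd_mult_right_iff)
    then show "(gcd d m, d div gcd d m) \<in> {d. d dvd m} \<times> {e. e dvd n}" by (simp add: g_def)
  next
    fix z assume "z \<in> {d. d dvd m} \<times> {e. e dvd n}"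
    then obtain d e where z: "z = (d, e)" "d dvd m" "e dvd n" by auto
    have "coprime e m" using assms(1) z(2,3)
      by (meson coprime_commute coprime_divisors dvd_refl)
    then have "gcd (d * e) m = gcd d m" by (simp add: gcd_mult_left_right_cancel coprime_commute)
    then have "gcd (d * e) m = d" using z(2) by simp
    moreover have "0 < d" using z assms by (auto intro: gr0I)
    ultimately show "(gcd (case z of (d, e) \<Rightarrow> d * e) m,
        (case z of (d, e) \<Rightarrow> d * e) div gcd (case z of (d, e) \<Rightarrow> d * e) m) = z" using z by simp
    show "(case z of (d, e) \<Rightarrow> d * e) \<in> {d. d dvd m * n}" using z by (auto intro: mult_dvd_mono)
  qed auto
  finally show ?thesis by simp
qed

text \<open>At a prime power \<open>dsum\<close> is a sum of powers of \<open>a p\<close>. For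
  \<open>a p = - 1\<close> it alternates between 1 and 0, which is why squares are the arguments
  with a guaranteed contribution.\<close>

lemma dsum_prime_power:
  assumes "prime p"
  shows "0 \<le> dsum (p ^ k)" "even k \<Longrightarrow> 1 \<le> dsum (p ^ k)"
proof -
  have pow: "a (p ^ i) = a p ^ i" for i using one by (induction i) (auto simp: mult)
  have "{d. d dvd p ^ k} = (\<lambda>i. p ^ i) ` {..k}" using divides_primepow_nat[OF assms] by auto
  moreover have "inj_on (\<lambda>i. p ^ i) {..k}"
    using prime_gt_1_nat[OF assms] by (auto simp: inj_on_def power_inject_exp)
  ultimately have eq: "dsum (p ^ k) = (\<Sum>i\<le>k. a p ^ i)"
    by (simp add: dsum_def sum.reindex pow)
  consider "a p = 1" | "a p = 0" | "a p = - 1" using trivalued[of p] by auto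
  then have "0 \<le> (\<Sum>i\<le>k. a p ^ i) \<and> (even k \<longrightarrow> 1 \<le> (\<Sum>i\<le>k. a p ^ i))"
  proof cases
    case 3
    have "(\<Sum>i\<le>k. (- 1 :: real) ^ i) = (if even k then 1 else 0)"
      by (induction k) auto
    then show ?thesis using 3 by simp
  qed (auto simp: power_0_left sum.delta)
  then show "0 \<le> dsum (p ^ k)" "even k \<Longrightarrow> 1 \<le> dsum (p ^ k)" by (auto simp: eq)
qed

lemma dsum_nonneg:
  assumes "0 < m"
  shows "0 \<le> dsum m"
  using assms
proof (induction m rule: less_induct)
  case (less m)
  show ?case
  proof (cases "m = 1")
    case False
    then obtain p where p: "prime p" "p dvd m" using prime_factor_nat by blast
    define k where "k = multiplicity p m"
    obtain m' where m': "m = p ^ k * m'" "\<not> p dvd m'" unfolding k_def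
      using multiplicity_decompose'[of m p] p less.prems by (metis not_prime_unit neq0_conv)
    have "0 < m'" using m' less.prems by (auto intro: gr0I)
    have "k \<noteq> 0" using p m' by (auto intro: gr0I)
    then have "1 < p ^ k" using prime_gt_1_nat[OF p(1)] by (intro one_less_power) auto
    then have "m' < m" using \<open>0 < m'\<close> m' by simp
    moreover have "coprime (p ^ k) m'" using p m' by (simp add: prime_imp_coprime)
    ultimately show ?thesis
      using less.IH[of m'] \<open>0 < m'\<close> dsum_prime_power(1)[OF p(1), of k] dsum_coprime_mult[of "p ^ k" m'] m'
        prime_gt_0_nat[OF p(1)] by simp
  qed (simp add: dsum_def one[simplified])
qed

lemma dsum_square:
  assumes "0 < m"
  shows "1 \<le> dsum (m\<^sup>2)"
  using assms
proof (induction m rule: less_induct)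
  case (less m)
  show ?case
  proof (cases "m = 1")
    case False
    then obtain p where p: "prime p" "p dvd m" using prime_factor_nat by blast
    define k where "k = multiplicity p m"
    obtain m' where m': "m = p ^ k * m'" "\<not> p dvd m'" unfolding k_def
      using multiplicity_decompose'[of m p] p less.prems by (metis not_prime_unit neq0_conv)
    have "0 < m'" using m' less.prems by (auto intro: gr0I)
    have "k \<noteq> 0" using p m' by (auto intro: gr0I)
    then have "1 < p ^ k" using prime_gt_1_nat[OF p(1)] by (intro one_less_power) auto
    then have "m' < m" using \<open>0 < m'\<close> m' by simp
    then have "1 \<le> dsum (m'\<^sup>2)" using less.IH \<open>0 < m'\<close> by blast
    moreover have "1 \<le> dsum (p ^ (2 * k))" using dsum_prime_power(2)[OF p(1), of "2 * k"] by simp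
    moreover have "coprime (p ^ (2 * k)) (m'\<^sup>2)" using p m' by (simp add: prime_imp_coprime)
    moreover have "m\<^sup>2 = p ^ (2 * k) * m'\<^sup>2" by (simp add: m' power_mult_distrib power_mult mult.commute flip: power_mult)
    ultimately show ?thesis
      using dsum_coprime_mult[of "p ^ (2 * k)" "m'\<^sup>2"] \<open>0 < m'\<close> prime_gt_0_nat[OF p(1)]
        mult_mono[of 1 "dsum (p ^ (2 * k))" 1 "dsum (m'\<^sup>2)"] by simp
  qed (simp add: dsum_def one[simplified])
qed

text \<open>
  Monsky's argument: if the series vanished, then \<open>\<Sum> a n * x ^ n / (1 - x ^ n)\<close> would be bounded
  on \<open>(0, 1)\<close>, being \<open>- \<Sum> a n * b n\<close> with the decreasing \<open>b\<close> of \<open>lambert_coefficient_antimono\<close>.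
  But it equals \<open>\<Sum> dsum n * x ^ n\<close>, which is unbounded because of the squares.
\<close>

theorem series_nonzero:
  assumes B: "\<And>M. \<bar>\<Sum>n<M. a n\<bar> \<le> B"
  shows "(\<Sum>n. a n / real n) \<noteq> 0"
proof
  assume zero_sum: "(\<Sum>n. a n / real n) = 0"
  obtain K :: nat where K: "4 * B < real K" using reals_Archimedean2 by blast
  have "0 \<le> B" using B[of 0] by simp
  then have K0: "0 < K" using K by (auto intro: gr0I)
  \<comment> \<open>With this \<open>x\<close> every square \<open>k ^ 2\<close> for
    \<open>k \<le> K\<close> has weight \<open>x ^ (k ^ 2) \<ge> 1 / 2\<close>, so the squares alone
    contribute at least \<open>K / 2\<close>, more than the upper bound
    \<open>2 * B\<close>.\<close>
  define x :: real where "x = (1 / 2) powr (1 / real (K\<^sup>2))"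
  have xK: "x ^ (K\<^sup>2) = 1 / 2" using K0 by (simp add: x_def powr_power)
  have x: "0 < x" "x < 1"
  proof -
    show "0 < x" by (simp add: x_def)
    have "x < (1 / 2) powr 0" unfolding x_def using K0 by (intro powr_less_mono') auto
    then show "x < 1" by simp
  qed
  have abs_a: "\<bar>a n\<bar> \<le> 1" for n using trivalued[of n] by auto
  have x_pow: "x ^ n \<le> x" if "1 \<le> n" for n using that x power_decreasing[of 1 n x] by simp
  define c where "c n = a n * (x ^ n / (1 - x ^ n))" for n
  have norm_c: "norm (c n) \<le> (1 / (1 - x)) * x ^ n" for n
  proof (cases "n = 0")
    case False
    have xn: "x ^ n \<le> x" using False by (intro x_pow) simp
    have "x ^ n / (1 - x ^ n) \<le> x ^ n / (1 - x)" using x xn by (intro frac_le) auto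
    moreover have "0 \<le> x ^ n / (1 - x ^ n)" using x xn by (intro divide_nonneg_nonneg) auto
    ultimately have "\<bar>a n\<bar> * (x ^ n / (1 - x ^ n)) \<le> 1 * (x ^ n / (1 - x))"
      using abs_a[of n] by (intro mult_mono) auto
    moreover have "norm (c n) = \<bar>a n\<bar> * (x ^ n / (1 - x ^ n))"
      using \<open>0 \<le> x ^ n / (1 - x ^ n)\<close> by (simp only: c_def real_norm_def abs_mult abs_of_nonneg)
    ultimately show ?thesis by simp
  qed (use x in \<open>simp add: c_def zero\<close>)
  have c_summable: "summable (\<lambda>n. norm (c n))"
  proof (rule summable_comparison_test'[where N = 0])
    show "summable (\<lambda>n. (1 / (1 - x)) * x ^ n)" using x by (intro summable_mult summable_geometric) auto
    show "norm (norm (c n)) \<le> (1 / (1 - x)) * x ^ n" for n using norm_c[of n] by simp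
  qed
  \<comment> \<open>Subtracting \<open>c\<close> from the vanishing series divided by
    \<open>1 - x\<close> leaves the terms \<open>a n * b n\<close>. Since \<open>b 1 = 1\<close>,
    the Abel bound does not depend on \<open>x\<close>.\<close>
  have upper: "\<bar>suminf c\<bar> \<le> 2 * B"
  proof -
    define b where "b n = 1 / (real n * (1 - x)) - x ^ n / (1 - x ^ n)" for n
    have "\<bar>\<Sum>n<M. a n * b n\<bar> \<le> 2 * B" for M
    proof -
      have "(\<Sum>n<M. a n * b n) = (\<Sum>n=1..<M. a n * b n)"
        by (rule sum.mono_neutral_right) (auto simp: zero not_le)
      also have "\<bar>\<dots>\<bar> \<le> 2 * B * b 1"
        using lambert_coefficient_antimono[OF x] by (intro abel_summation_bound[OF B]) (auto simp: b_def)
      also have "b 1 = 1" using x by (simp add: b_def field_simps)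
      finally show ?thesis by simp
    qed
    moreover have "(\<lambda>M. \<bar>\<Sum>n<M. a n * b n\<bar>) \<longlonglongrightarrow> \<bar>0 - suminf c\<bar>"
    proof -
      have "(\<lambda>M. \<Sum>n<M. a n / real n) \<longlonglongrightarrow> 0"
        using summable_LIMSEQ[OF summable_dirichlet_1[OF B]] zero_sum by simp
      then have "(\<lambda>M. (\<Sum>n<M. a n / real n) / (1 - x) - (\<Sum>n<M. c n)) \<longlonglongrightarrow> 0 / (1 - x) - suminf c"
        using x summable_LIMSEQ[OF summable_norm_cancel[OF c_summable]]
        by (intro tendsto_diff tendsto_divide tendsto_const) auto
      moreover have "(\<Sum>n<M. a n / real n) / (1 - x) - (\<Sum>n<M. c n) = (\<Sum>n<M. a n * b n)" for M
        by (simp add: b_def c_def right_diff_distrib sum_subtractf sum_divide_distrib)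
      ultimately show ?thesis by (intro tendsto_rabs) simp
    qed
    ultimately show ?thesis by (intro LIMSEQ_le_const2[where X = "\<lambda>M. \<bar>\<Sum>n<M. a n * b n\<bar>"]) auto
  qed
  \<comment> \<open>Expanding every \<open>x ^ d / (1 - x ^ d)\<close> geometrically and regrouping
    by \<open>d * k\<close> turns the Lambert series into the power series of
    \<open>dsum\<close>.\<close>
  have geom: "((\<lambda>k. x ^ (d * k)) has_sum x ^ d / (1 - x ^ d)) {1..}" if d: "1 \<le> d" for d
  proof -
    have xd: "0 \<le> x ^ d" "x ^ d < 1" using x x_pow[OF d] by auto
    have "(\<lambda>k. (x ^ d) ^ Suc k) sums (x ^ d * (1 / (1 - x ^ d)))"
      unfolding power_Suc using xd by (intro sums_mult geometric_sums) auto
    then have "((\<lambda>k. (x ^ d) ^ Suc k) has_sum (x ^ d * (1 / (1 - x ^ d)))) UNIV"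
      using xd by (intro sums_nonneg_imp_has_sum) auto
    also have "?this \<longleftrightarrow> ((\<lambda>k. x ^ (d * k)) has_sum x ^ d / (1 - x ^ d)) {1..}"
      by (rule has_sum_reindex_bij_witness[where i = "\<lambda>k. k - 1" and j = Suc])
        (auto simp: power_mult power_add)
    finally show ?thesis .
  qed
  have "((\<lambda>(d, k). a d * x ^ (d * k)) has_sum suminf c) ({1..} \<times> {1..})"
  proof (rule has_sum_SigmaI)
    show "((\<lambda>k. case (d, k) of (d, k) \<Rightarrow> a d * x ^ (d * k)) has_sum c d) {1..}" if "d \<in> {1..}" for d
      unfolding c_def using has_sum_cmult_right[OF geom] that by simp
    have "(c has_sum suminf c) UNIV"
      by (rule norm_summable_imp_has_sum[OF c_summable summable_sums[OF summable_norm_cancel[OF c_summable]]])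
    also have "?this \<longleftrightarrow> (c has_sum suminf c) {1..}"
      by (intro has_sum_cong_neutral) (auto simp: c_def zero not_le)
    finally show "(c has_sum suminf c) {1..}" .
    have "(\<lambda>(d, k). x ^ (d * k)) summable_on ({1..} \<times> {1..})"
    proof (rule summable_on_SigmaI)
      show "((\<lambda>k. case (d, k) of (d, k) \<Rightarrow> x ^ (d * k)) has_sum x ^ d / (1 - x ^ d)) {1..}"
        if "d \<in> {1..}" for d using geom that by simp
      have "summable (\<lambda>n. norm (x ^ n / (1 - x)))"
        using x by (simp add: summable_divide summable_geometric)
      then have "(\<lambda>n. x ^ n / (1 - x)) summable_on UNIV" by (rule norm_summable_imp_summable_on)
      then have "(\<lambda>n. x ^ n / (1 - x)) summable_on {1..}" by (rule summable_on_subset_banach) simp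
      then show "(\<lambda>d. x ^ d / (1 - x ^ d)) summable_on {1..}"
      proof (rule summable_on_comparison_test)
        fix d :: nat assume "d \<in> {1..}"
        then have "x ^ d \<le> x" by (intro x_pow) simp
        then show "x ^ d / (1 - x ^ d) \<le> x ^ d / (1 - x)" "0 \<le> x ^ d / (1 - x ^ d)"
          using x by (auto intro!: frac_le divide_nonneg_nonneg)
      qed
    qed (use x in auto)
    then show "(\<lambda>(d, k). a d * x ^ (d * k)) summable_on ({1..} \<times> {1..})"
    proof (rule abs_summable_summable[OF summable_on_comparison_test])
      fix z :: "nat \<times> nat"
      show "norm (case z of (d, k) \<Rightarrow> a d * x ^ (d * k)) \<le> (case z of (d, k) \<Rightarrow> x ^ (d * k))"
        using abs_a x by (auto simp: abs_mult mult_left_le_one_le split: prod.splits)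
    qed auto
  qed
  then have "((\<lambda>n. \<Sum>d | d dvd n. a d * x ^ (d * (n div d))) has_sum suminf c) {1..}"
    by (rule has_sum_divisor_sums)
  moreover have "(\<Sum>d | d dvd n. a d * x ^ (d * (n div d))) = dsum n * x ^ n" for n
    unfolding dsum_def sum_distrib_right by (intro sum.cong) auto
  ultimately have hs: "((\<lambda>n. dsum n * x ^ n) has_sum suminf c) {1..}" by simp
  have "real K * (1 / 2) = (\<Sum>k\<in>{1..K}. x ^ (K\<^sup>2))" by (simp add: xK)
  also have "\<dots> \<le> (\<Sum>k\<in>{1..K}. dsum (k\<^sup>2) * x ^ (k\<^sup>2))"
  proof (rule sum_mono)
    fix k assume k: "k \<in> {1..K}"
    have "x ^ (K\<^sup>2) \<le> x ^ (k\<^sup>2)" using x k by (intro power_decreasing) auto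
    also have "\<dots> \<le> dsum (k\<^sup>2) * x ^ (k\<^sup>2)"
      using dsum_square[of k] k x by (intro mult_le_cancel_right1[THEN iffD2]) auto
    finally show "x ^ (K\<^sup>2) \<le> dsum (k\<^sup>2) * x ^ (k\<^sup>2)" .
  qed
  also have "\<dots> = (\<Sum>n\<in>(\<lambda>k. k\<^sup>2) ` {1..K}. dsum n * x ^ n)"
    by (subst sum.reindex) (auto simp: inj_on_def power2_eq_iff_nonneg)
  also have "\<dots> \<le> suminf c"
    using dsum_nonneg x by (intro finite_sum_le_has_sum[OF hs]) (auto simp: Suc_le_eq)
  finally show False using upper K by linarith
qed

end

section \<open>Characters with nonprincipal square: the 3-4-1 inequality\<close>

context dirichlet_character
begin

lemma principal_character: "dirichlet_character N (\<lambda>n. if coprime n N then 1 else 0)"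
proof -
  have "coprime (a + N) N \<longleftrightarrow> coprime a N" for a
    by (metis coprime_iff_gcd_eq_1 gcd_add1)
  then show ?thesis using modulus by unfold_locales (auto simp: coprime_mult_left_iff)
qed

lemma square_character: "dirichlet_character N (\<lambda>n. (\<psi> n)\<^sup>2)"
  using modulus unit nonunit by unfold_locales (auto simp: mult periodic power_mult_distrib norm_power)

lemma norm_L_3_ge: "1 / 2 \<le> norm (L 3)"
  using norm_L_minus_1_le[of 3] norm_triangle_ineq3[of "L 3" 1] by simp

text \<open>Multiplication by the unit \<open>a\<close> permutes the residues, so the sum equals
  \<open>\<psi> a\<close> times itself.\<close>

lemma sum_period:
  assumes a: "coprime a N" "\<psi> a \<noteq> 1"
  shows "(\<Sum>n<N. \<psi> n) = 0"
proof -
  have "inj_on (\<lambda>n. a * n mod N) {..<N}"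
  proof
    fix m n assume mn: "m \<in> {..<N}" "n \<in> {..<N}" "a * m mod N = a * n mod N"
    then have "[a * m = a * n] (mod N)" by (simp add: Cong.cong_def)
    then have "[m = n] (mod N)" using a by (simp add: cong_mult_lcancel_nat)
    then show "m = n" using mn cong_less_modulus_unique_nat by auto
  qed
  moreover have "(\<lambda>n. a * n mod N) ` {..<N} \<subseteq> {..<N}" using modulus by auto
  ultimately have "bij_betw (\<lambda>n. a * n mod N) {..<N} {..<N}"
    using endo_inj_surj[of "{..<N}"] by (auto simp: bij_betw_def)
  then have "(\<Sum>n<N. \<psi> n) = (\<Sum>n<N. \<psi> (a * n mod N))"
    using sum.reindex_bij_betw[of _ "{..<N}" "{..<N}" \<psi>] by metis
  also have "\<dots> = (\<Sum>n<N. \<psi> a * \<psi> n)"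
  proof (intro sum.cong refl)
    fix n show "\<psi> (a * n mod N) = \<psi> a * \<psi> n"
      using cong_eq[of "a * n mod N" "a * n"] by (simp add: mult)
  qed
  also have "\<dots> = \<psi> a * (\<Sum>n<N. \<psi> n)" by (simp add: sum_distrib_left)
  finally show ?thesis using a by simp
qed

text \<open>Candidate for the value of \<open>L\<close> at 1. Real and imaginary parts are summed
  separately because the estimates near 1 concern real coefficients; \<open>L_near_1\<close>
  justifies the name for nonprincipal characters.\<close>

definition L1 :: complex where
  "L1 = Complex (\<Sum>n. Re (\<psi> n) / real n) (\<Sum>n. Im (\<psi> n) / real n)"

text \<open>
  The logarithmic derivative of the square of the product below is
  \<open>- 2 \<Sum> mangoldt n * n powr (- s) * (3 \<psi>0 n + 4 Re (\<psi> n) + Re ((\<psi> n)\<^sup>2))\<close>, and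
  \<open>3 + 4 x + (2 x\<^sup>2 - 1) = 2 (1 + x)\<^sup>2\<close>; so the product decreases in \<open>s\<close>.
\<close>

lemma three_four_one:
  defines "\<psi>0 \<equiv> \<lambda>n. if coprime n N then 1 else 0" and "\<psi>2 \<equiv> \<lambda>n. (\<psi> n)\<^sup>2"
  assumes s: "1 < s" "s \<le> 3"
  shows "(1 / 2) ^ 16 \<le> norm (dirichlet_character.L \<psi>0 s) ^ 6 * norm (L s) ^ 8 *
    norm (dirichlet_character.L \<psi>2 s) ^ 2"
proof -
  interpret P: dirichlet_character N \<psi>0 unfolding \<psi>0_def by (rule principal_character)
  interpret S: dirichlet_character N \<psi>2 unfolding \<psi>2_def by (rule square_character)
  define h where "h t = ((norm (P.L t))\<^sup>2) ^ 3 * ((norm (L t))\<^sup>2) ^ 4 * (norm (S.L t))\<^sup>2" for t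
  have "h 3 \<le> h s"
  proof (rule DERIV_nonpos_imp_nonincreasing[OF s(2)])
    fix t assume "s \<le> t" "t \<le> 3"
    then have t: "1 < t" using s by simp
    define D where "D = 3 * Re (P.L_mangoldt t) + 4 * Re (L_mangoldt t) + Re (S.L_mangoldt t)"
    have "(h has_real_derivative - 2 * D * h t) (at t)"
      unfolding h_def D_def
      by (rule derivative_eq_intros P.norm_L_squared_has_derivative[OF t]
          norm_L_squared_has_derivative[OF t] S.norm_L_squared_has_derivative[OF t] refl)+
        (simp add: algebra_simps power_numeral_reduce)
    moreover have "0 \<le> D"
    proof -
      let ?m = "\<lambda>n. mangoldt n * real n powr - t"
      have sm: "summable (\<lambda>n. Re (\<psi>0 n) * ?m n)" "summable (\<lambda>n. Re (\<psi> n) * ?m n)"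
        "summable (\<lambda>n. Re (\<psi>2 n) * ?m n)"
        using P.summable_norms(3)[OF t, THEN summable_norm_cancel, THEN summable_Re]
          summable_norms(3)[OF t, THEN summable_norm_cancel, THEN summable_Re]
          S.summable_norms(3)[OF t, THEN summable_norm_cancel, THEN summable_Re] by simp_all
      have "(\<lambda>n. 3 * (Re (\<psi>0 n) * ?m n) + 4 * (Re (\<psi> n) * ?m n) + Re (\<psi>2 n) * ?m n) sums D"
        unfolding D_def P.Re_Im_L(5)[OF t] Re_Im_L(5)[OF t] S.Re_Im_L(5)[OF t]
        using sm by (intro sums_add sums_mult summable_sums)
      then have "D = (\<Sum>n. 3 * (Re (\<psi>0 n) * ?m n) + 4 * (Re (\<psi> n) * ?m n) + Re (\<psi>2 n) * ?m n)"
        by (rule sums_unique)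
      also have "\<dots> \<ge> 0"
      proof (rule suminf_nonneg)
        show "summable (\<lambda>n. 3 * (Re (\<psi>0 n) * ?m n) + 4 * (Re (\<psi> n) * ?m n) + Re (\<psi>2 n) * ?m n)"
          using sm by (intro summable_add summable_mult)
        fix n
        have "0 \<le> 3 * Re (\<psi>0 n) + 4 * Re (\<psi> n) + Re (\<psi>2 n)"
        proof (cases "coprime n N")
          case True
          then have "(Re (\<psi> n))\<^sup>2 + (Im (\<psi> n))\<^sup>2 = 1" using unit[of n] by (simp flip: cmod_power2)
          then have "3 * Re (\<psi>0 n) + 4 * Re (\<psi> n) + Re (\<psi>2 n) = 2 * (1 + Re (\<psi> n))\<^sup>2"
            using True by (simp add: \<psi>0_def \<psi>2_def power2_eq_square algebra_simps)
          then show ?thesis by simp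
        qed (simp add: \<psi>0_def \<psi>2_def nonunit)
        then have "0 \<le> (3 * Re (\<psi>0 n) + 4 * Re (\<psi> n) + Re (\<psi>2 n)) * ?m n"
          by (intro mult_nonneg_nonneg) (auto simp: mangoldt_nonneg)
        then show "0 \<le> 3 * (Re (\<psi>0 n) * ?m n) + 4 * (Re (\<psi> n) * ?m n) + Re (\<psi>2 n) * ?m n"
          by (simp add: algebra_simps)
      qed
      finally show ?thesis .
    qed
    moreover have "0 \<le> h t" by (simp add: h_def)
    ultimately show "\<exists>y. (h has_real_derivative y) (at t) \<and> y \<le> 0"
      by (intro exI[of _ "- 2 * D * h t"]) (simp add: mult_nonneg_nonneg)
  qed
  \<comment> \<open>At 3 each norm is at least 1/2, and the exponents 6, 8 and 2 add up to
    16.\<close>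
  moreover have "(1 / 2) ^ 6 * (1 / 2) ^ 8 * (1 / 2) ^ 2 \<le>
      norm (P.L 3) ^ 6 * norm (L 3) ^ 8 * norm (S.L 3) ^ 2"
    by (intro mult_mono power_mono P.norm_L_3_ge norm_L_3_ge S.norm_L_3_ge) auto
  ultimately show ?thesis by (simp add: h_def power_mult[symmetric])
qed

end

section \<open>Nonprincipal characters near 1\<close>

locale nonprincipal_character = dirichlet_character +
  assumes nonprincipal: "\<exists>a. coprime a N \<and> \<psi> a \<noteq> 1"
begin

lemma partial_sum_bound: "norm (\<Sum>n<M. \<psi> n) \<le> real N"
proof (induction M rule: less_induct)
  case (less M)
  show ?case
  proof (cases "M < N")
    case True
    have "norm (\<Sum>n<M. \<psi> n) \<le> (\<Sum>n<M. 1)" by (intro sum_norm_le norm_le_1)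
    then show ?thesis using True by simp
  next
    case False
    then obtain M' where M': "M = M' + N" using le_Suc_ex by (metis add.commute not_le)
    have "(\<Sum>n<M. \<psi> n) = (\<Sum>n<N. \<psi> n) + (\<Sum>n=0+N..<M'+N. \<psi> n)"
      using sum.atLeastLessThan_concat[of 0 N M \<psi>] M' by (simp add: atLeast0LessThan)
    also have "(\<Sum>n=0+N..<M'+N. \<psi> n) = (\<Sum>n<M'. \<psi> n)"
      unfolding sum.shift_bounds_nat_ivl by (simp add: atLeast0LessThan periodic)
    also have "(\<Sum>n<N. \<psi> n) = 0" using nonprincipal sum_period by blast
    finally show ?thesis using less[of M'] M' modulus by simp
  qed
qed

lemma partial_sum_bound_Re: "\<bar>\<Sum>n<M. Re (\<psi> n)\<bar> \<le> real N"
  using order_trans[OF abs_Re_le_cmod partial_sum_bound, of M] by simp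

lemma partial_sum_bound_Im: "\<bar>\<Sum>n<M. Im (\<psi> n)\<bar> \<le> real N"
  using order_trans[OF abs_Im_le_cmod partial_sum_bound, of M] by simp

text \<open>The factor 2 passes from real and imaginary parts to the norm; \<open>1 + 2 * N\<close>
  is the derivative bound for coefficients with partial sums bounded by \<open>N\<close>.\<close>

definition C :: real where "C = 2 * (1 + 2 * real N)"

lemma C_pos: "0 < C" by (simp add: C_def)

lemma L_near_1:
  assumes "1 < s"
  shows "norm (L s - L1) \<le> C * (s - 1)"
proof -
  have "\<bar>Re (L s - L1)\<bar> \<le> (1 + 2 * real N) * (s - 1)"
    using dirichlet_series_near_1[OF abs_Re_Im_le(1) partial_sum_bound_Re assms]
    by (simp add: Re_Im_L[OF assms] L1_def)
  moreover have "\<bar>Im (L s - L1)\<bar> \<le> (1 + 2 * real N) * (s - 1)"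
    using dirichlet_series_near_1[OF abs_Re_Im_le(2) partial_sum_bound_Im assms]
    by (simp add: Re_Im_L[OF assms] L1_def)
  ultimately show ?thesis using cmod_le[of "L s - L1"] by (simp add: C_def algebra_simps)
qed

lemma L_ln_bound:
  assumes "1 < s"
  shows "norm (L_ln s) \<le> C"
proof -
  have "\<bar>Re (L_ln s)\<bar> \<le> 1 + 2 * real N" "\<bar>Im (L_ln s)\<bar> \<le> 1 + 2 * real N"
    unfolding Re_Im_L[OF assms]
    using ln_series_bound[OF abs_Re_Im_le(1) partial_sum_bound_Re assms]
      ln_series_bound[OF abs_Re_Im_le(2) partial_sum_bound_Im assms] by auto
  then show ?thesis using cmod_le[of "L_ln s"] by (simp add: C_def)
qed

text \<open>If \<open>(\<psi> n)\<^sup>2\<close> is nonprincipal, a zero at 1 would make the 3-4-1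
  product at \<open>1 + e\<close> at most a constant times \<open>e ^ (8 - 6)\<close>, against its
  positive lower bound. If the square is principal, its own factor may grow like
  \<open>1 / e\<close> and cancel this gain; but then \<open>\<psi>\<close> is real and
  \<open>series_nonzero\<close> applies.\<close>

lemma L1_nonzero: "L1 \<noteq> 0"
proof (cases "\<exists>a. coprime a N \<and> (\<psi> a)\<^sup>2 \<noteq> 1")
  case True
  interpret S: nonprincipal_character N "\<lambda>n. (\<psi> n)\<^sup>2"
    using square_character True by (simp add: nonprincipal_character_def nonprincipal_character_axioms_def)
  interpret P: dirichlet_character N "\<lambda>n. if coprime n N then 1 else 0" by (rule principal_character)
  show ?thesis
  proof
    assume "L1 = 0"
    define K where "K = norm S.L1 + S.C"
    define c where "c = 2 ^ 6 * C ^ 8 * K\<^sup>2"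
    have "0 \<le> K" "0 \<le> c" using S.C_pos C_pos by (auto simp: K_def c_def)
    have small: "(1 / 2) ^ 16 \<le> c * e" if e: "0 < e" "e \<le> 1" for e
    proof -
      let ?s = "1 + e"
      have "norm (P.L ?s) \<le> 1 + 1 / e"
        using P.norm_L_minus_1_le[of ?s] norm_triangle_ineq3[of "P.L ?s" 1] e by simp
      also have "\<dots> \<le> 2 / e" using e by (simp add: field_simps)
      finally have 1: "norm (P.L ?s) \<le> 2 / e" .
      have 2: "norm (L ?s) \<le> C * e" using L_near_1[of ?s] \<open>L1 = 0\<close> e by simp
      have "norm (S.L ?s) \<le> norm S.L1 + S.C * e"
        using S.L_near_1[of ?s] norm_triangle_ineq2[of "S.L ?s" S.L1] e by simp
      also have "\<dots> \<le> K" using e S.C_pos by (simp add: K_def)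
      finally have 3: "norm (S.L ?s) \<le> K" .
      have "(1 / 2) ^ 16 \<le> norm (P.L ?s) ^ 6 * norm (L ?s) ^ 8 * norm (S.L ?s) ^ 2"
        using three_four_one[of ?s] e by simp
      also have "\<dots> \<le> (2 / e) ^ 6 * (C * e) ^ 8 * K ^ 2"
        using 1 2 3 e C_pos by (intro mult_mono power_mono) auto
      also have "\<dots> = c * e\<^sup>2" using e by (simp add: c_def power_mult_distrib power_divide field_simps power_numeral_reduce)
      also have "\<dots> \<le> c * e" using e \<open>0 \<le> c\<close> by (intro mult_left_mono) (auto simp: power2_eq_square mult_left_le)
      finally show ?thesis .
    qed
    define e where "e = min 1 ((1 / 2) ^ 17 / (c + 1))"
    have e: "0 < e" "e \<le> 1" using \<open>0 \<le> c\<close> by (auto simp: e_def)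
    have "c * e \<le> (c + 1) * ((1 / 2) ^ 17 / (c + 1))"
      using \<open>0 \<le> c\<close> e by (intro mult_mono) (auto simp: e_def)
    also have "\<dots> = (1 / 2) ^ 17" using \<open>0 \<le> c\<close> by simp
    also have "\<dots> < (1 / 2 :: real) ^ 16" by (rule power_strict_decreasing) auto
    finally show False using small[OF e] by linarith
  qed
next
  case False
  have real: "\<psi> n \<in> {- 1, 0, 1}" for n
    using False nonunit[of n] by (cases "coprime n N") (auto simp: power2_eq_1_iff)
  have Im0: "Im (\<psi> n) = 0" for n using real[of n] by auto
  have Re: "Re (\<psi> n) \<in> {- 1, 0, 1}" for n using real[of n] by auto
  interpret R: real_multiplicative "\<lambda>n. Re (\<psi> n)"
    by unfold_locales (use Re in \<open>simp_all add: mult Im0\<close>)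
  have "Re L1 \<noteq> 0" using R.series_nonzero[OF partial_sum_bound_Re] by (simp add: L1_def)
  then show ?thesis by auto
qed

text \<open>Here nonvanishing enters: near 1 the norm of \<open>L\<close> stays above half that of
  \<open>L1\<close>, while \<open>L_ln\<close> is bounded by \<open>C\<close>.\<close>

lemma L_mangoldt_bounded: "\<exists>b>1. \<exists>K. \<forall>s. 1 < s \<and> s < b \<longrightarrow> norm (L_mangoldt s) \<le> K"
proof -
  have pos: "0 < norm L1" using L1_nonzero by simp
  have "norm (L_mangoldt s) \<le> C / (norm L1 / 2)" if s: "1 < s \<and> s < 1 + norm L1 / (2 * C)" for s
  proof -
    have "C * (s - 1) < C * (norm L1 / (2 * C))" using C_pos s by (intro mult_strict_left_mono) auto
    also have "\<dots> = norm L1 / 2" using C_pos by simp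
    finally have "norm L1 / 2 \<le> norm (L s)"
      using L_near_1[of s] s norm_triangle_ineq3[of L1 "L s"] norm_minus_commute[of "L s" L1] by linarith
    moreover have "norm (L_mangoldt s) * norm (L s) \<le> C"
      using L_mult_L_mangoldt[of s] L_ln_bound[of s] s by (simp flip: norm_mult)
    ultimately have "norm (L_mangoldt s) * (norm L1 / 2) \<le> C"
      by (meson mult_left_mono norm_ge_zero order_trans)
    then show ?thesis using pos by (simp add: field_simps)
  qed
  moreover have "1 < 1 + norm L1 / (2 * C)" using C_pos pos by simp
  ultimately show ?thesis by blast
qed

end

section \<open>Primes in residue classes modulo a product of two primes\<close>

text \<open>An upper bound \<open>K\<close> for \<open>Re (L_mangoldt s)\<close> makes
  \<open>(norm (L s))\<^sup>2 * exp (2 * K * s)\<close> nondecreasing, so \<open>L\<close> is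
  bounded near 1. But \<open>L s\<close> dominates the sum over \<open>n\<close> congruent to 1
  modulo \<open>N\<close>, whose limit at 1 is comparable to the harmonic series.\<close>

lemma (in dirichlet_character) principal_L_mangoldt_unbounded:
  assumes principal: "\<And>n. coprime n N \<Longrightarrow> \<psi> n = 1"
    and b: "1 < b" "\<And>s. 1 < s \<Longrightarrow> s < b \<Longrightarrow> Re (L_mangoldt s) \<le> K"
  shows False
proof -
  define t where "t = (1 + b) / 2"
  have t: "1 < t" "t < b" using b by (auto simp: t_def)
  define h where "h s = (norm (L s))\<^sup>2 * exp (2 * K * s)" for s
  define W where "W = h t * exp (2 * \<bar>K\<bar> * b)"
  have bounded: "norm (L s) \<le> 1 + W" if s: "1 < s" "s \<le> t" for s
  proof -
    have "h s \<le> h t"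
    proof (rule DERIV_nonneg_imp_nondecreasing[OF s(2)])
      fix x assume x: "s \<le> x" "x \<le> t"
      then have x1: "1 < x" "x < b" using s t by auto
      have "(h has_real_derivative 2 * h x * (K - Re (L_mangoldt x))) (at x)"
        unfolding h_def
        by (rule derivative_eq_intros norm_L_squared_has_derivative[OF x1(1)] refl)+
          (simp add: algebra_simps)
      moreover have "0 \<le> 2 * h x * (K - Re (L_mangoldt x))"
        using b(2)[OF x1] by (simp add: h_def)
      ultimately show "\<exists>y. (h has_real_derivative y) (at x) \<and> 0 \<le> y" by blast
    qed
    have "(norm (L s))\<^sup>2 = h s * exp (- (2 * K * s))" by (simp add: h_def exp_minus)
    also have "\<dots> \<le> h t * exp (2 * \<bar>K\<bar> * b)"
    proof (intro mult_mono)
      have "- K * s \<le> \<bar>K\<bar> * b" using s t by (intro mult_mono) auto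
      then have "- (2 * K * s) \<le> 2 * \<bar>K\<bar> * b" by linarith
      then show "exp (- (2 * K * s)) \<le> exp (2 * \<bar>K\<bar> * b)" by (simp only: exp_le_cancel_iff)
    qed (use \<open>h s \<le> h t\<close> in \<open>auto simp: h_def\<close>)
    finally have "(norm (L s))\<^sup>2 \<le> W" by (simp add: W_def)
    moreover have "2 * norm (L s) \<le> (norm (L s))\<^sup>2 + 1"
      using zero_le_power2[of "norm (L s) - 1"] by (simp add: power2_diff)
    ultimately show ?thesis using norm_ge_zero[of "L s"] by linarith
  qed
  have nonzero: "real (k * N + 1) \<noteq> 0" for k by (simp only: of_nat_eq_0_iff)
  have bound: "(\<Sum>k<M. real (k * N + 1) powr - 1) \<le> 1 + W" for M
  proof (rule tendsto_upperbound)
    show "((\<lambda>s. \<Sum>k<M. real (k * N + 1) powr - s) \<longlongrightarrow> (\<Sum>k<M. real (k * N + 1) powr - 1)) (at_right 1)"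
      by (intro tendsto_sum tendsto_powr tendsto_const tendsto_minus tendsto_ident_at nonzero)
    show "\<forall>\<^sub>F s in at_right 1. (\<Sum>k<M. real (k * N + 1) powr - s) \<le> 1 + W"
    proof (rule eventually_at_rightI[OF _ t(1)])
      fix s assume "s \<in> {1<..<t}"
      then have s: "1 < s" "s \<le> t" by auto
      have val: "\<psi> (Suc (k * N)) = 1" for k using periodic_mult[of 1 k] by simp
      have inj: "inj_on (\<lambda>k. k * N + 1) {..<M}" using modulus by (auto simp: inj_on_def)
      have "(\<Sum>k<M. real (k * N + 1) powr - s) = (\<Sum>n\<in>(\<lambda>k. k * N + 1) ` {..<M}. Re (\<psi> n) * real n powr - s)"
        by (subst sum.reindex[OF inj]) (simp add: val)
      also have "\<dots> \<le> (\<Sum>n. Re (\<psi> n) * real n powr - s)"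
      proof (rule sum_le_suminf)
        show "summable (\<lambda>n. Re (\<psi> n) * real n powr - s)"
          using summable_norms(1)[OF s(1), THEN summable_norm_cancel, THEN summable_Re] by simp
        show "0 \<le> Re (\<psi> n) * real n powr - s" for n
          using principal[of n] nonunit[of n] by (cases "coprime n N") auto
      qed simp
      also have "\<dots> \<le> norm (L s)" using Re_Im_L(1)[OF s(1)] complex_Re_le_cmod[of "L s"] by simp
      also have "\<dots> \<le> 1 + W" by (rule bounded[OF s])
      finally show "(\<Sum>k<M. real (k * N + 1) powr - s) \<le> 1 + W" .
    qed
  qed simp
  have harmonic: "inverse (real (Suc k)) \<le> real N * real (k * N + 1) powr - 1" for k
  proof -
    have le: "real (k * N + 1) \<le> real N * real (Suc k)" using modulus by (simp add: algebra_simps)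
    have frac: "inverse y \<le> m / x" if "0 < x" "0 < y" "x \<le> m * y" for x y m :: real
      using that by (simp add: field_simps)
    have "inverse (real (Suc k)) \<le> real N / real (k * N + 1)"
      by (rule frac[OF _ _ le]; simp add: add_pos_nonneg)
    then show ?thesis by (simp add: powr_minus_divide)
  qed
  have "(\<Sum>k<M. inverse (real (Suc k))) \<le> real N * (1 + W)" for M
  proof -
    have "(\<Sum>k<M. inverse (real (Suc k))) \<le> (\<Sum>k<M. real N * real (k * N + 1) powr - 1)"
      by (intro sum_mono harmonic)
    also have "\<dots> = real N * (\<Sum>k<M. real (k * N + 1) powr - 1)" by (rule sum_distrib_left[symmetric])
    also have "\<dots> \<le> real N * (1 + W)" by (intro mult_left_mono bound) simp
    finally show ?thesis .
  qed
  then have "summable (\<lambda>k. inverse (real (Suc k)))"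
    by (intro bounded_imp_summable[where B = "real N * (1 + W)"])
      (simp_all only: lessThan_Suc_atMost[symmetric], simp)
  then have "summable (\<lambda>k. inverse (real k))" by (subst (asm) summable_Suc_iff)
  then show False using not_summable_harmonic[where 'a = real] by simp
qed

text \<open>The \<open>j\<close>-th power of the character that sends the primitive root
  \<open>g\<close> to the standard root of unity of order \<open>p - 1\<close>. \<open>SOME\<close>
  picks a discrete logarithm; the value does not depend on which one.\<close>

definition prime_character :: "nat \<Rightarrow> nat \<Rightarrow> nat \<Rightarrow> nat \<Rightarrow> complex" where
  "prime_character p g j n = (if p dvd n then 0
    else (cis (2 * pi / real (p - 1)) ^ (SOME i. [g ^ i = n] (mod p))) ^ j)"

context
  fixes p g :: nat
  assumes p: "prime p" and g: "residue_primroot p g"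
begin

lemma primroot_power_exists:
  assumes "\<not> p dvd n"
  obtains i where "i < p - 1" "[g ^ i = n] (mod p)"
proof -
  have "n mod p \<in> totatives p"
    using assms p by (auto simp: totatives_prime prime_gt_0_nat dvd_eq_mod_eq_0)
  then have "n mod p \<in> (\<lambda>i. g ^ i mod p) ` {..<p - 1}"
    using bij_betw_imp_surj_on[OF residue_primroot_is_generator[OF prime_gt_1_nat[OF p] g]] p
    by (simp add: totient_prime)
  then show thesis using that by (auto simp: Cong.cong_def)
qed

lemma unity_root_power_cong:
  assumes "[g ^ i = g ^ i'] (mod p)"
  shows "cis (2 * pi / real (p - 1)) ^ i = cis (2 * pi / real (p - 1)) ^ i'"
proof -
  define z where "z = cis (2 * pi / real (p - 1))"
  have "0 < p - 1" using prime_gt_1_nat[OF p] by simp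
  then have "z ^ (p - 1) = 1" by (simp add: z_def Complex.DeMoivre)
  then have "z ^ k = z ^ (k mod (p - 1))" for k
    by (metis mult.right_neutral mult_div_mod_eq power_add power_mult power_one mult.left_neutral)
  moreover have "i mod (p - 1) = i' mod (p - 1)"
    using assms g p order_divides_expdiff[of p g i i']
    by (simp add: residue_primroot_def totient_prime Cong.cong_def)
  ultimately show ?thesis unfolding z_def by metis
qed

lemma prime_character_eq:
  assumes "[g ^ i = n] (mod p)"
  shows "prime_character p g j n = (cis (2 * pi / real (p - 1)) ^ i) ^ j"
proof -
  have "coprime p g" using g by (simp add: residue_primroot_def)
  then have "\<not> p dvd g ^ i"
    using p by (metis coprime_absorb_left not_prime_unit prime_dvd_power)
  then have "\<not> p dvd n" using assms cong_dvd_iff by blast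
  moreover have "[g ^ (SOME i. [g ^ i = n] (mod p)) = n] (mod p)" using assms by (rule someI)
  then have "[g ^ (SOME i. [g ^ i = n] (mod p)) = g ^ i] (mod p)" using assms by (simp add: Cong.cong_def)
  ultimately show ?thesis using unity_root_power_cong by (simp add: prime_character_def)
qed

lemma prime_character_mult: "prime_character p g j (m * n) = prime_character p g j m * prime_character p g j n"
proof (cases "p dvd m \<or> p dvd n")
  case True
  then show ?thesis by (auto simp: prime_character_def)
next
  case False
  then obtain i i' where i: "[g ^ i = m] (mod p)" "[g ^ i' = n] (mod p)"
    using primroot_power_exists by metis
  then have "[g ^ (i + i') = m * n] (mod p)" unfolding power_add by (rule cong_mult)
  then have "prime_character p g j (m * n) = (cis (2 * pi / real (p - 1)) ^ (i + i')) ^ j"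
    by (rule prime_character_eq)
  then show ?thesis
    using i by (simp only: prime_character_eq power_add power_mult_distrib)
qed

lemma prime_character_cong:
  assumes "[m = n] (mod p)"
  shows "prime_character p g j m = prime_character p g j n"
proof -
  have "p dvd m \<longleftrightarrow> p dvd n" using assms by (rule cong_dvd_iff)
  moreover have "[g ^ i = m] (mod p) \<longleftrightarrow> [g ^ i = n] (mod p)" for i using assms by (simp add: Cong.cong_def)
  ultimately show ?thesis by (simp add: prime_character_def)
qed

lemma norm_prime_character: "norm (prime_character p g j n) = (if p dvd n then 0 else 1)"
  by (simp add: prime_character_def norm_power)

lemma unity_root_power_inj:
  assumes "i < p - 1" "i' < p - 1" "cis (2 * pi / real (p - 1)) ^ i = cis (2 * pi / real (p - 1)) ^ i'"
  shows "i = i'"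
proof -
  have "inj_on (\<lambda>k. cis (2 * pi * real k / real (p - 1))) {..<p - 1}"
    using Complex.bij_betw_roots_unity[of "p - 1"] assms(1) by (simp add: bij_betw_def)
  then show ?thesis using assms by (auto simp: Complex.DeMoivre inj_on_def mult_ac)
qed

text \<open>The sum is geometric, and its ratio is a root of unity of exponent \<open>p - 1\<close>
  that equals 1 exactly when the two discrete logarithms agree.\<close>

lemma prime_character_orthogonality:
  assumes a: "\<not> p dvd a"
  shows "(\<Sum>j<p - 1. cnj (prime_character p g j a) * prime_character p g j n) =
    (if [n = a] (mod p) then of_nat (p - 1) else 0)"
proof (cases "p dvd n")
  case True
  then show ?thesis using a cong_dvd_iff by (auto simp: prime_character_def)
next
  case False
  define z where "z = cis (2 * pi / real (p - 1))"
  obtain i where i: "i < p - 1" "[g ^ i = n] (mod p)" using primroot_power_exists[OF False] .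
  obtain i' where i': "i' < p - 1" "[g ^ i' = a] (mod p)" using primroot_power_exists[OF a] .
  define y where "y = cnj (z ^ i') * z ^ i"
  have sum: "(\<Sum>j<p - 1. cnj (prime_character p g j a) * prime_character p g j n) = (\<Sum>j<p - 1. y ^ j)"
    by (simp add: prime_character_eq[OF i(2)] prime_character_eq[OF i'(2)] y_def z_def power_mult_distrib)
  have unit: "z ^ k * cnj (z ^ k) = 1" for k
    by (subst complex_norm_square[symmetric]) (simp add: z_def norm_power)
  show ?thesis
  proof (cases "i = i'")
    case True
    then have "y = 1" using unit[of i] by (simp add: y_def mult.commute)
    moreover have "[n = a] (mod p)" using i i' True by (simp add: Cong.cong_def)
    ultimately show ?thesis unfolding sum by simp
  next
    case False
    have "y \<noteq> 1"
    proof
      assume "y = 1"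
      have "z ^ i = (z ^ i' * cnj (z ^ i')) * z ^ i" by (simp only: unit mult_1_left)
      also have "\<dots> = z ^ i' * y" by (simp only: y_def mult.assoc)
      finally have "z ^ i = z ^ i'" using \<open>y = 1\<close> by simp
      then show False using unity_root_power_inj i i' False unfolding z_def by blast
    qed
    moreover have "y ^ (p - 1) = 1"
    proof -
      have "z ^ (p - 1) = 1" using i(1) by (simp add: z_def Complex.DeMoivre)
      then have "(z ^ k) ^ (p - 1) = 1" for k
        by (metis mult.commute power_mult power_one)
      then show ?thesis by (simp add: y_def power_mult_distrib flip: complex_cnj_power)
    qed
    moreover have "\<not> [n = a] (mod p)"
    proof
      assume "[n = a] (mod p)"
      then have "[g ^ i = g ^ i'] (mod p)" using i i' by (simp add: Cong.cong_def)
      then show False using unity_root_power_cong unity_root_power_inj i i' False by blast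
    qed
    ultimately show ?thesis unfolding sum by (simp add: geometric_sum)
  qed
qed

end

lemma product_character:
  assumes p: "prime p" "residue_primroot p g" and q: "prime q" "residue_primroot q h"
  shows "dirichlet_character (p * q) (\<lambda>n. prime_character p g j n * prime_character q h k n)"
proof
  have "1 < p" "0 < q" using p q prime_gt_1_nat prime_gt_0_nat by auto
  then show "1 < p * q" by (metis less_1_mult less_one linorder_neqE_nat mult.right_neutral neq0_conv)
  have cop: "coprime n (p * q) \<longleftrightarrow> \<not> p dvd n \<and> \<not> q dvd n" for n
    using p(1) q(1) by (metis coprime_mult_right_iff coprime_commute prime_imp_coprime coprime_absorb_left not_prime_unit)
  show "prime_character p g j (a * b) * prime_character q h k (a * b) =
      prime_character p g j a * prime_character q h k a * (prime_character p g j b * prime_character q h k b)" for a b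
    by (simp add: prime_character_mult[OF p] prime_character_mult[OF q])
  have "[a + p * q = a] (mod p)" "[a + p * q = a] (mod q)" for a by (auto simp: Cong.cong_def)
  then show "prime_character p g j (a + p * q) * prime_character q h k (a + p * q) =
      prime_character p g j a * prime_character q h k a" for a
    using prime_character_cong[OF p] prime_character_cong[OF q] by metis
  show "norm (prime_character p g j a * prime_character q h k a) = 1" if "coprime a (p * q)" for a
    using that cop by (simp add: norm_mult norm_prime_character[OF p] norm_prime_character[OF q])
  show "prime_character p g j a * prime_character q h k a = 0" if "\<not> coprime a (p * q)" for a
    using that cop by (auto simp: prime_character_def)
qed

lemma product_character_nonprincipal:
  assumes p: "prime p" "residue_primroot p g" and q: "prime q" "residue_primroot q h" and "p \<noteq> q"
    and jk: "j < p - 1" "k < q - 1" "j \<noteq> 0 \<or> k \<noteq> 0"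
  shows "\<exists>a. coprime a (p * q) \<and> prime_character p g j a * prime_character q h k a \<noteq> 1"
proof -
  have cop: "coprime p q" using p q \<open>p \<noteq> q\<close> by (simp add: primes_coprime)
  \<comment> \<open>These exponents select one prime at which the character is nontrivial:
    \<open>a\<close> is the generator there and 1 modulo the other prime, so only one factor differs
    from 1.\<close>
  define e f :: nat where "e = of_bool (j \<noteq> 0)" and "f = of_bool (j = 0)"
  obtain a where a: "[a = g ^ e] (mod p)" "[a = h ^ f] (mod q)"
    using binary_chinese_remainder_nat[OF cop] by blast
  have "coprime p (g ^ e)" "coprime q (h ^ f)" using p q by (auto simp: residue_primroot_def)
  then have "coprime a p" "coprime a q"
    using a by (metis cong_imp_coprime cong_sym coprime_commute)+
  moreover have "prime_character p g j a * prime_character q h k a =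
      (cis (2 * pi / real (p - 1)) ^ e) ^ j * (cis (2 * pi / real (q - 1)) ^ f) ^ k"
    using prime_character_eq[OF p cong_sym[OF a(1)]] prime_character_eq[OF q cong_sym[OF a(2)]] by simp
  moreover have "(cis (2 * pi / real (p - 1)) ^ e) ^ j * (cis (2 * pi / real (q - 1)) ^ f) ^ k \<noteq> 1"
  proof (cases "j = 0")
    case True
    have "0 < q - 1" using jk by linarith
    then have "cis (2 * pi / real (q - 1)) ^ k \<noteq> cis (2 * pi / real (q - 1)) ^ 0"
      using unity_root_power_inj[OF q jk(2)] True jk(3) by blast
    then show ?thesis using True by (simp add: e_def f_def)
  next
    case False
    have "0 < p - 1" using jk by linarith
    then have "cis (2 * pi / real (p - 1)) ^ j \<noteq> cis (2 * pi / real (p - 1)) ^ 0"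
      using unity_root_power_inj[OF p jk(1)] False by blast
    then show ?thesis using False by (simp add: e_def f_def)
  qed
  ultimately show ?thesis by (metis coprime_mult_right_iff)
qed

text \<open>Proper prime powers contribute a bounded amount even at \<open>s = 1\<close>: only
  exponents from 2 on occur, and for a base \<open>b \<ge> 2\<close> the geometric series is at most
  twice its first term.\<close>

lemma prime_power_sum_bound:
  "(\<Sum>n | n < M \<and> primepow n \<and> \<not> prime n. mangoldt n / real n) \<le> 2 * (\<Sum>n. ln (real n) * real n powr - 2)"
proof -
  let ?I = "{b. b < M \<and> prime b} \<times> {2..<M}" and ?T = "{n. n < M \<and> primepow n \<and> \<not> prime n}"
  have "?T \<subseteq> (\<lambda>(b, k). b ^ k) ` ?I"
  proof
    fix n assume n: "n \<in> ?T"
    then obtain b k where bk: "prime b" "0 < k" "n = b ^ k" by (auto simp: primepow_def)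
    have "k \<noteq> 1" using n bk by auto
    then have "2 \<le> k" using bk by simp
    moreover have "k < b ^ k" using prime_gt_1_nat[OF bk(1)] by (intro power_gt_expt) auto
    moreover have "b \<le> b ^ k" using prime_gt_0_nat[OF bk(1)] bk(2) by (intro self_le_power) auto
    ultimately show "n \<in> (\<lambda>(b, k). b ^ k) ` ?I" using n bk by (intro image_eqI[of _ _ "(b, k)"]) auto
  qed
  then have "(\<Sum>n\<in>?T. mangoldt n / real n) \<le> (\<Sum>n\<in>(\<lambda>(b, k). b ^ k) ` ?I. mangoldt n / real n)"
    by (intro sum_mono2) (auto simp: mangoldt_nonneg)
  also have "\<dots> \<le> (\<Sum>z\<in>?I. mangoldt (case z of (b, k) \<Rightarrow> b ^ k) / real (case z of (b, k) \<Rightarrow> b ^ k))"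
    using sum_image_le[of ?I "\<lambda>n. mangoldt n / real n" "\<lambda>(b, k). b ^ k"] by (simp add: mangoldt_nonneg o_def)
  also have "\<dots> = (\<Sum>(b, k)\<in>?I. ln (real b) * (1 / real b) ^ k)"
    by (intro sum.cong) (auto simp: power_divide)
  also have "\<dots> = (\<Sum>b | b < M \<and> prime b. \<Sum>k=2..<M. ln (real b) * (1 / real b) ^ k)"
    by (rule sum.cartesian_product[symmetric])
  also have "\<dots> \<le> (\<Sum>b | b < M \<and> prime b. 2 * (ln (real b) * real b powr - 2))"
  proof (rule sum_mono)
    fix b assume "b \<in> {b. b < M \<and> prime b}"
    then have b: "2 \<le> b" using prime_ge_2_nat by auto
    have "(\<Sum>k=2..<M. (1 / real b) ^ k) \<le> 2 * (1 / real b)\<^sup>2"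
    proof (cases "2 \<le> M")
      case True
      then obtain M' where M': "M = M' + 2" by (metis add.commute le_Suc_ex)
      have "(\<Sum>k=2..<M. (1 / real b) ^ k) = (\<Sum>k=0+2..<M'+2. (1 / real b) ^ k)"
        by (simp only: M' add_0_left)
      also have "\<dots> = (1 / real b)\<^sup>2 * (\<Sum>k=0..<M'. (1 / real b) ^ k)"
        unfolding sum.shift_bounds_nat_ivl sum_distrib_left
        by (intro sum.cong refl) (simp only: power_add mult.commute)
      also have "\<dots> \<le> (1 / real b)\<^sup>2 * 2"
      proof (rule mult_left_mono)
        have "(\<Sum>k=0..<M'. (1 / real b) ^ k) \<le> 1 / (1 - 1 / real b)"
          using b by (intro less_imp_le geometric_sum_less) auto
        also have "\<dots> \<le> 2" using b by (simp add: field_simps)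
        finally show "(\<Sum>k=0..<M'. (1 / real b) ^ k) \<le> 2" .
      qed simp
      finally show ?thesis by simp
    qed simp
    then have "ln (real b) * (\<Sum>k=2..<M. (1 / real b) ^ k) \<le> ln (real b) * (2 * (1 / real b)\<^sup>2)"
      using b by (intro mult_left_mono) auto
    moreover have "real b powr - 2 = (1 / real b)\<^sup>2"
      using b by (simp add: powr_minus_divide power_divide)
    ultimately show "(\<Sum>k=2..<M. ln (real b) * (1 / real b) ^ k) \<le> 2 * (ln (real b) * real b powr - 2)"
      by (simp add: sum_distrib_left[symmetric])
  qed
  also have "\<dots> = 2 * (\<Sum>b | b < M \<and> prime b. ln (real b) * real b powr - 2)"
    by (simp add: sum_distrib_left)
  also have "\<dots> \<le> 2 * (\<Sum>n. ln (real n) * real n powr - 2)"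
  proof (intro mult_left_mono sum_le_suminf summable_ln_powr)
    show "0 \<le> ln (real n) * real n powr - 2" for n by (cases "n = 0") auto
  qed auto
  finally show ?thesis .
qed

text \<open>By orthogonality the combination of all \<open>L_mangoldt\<close> with weights
  \<open>cnj (\<psi> x a)\<close> is \<open>(p - 1) * (q - 1)\<close> times the
  \<open>mangoldt\<close> series restricted to the class of \<open>a\<close>. With finitely many
  primes in the class this stays bounded as \<open>s\<close> tends to 1. So do the nonprincipal
  terms, hence also the principal one, which is impossible.\<close>

theorem infinite_primes_in_residue_class:
  fixes p q a :: nat
  assumes p: "prime p" and q: "prime q" and "p \<noteq> q" and a: "coprime a (p * q)"
  shows "infinite {r. prime r \<and> [r = a] (mod p * q)}"
proof
  assume fin: "finite {r. prime r \<and> [r = a] (mod p * q)}" (is "finite ?R")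
  obtain g where g: "residue_primroot p g" using prime_primitive_root_exists[OF prime_gt_1_nat[OF p] p] by blast
  obtain h where h: "residue_primroot q h" using prime_primitive_root_exists[OF prime_gt_1_nat[OF q] q] by blast
  have cop: "coprime p q" using p q \<open>p \<noteq> q\<close> by (simp add: primes_coprime)
  have a': "\<not> p dvd a" "\<not> q dvd a"
    using a p q by (metis coprime_mult_right_iff coprime_commute coprime_absorb_left not_prime_unit)+
  define \<psi> where "\<psi> = (\<lambda>(j, k) n. prime_character p g j n * prime_character q h k n)"
  define J where "J = {..<p - 1} \<times> {..<q - 1}"
  define J' where "J' = J - {(0, 0)}"
  define D where "D = (\<lambda>x. dirichlet_character.L_mangoldt (\<psi> x))"
  have dc: "dirichlet_character (p * q) (\<psi> x)" for x
    unfolding \<psi>_def case_prod_unfold using product_character[OF p g q h] by simp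
  have np: "nonprincipal_character (p * q) (\<psi> x)" if "x \<in> J'" for x
    using that dc product_character_nonprincipal[OF p g q h \<open>p \<noteq> q\<close>, of "fst x" "snd x"]
    by (auto simp: nonprincipal_character_def nonprincipal_character_axioms_def \<psi>_def case_prod_unfold
        J'_def J_def prod_eq_iff)
  have J00: "(0, 0) \<in> J" "finite J"
    using prime_gt_1_nat[OF p] prime_gt_1_nat[OF q] by (auto simp: J_def)
  have orth: "(\<Sum>x\<in>J. cnj (\<psi> x a) * \<psi> x n) = (if [n = a] (mod p * q) then of_nat ((p - 1) * (q - 1)) else 0)" for n
  proof -
    have "(\<Sum>x\<in>J. cnj (\<psi> x a) * \<psi> x n) =
        (\<Sum>j<p - 1. cnj (prime_character p g j a) * prime_character p g j n) *
        (\<Sum>k<q - 1. cnj (prime_character q h k a) * prime_character q h k n)"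
      unfolding sum_product sum.cartesian_product J_def
      by (intro sum.cong refl) (auto simp: \<psi>_def mult_ac)
    moreover have "[n = a] (mod p * q) \<longleftrightarrow> [n = a] (mod p) \<and> [n = a] (mod q)"
      using cop coprime_cong_mult_nat cong_modulus_mult_nat by (metis mult.commute)
    ultimately show ?thesis
      unfolding prime_character_orthogonality[OF p g a'(1)] prime_character_orthogonality[OF q h a'(2)]
      by (simp del: of_nat_diff)
  qed
  define w where "w s n = (if [n = a] (mod p * q) then mangoldt n * real n powr - s else 0)" for s and n :: nat
  \<comment> \<open>The two parts bound the finitely many primes assumed in the class and all proper
    prime powers; neither depends on \<open>s\<close>.\<close>
  define K where "K = (\<Sum>r\<in>?R. ln (real r)) + 2 * (\<Sum>n. ln (real n) * real n powr - 2)"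
  have w_nonneg: "0 \<le> w s n" for s n by (simp add: w_def mangoldt_nonneg)
  have partial: "(\<Sum>n<M. w s n) \<le> K" if s: "1 < s" for s M
  proof -
    have "w s n \<le> (if n \<in> ?R then ln (real n) else 0) +
        (if primepow n \<and> \<not> prime n then mangoldt n / real n else 0)" for n
    proof (cases "[n = a] (mod p * q) \<and> primepow n")
      case True
      then have n: "1 < n" using primepow_gt_Suc_0[of n] by simp
      have "real n powr - s \<le> real n powr - 1" using s n by (intro powr_mono) auto
      then have pw: "real n powr - s \<le> 1 / real n" using n by (simp add: powr_minus_divide)
      have m: "mangoldt n * real n powr - s \<le> mangoldt n * (1 / real n)"
        using pw by (intro mult_left_mono mangoldt_nonneg)
      show ?thesis
      proof (cases "prime n")
        case prime: True
        have "mangoldt n * (1 / real n) \<le> mangoldt n * (1::real)"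
          using n by (intro mult_left_mono mangoldt_nonneg) auto
        then show ?thesis using True prime m by (simp add: w_def)
      next
        case False
        then show ?thesis using True m by (simp add: w_def)
      qed
    next
      case False
      then have "w s n = 0" by (auto simp: w_def mangoldt_def)
      moreover have "0 \<le> ln (real n)" by (cases "n = 0") auto
      moreover have "0 \<le> mangoldt n / real n" by (simp add: mangoldt_nonneg)
      ultimately show ?thesis by simp
    qed
    then have "(\<Sum>n<M. w s n) \<le> (\<Sum>n<M. if n \<in> ?R then ln (real n) else 0) +
        (\<Sum>n<M. if primepow n \<and> \<not> prime n then mangoldt n / real n else 0)"
      unfolding sum.distrib[symmetric] by (rule sum_mono)
    also have "(\<Sum>n<M. if n \<in> ?R then ln (real n) else 0) = (\<Sum>n\<in>{..<M} \<inter> ?R. ln (real n))"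
      by (simp only: sum.inter_restrict finite_lessThan)
    also have "\<dots> \<le> (\<Sum>r\<in>?R. ln (real r))"
      using fin by (intro sum_mono2) (auto simp: prime_ge_Suc_0_nat)
    also have "(\<Sum>n<M. if primepow n \<and> \<not> prime n then mangoldt n / real n else 0) =
        (\<Sum>n | n < M \<and> primepow n \<and> \<not> prime n. mangoldt n / real n)"
      by (rule sum.mono_neutral_cong_right) auto
    also have "\<dots> \<le> 2 * (\<Sum>n. ln (real n) * real n powr - 2)" by (rule prime_power_sum_bound)
    finally show ?thesis by (simp add: K_def)
  qed
  have w_sum: "norm (\<Sum>x\<in>J. cnj (\<psi> x a) * D x s) \<le> real ((p - 1) * (q - 1)) * K" if s: "1 < s" for s
  proof -
    have "(\<lambda>n. \<psi> x n * of_real (mangoldt n * real n powr - s)) sums D x s" for x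
      unfolding D_def dirichlet_character.L_mangoldt_def[OF dc]
      by (rule summable_sums[OF summable_norm_cancel[OF dirichlet_character.summable_norms(3)[OF dc s]]])
    then have "(\<lambda>n. \<Sum>x\<in>J. cnj (\<psi> x a) * (\<psi> x n * of_real (mangoldt n * real n powr - s))) sums
        (\<Sum>x\<in>J. cnj (\<psi> x a) * D x s)"
      by (intro sums_sum sums_mult)
    moreover have "(\<Sum>x\<in>J. cnj (\<psi> x a) * (\<psi> x n * of_real (mangoldt n * real n powr - s))) =
        of_nat ((p - 1) * (q - 1)) * of_real (w s n)" for n
    proof -
      have "(\<Sum>x\<in>J. cnj (\<psi> x a) * (\<psi> x n * of_real (mangoldt n * real n powr - s))) =
          (\<Sum>x\<in>J. cnj (\<psi> x a) * \<psi> x n) * of_real (mangoldt n * real n powr - s)"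
        unfolding sum_distrib_right by (intro sum.cong refl) (simp only: mult_ac)
      then show ?thesis unfolding orth w_def by simp
    qed
    ultimately have "(\<lambda>n. of_nat ((p - 1) * (q - 1)) * complex_of_real (w s n)) sums
        (\<Sum>x\<in>J. cnj (\<psi> x a) * D x s)" by simp
    then have "(\<lambda>M. norm (\<Sum>n<M. of_nat ((p - 1) * (q - 1)) * complex_of_real (w s n))) \<longlonglongrightarrow>
        norm (\<Sum>x\<in>J. cnj (\<psi> x a) * D x s)"
      unfolding sums_def by (rule tendsto_norm)
    moreover have "norm (\<Sum>n<M. of_nat ((p - 1) * (q - 1)) * complex_of_real (w s n)) \<le>
        real ((p - 1) * (q - 1)) * K" for M
    proof -
      have "(\<Sum>n<M. of_nat ((p - 1) * (q - 1)) * complex_of_real (w s n)) =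
          complex_of_real (real ((p - 1) * (q - 1)) * (\<Sum>n<M. w s n))"
        by (simp add: sum_distrib_left)
      then have "norm (\<Sum>n<M. of_nat ((p - 1) * (q - 1)) * complex_of_real (w s n)) =
          real ((p - 1) * (q - 1)) * (\<Sum>n<M. w s n)"
        using w_nonneg by (simp only: norm_of_real) (intro abs_of_nonneg mult_nonneg_nonneg sum_nonneg, auto)
      also have "\<dots> \<le> real ((p - 1) * (q - 1)) * K" using partial[OF s] by (intro mult_left_mono) auto
      finally show ?thesis .
    qed
    ultimately show ?thesis by (intro LIMSEQ_le_const2) auto
  qed
  have "\<exists>b>1. \<exists>K. \<forall>s. 1 < s \<and> s < b \<longrightarrow> norm (D x s) \<le> K" if "x \<in> J'" for x
    unfolding D_def by (rule nonprincipal_character.L_mangoldt_bounded[OF np[OF that]])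
  then obtain b B where bB: "\<And>x. x \<in> J' \<Longrightarrow> 1 < b x" "\<And>x s. x \<in> J' \<Longrightarrow> 1 < s \<Longrightarrow> s < b x \<Longrightarrow> norm (D x s) \<le> B x"
    by metis
  define b0 where "b0 = Min (insert 2 (b ` J'))"
  have finJ': "finite J'" using J00 by (simp add: J'_def)
  have "1 < b0" unfolding b0_def using finJ' bB(1) by (subst Min_gr_iff) auto
  interpret P: dirichlet_character "p * q" "\<psi> (0, 0)" by (rule dc)
  show False
  proof (rule P.principal_L_mangoldt_unbounded)
    show principal: "\<psi> (0, 0) n = 1" if "coprime n (p * q)" for n
    proof -
      have "\<not> p dvd n" "\<not> q dvd n"
        using that p q by (metis coprime_mult_right_iff coprime_commute coprime_absorb_left not_prime_unit)+
      then show ?thesis by (simp add: \<psi>_def prime_character_def)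
    qed
    show "1 < b0" by fact
    fix s assume s: "1 < s" "s < b0"
    have "(\<Sum>x\<in>J. cnj (\<psi> x a) * D x s) = D (0, 0) s + (\<Sum>x\<in>J'. cnj (\<psi> x a) * D x s)"
      unfolding J'_def using J00 principal[OF a] by (subst sum.remove[of J "(0, 0)"]) auto
    then have "D (0, 0) s = (\<Sum>x\<in>J. cnj (\<psi> x a) * D x s) - (\<Sum>x\<in>J'. cnj (\<psi> x a) * D x s)" by simp
    then have "norm (D (0, 0) s) \<le> norm (\<Sum>x\<in>J. cnj (\<psi> x a) * D x s) + norm (\<Sum>x\<in>J'. cnj (\<psi> x a) * D x s)"
      using norm_triangle_ineq4 by metis
    moreover have "norm (\<Sum>x\<in>J'. cnj (\<psi> x a) * D x s) \<le> (\<Sum>x\<in>J'. B x)"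
    proof (rule sum_norm_le)
      fix x assume x: "x \<in> J'"
      then have "b0 \<le> b x" unfolding b0_def using finJ' by (intro Min_le) auto
      then have "norm (D x s) \<le> B x" using bB(2)[OF x] s by simp
      moreover have "norm (cnj (\<psi> x a) * D x s) \<le> norm (D x s)"
        using dirichlet_character.norm_le_1[OF dc, of x a] by (simp add: norm_mult mult_left_le_one_le)
      ultimately show "norm (cnj (\<psi> x a) * D x s) \<le> B x" by linarith
    qed
    ultimately have "norm (D (0, 0) s) \<le> real ((p - 1) * (q - 1)) * K + (\<Sum>x\<in>J'. B x)"
      using w_sum[OF s(1)] by linarith
    then show "Re (P.L_mangoldt s) \<le> real ((p - 1) * (q - 1)) * K + (\<Sum>x\<in>J'. B x)"
      using complex_Re_le_cmod[of "D (0, 0) s"] unfolding D_def by linarith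
  qed
qed

section \<open>Coefficients of ternary cyclotomic polynomials\<close>

lemma prod_roots_unity:
  assumes "0 < m"
  shows "(\<Prod>j\<in>{1..m}. [:- cis (2 * pi * real j / real m), 1:]) = Polynomial.monom 1 m - 1"
proof (rule poly_eqI_degree_lead_coeff[where n = m and A = "{z::complex. z ^ m = 1}"])
  let ?f = "\<lambda>j. [:- cis (2 * pi * real j / real m), 1:]"
  have deg: "degree (\<Prod>j\<in>{1..m}. ?f j) = m"
    by (subst degree_prod_eq_sum_degree) auto
  have "lead_coeff (\<Prod>j\<in>{1..m}. ?f j) = 1"
    by (subst lead_coeff_prod) auto
  then show "poly.coeff (\<Prod>j\<in>{1..m}. ?f j) m = poly.coeff (Polynomial.monom 1 m - 1) m"
    using assms deg by simp
  show "m \<le> card {z::complex. z ^ m = 1}"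
    using Complex.card_roots_unity_eq[OF assms] by simp
  show "degree (\<Prod>j\<in>{1..m}. ?f j) \<le> m" using deg by simp
  show "degree (Polynomial.monom 1 m - 1 :: complex poly) \<le> m"
    by (intro degree_diff_le degree_monom_le) simp
next
  fix z :: complex assume z: "z \<in> {z. z ^ m = 1}"
  then obtain k where k: "k < m" "z = cis (2 * pi * real k / real m)"
    using bij_betw_imp_surj_on[OF Complex.bij_betw_roots_unity[OF assms]] by auto
  define j where "j = (if k = 0 then m else k)"
  have "j \<in> {1..m}" "z = cis (2 * pi * real j / real m)"
    using k assms by (auto simp: j_def)
  then have "(\<Prod>j\<in>{1..m}. z - cis (2 * pi * real j / real m)) = 0"
    by (intro prod_zero) auto
  then show "poly (\<Prod>j\<in>{1..m}. [:- cis (2 * pi * real j / real m), 1:]) z = poly (Polynomial.monom 1 m - 1) z"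
    using z by (simp add: poly_prod poly_monom)
qed

lemma prod_roots_unity_dvd:
  assumes "0 < m" "0 < t"
  shows "(\<Prod>k | k \<in> {1..t * m} \<and> t dvd k. [:- cis (2 * pi * real k / real (t * m)), 1:])
    = Polynomial.monom 1 m - 1"
proof -
  have "(\<Prod>k | k \<in> {1..t * m} \<and> t dvd k. [:- cis (2 * pi * real k / real (t * m)), 1:])
    = (\<Prod>j\<in>{1..m}. [:- cis (2 * pi * real j / real m), 1:])"
    by (rule prod.reindex_bij_witness[where i = "\<lambda>j. t * j" and j = "\<lambda>k. k div t"])
      (use assms in \<open>auto simp: mult.assoc elim!: dvdE\<close>)
  then show ?thesis using prod_roots_unity[OF assms(1)] by simp
qed

lemma cyclotomic_poly_ternary:
  assumes pqr: "prime p" "prime q" "prime r" "distinct [p, q, r]"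
  shows "cyclotomic_poly (p * q * r) *
      ((Polynomial.monom 1 (q * r) - 1) * (Polynomial.monom 1 (p * r) - 1) * (Polynomial.monom 1 (p * q) - 1) * (Polynomial.monom 1 1 - 1)) =
    (Polynomial.monom 1 (p * q * r) - 1) * (Polynomial.monom 1 r - 1) * (Polynomial.monom 1 q - 1) * (Polynomial.monom 1 p - 1)"
proof -
  define n where "n = p * q * r"
  define f :: "nat \<Rightarrow> complex poly" where "f k = [:- cis (2 * pi * real k / real n), 1:]" for k
  define G where "G R = (\<Prod>k | k \<in> {1..n} \<and> R k. f k)" for R
  have pos: "0 < p" "0 < q" "0 < r" using pqr by (auto simp: prime_gt_0_nat)
  have split: "G R = G (\<lambda>k. R k \<and> S k) * G (\<lambda>k. R k \<and> \<not> S k)" for R S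
  proof -
    have *: "{k. k \<in> {1..n} \<and> R k} =
        {k. k \<in> {1..n} \<and> R k \<and> S k} \<union> {k. k \<in> {1..n} \<and> R k \<and> \<not> S k}" by auto
    show ?thesis unfolding G_def by (subst *, subst prod.union_disjoint) auto
  qed
  have Gdvd: "G (\<lambda>k. t dvd k) = Polynomial.monom 1 m - 1" if "t * m = n" "0 < t" "0 < m" for t m
    using prod_roots_unity_dvd[of m t] that unfolding G_def f_def by simp
  have cong: "G R = G S" if "\<And>k. R k \<longleftrightarrow> S k" for R S using that by (simp add: G_def)
  have cop: "coprime p q" "coprime p r" "coprime q r" "coprime (p * q) r"
    using pqr by (auto simp: primes_coprime coprime_mult_left_iff)
  have d: "p dvd k \<and> q dvd k \<longleftrightarrow> p * q dvd k" "p dvd k \<and> r dvd k \<longleftrightarrow> p * r dvd k"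
    "q dvd k \<and> r dvd k \<longleftrightarrow> q * r dvd k" "p * q dvd k \<and> r dvd k \<longleftrightarrow> n dvd k" for k
    using cop by (auto simp: n_def intro: divides_mult dvd_mult_left dvd_mult_right)
  have nz: "G R \<noteq> 0" for R unfolding G_def by (subst prod_zero_iff) (auto simp: f_def)
  let ?p = "\<lambda>k. p dvd k" and ?q = "\<lambda>k. q dvd k" and ?r = "\<lambda>k. r dvd k"
  have c: "cyclotomic_poly n = G (\<lambda>k. \<not> ?p k \<and> \<not> ?q k \<and> \<not> ?r k)"
  proof -
    have "totatives n = {k. k \<in> {1..n} \<and> \<not> ?p k \<and> \<not> ?q k \<and> \<not> ?r k}"
      using pqr by (auto simp: totatives_def n_def coprime_mult_right_iff prime_imp_coprime
          coprime_commute[of _ p] coprime_commute[of _ q] coprime_commute[of _ r] Suc_le_eq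
          coprime_absorb_left)
    then show ?thesis by (simp add: cyclotomic_poly_def G_def f_def)
  qed
  have e1: "G (\<lambda>k. \<not> ?p k \<and> \<not> ?q k) = G (\<lambda>k. \<not> ?p k \<and> \<not> ?q k \<and> ?r k) * cyclotomic_poly n"
    unfolding c by (subst split[where S = ?r]) (auto intro!: arg_cong2[where f = "(*)"] cong)
  have e2: "G (\<lambda>k. \<not> ?p k) = G (\<lambda>k. \<not> ?p k \<and> ?q k) * G (\<lambda>k. \<not> ?p k \<and> \<not> ?q k)"
    by (rule split)
  have e3: "G (\<lambda>k. True) = G ?p * G (\<lambda>k. \<not> ?p k)"
    by (subst split[where S = ?p]) simp
  have e4: "G ?q = G (\<lambda>k. p * q dvd k) * G (\<lambda>k. \<not> ?p k \<and> ?q k)"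
    unfolding d[symmetric] by (subst split[where S = ?p]) (auto intro!: arg_cong2[where f = "(*)"] cong)
  have e5: "G (\<lambda>k. \<not> ?p k \<and> ?r k) = G (\<lambda>k. \<not> ?p k \<and> ?q k \<and> ?r k) * G (\<lambda>k. \<not> ?p k \<and> \<not> ?q k \<and> ?r k)"
    by (subst split[where S = ?q]) (auto intro!: arg_cong2[where f = "(*)"] cong)
  have e6: "G ?r = G (\<lambda>k. p * r dvd k) * G (\<lambda>k. \<not> ?p k \<and> ?r k)"
    unfolding d[symmetric] by (subst split[where S = ?p]) (auto intro!: arg_cong2[where f = "(*)"] cong)
  have e7: "G (\<lambda>k. q * r dvd k) = G (\<lambda>k. n dvd k) * G (\<lambda>k. \<not> ?p k \<and> ?q k \<and> ?r k)"
    unfolding d[symmetric] by (subst split[where S = ?p]) (auto intro!: arg_cong2[where f = "(*)"] cong)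
  \<comment> \<open>Inclusion-exclusion without division: both sides carry two auxiliary products,
    which let all factors regroup and then cancel because no \<open>G R\<close> is zero.\<close>
  have "cyclotomic_poly n * (G ?p * G ?q * G ?r * G (\<lambda>k. n dvd k)) *
      (G (\<lambda>k. \<not> ?p k \<and> \<not> ?q k \<and> ?r k) * G (\<lambda>k. \<not> ?p k \<and> ?q k \<and> ?r k)) =
    G (\<lambda>k. True) * G (\<lambda>k. p * q dvd k) * G (\<lambda>k. p * r dvd k) * G (\<lambda>k. q * r dvd k) *
      (G (\<lambda>k. \<not> ?p k \<and> \<not> ?q k \<and> ?r k) * G (\<lambda>k. \<not> ?p k \<and> ?q k \<and> ?r k))"
    unfolding e3 e2 e1 e4 e6 e7 e5 by (simp only: mult_ac)
  then have "cyclotomic_poly n * (G ?p * G ?q * G ?r * G (\<lambda>k. n dvd k)) =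
    G (\<lambda>k. True) * G (\<lambda>k. p * q dvd k) * G (\<lambda>k. p * r dvd k) * G (\<lambda>k. q * r dvd k)"
    using nz by simp
  moreover have "G (\<lambda>k. True) = Polynomial.monom 1 n - 1"
    using Gdvd[of 1 n] pos by (simp add: n_def)
  ultimately show ?thesis
    using pos Gdvd[of p "q * r"] Gdvd[of q "p * r"] Gdvd[of r "p * q"] Gdvd[of n 1]
      Gdvd[of "p * q" r] Gdvd[of "p * r" q] Gdvd[of "q * r" p]
    by (simp add: n_def mult_ac)
qed

text \<open>For primes the difference of double sums is the Lam-Leung form of the cyclotomic
  polynomial of \<open>p * q\<close>. After multiplication by
  \<open>(y ^ q - 1) * (y ^ p - 1)\<close> the first sum becomes \<open>(X - 1) * (Y - 1)\<close>
  and \<open>Z\<close> times the second becomes \<open>(Z - X) * (Z - Y)\<close>; the relation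
  \<open>X * Y = Z * y\<close> collapses the difference.\<close>

lemma binary_sum_identity:
  fixes y :: "'a :: idom"
  assumes y: "y \<noteq> 0" and QR: "Q * q + R * p = p * q + 1" "Q \<le> p" "R \<le> q"
  shows "((\<Sum>u<Q. \<Sum>v<R. y ^ (u * q + v * p)) -
      (\<Sum>u=Q..<p. \<Sum>v=R..<q. y ^ (u * q + v * p - p * q))) * ((y ^ q - 1) * (y ^ p - 1)) =
    (y - 1) * (y ^ (p * q) - 1)"
    (is "(?S1 - ?S2) * _ = _")
proof -
  define X Y Z where XYZ: "X = y ^ (q * Q)" "Y = y ^ (p * R)" "Z = y ^ (p * q)"
  have XY: "X * Y = Z * y"
    using QR(1) by (simp add: XYZ power_add[symmetric] mult.commute[of q] mult.commute[of p R] flip: power_Suc2)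
  have pw: "(y ^ a) ^ u = y ^ (u * a)" for a u by (simp add: power_mult[symmetric] mult.commute)
  have gp: "(\<Sum>u<n. (y ^ a) ^ u) * (y ^ a - 1) = y ^ (a * n) - 1" for a n
    using power_diff_1_eq[of "y ^ a" n] by (simp add: power_mult mult.commute)
  have gp': "(\<Sum>u=m..<n. (y ^ a) ^ u) * (y ^ a - 1) = y ^ (a * n) - y ^ (a * m)" if "m \<le> n" for a m n
  proof -
    have "(\<Sum>u=m..<n. (y ^ a) ^ u) = (\<Sum>u<n. (y ^ a) ^ u) - (\<Sum>u<m. (y ^ a) ^ u)"
      using sum_diff_nat_ivl[of 0 m n "\<lambda>u. (y ^ a) ^ u"] that by (simp add: atLeast0LessThan)
    then show ?thesis by (simp only: left_diff_distrib gp) simp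
  qed
  have "?S1 = (\<Sum>u<Q. (y ^ q) ^ u) * (\<Sum>v<R. (y ^ p) ^ v)"
    by (simp only: sum_product power_add pw)
  then have "?S1 * ((y ^ q - 1) * (y ^ p - 1)) =
      ((\<Sum>u<Q. (y ^ q) ^ u) * (y ^ q - 1)) * ((\<Sum>v<R. (y ^ p) ^ v) * (y ^ p - 1))"
    by (simp only: mult_ac)
  then have S1: "?S1 * ((y ^ q - 1) * (y ^ p - 1)) = (X - 1) * (Y - 1)"
    by (simp only: gp XYZ)
  have "Z * ?S2 = (\<Sum>u=Q..<p. \<Sum>v=R..<q. y ^ (u * q + v * p))"
    unfolding sum_distrib_left XYZ
  proof (intro sum.cong refl)
    fix u v assume "u \<in> {Q..<p}" "v \<in> {R..<q}"
    then have "Q * q + R * p \<le> u * q + v * p"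
      by (intro add_mono mult_right_mono) auto
    then show "y ^ (p * q) * y ^ (u * q + v * p - p * q) = y ^ (u * q + v * p)"
      using QR(1) by (simp add: power_add[symmetric])
  qed
  also have "\<dots> = (\<Sum>u=Q..<p. (y ^ q) ^ u) * (\<Sum>v=R..<q. (y ^ p) ^ v)"
    by (simp only: sum_product power_add pw)
  finally have "Z * ?S2 * ((y ^ q - 1) * (y ^ p - 1)) =
      ((\<Sum>u=Q..<p. (y ^ q) ^ u) * (y ^ q - 1)) * ((\<Sum>v=R..<q. (y ^ p) ^ v) * (y ^ p - 1))"
    by (simp only: mult_ac)
  then have S2: "Z * ?S2 * ((y ^ q - 1) * (y ^ p - 1)) = (Z - X) * (Z - Y)"
    by (simp only: gp'[OF QR(2)] gp'[OF QR(3)] XYZ mult.commute[of q p])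
  have "Z * ((?S1 - ?S2) * ((y ^ q - 1) * (y ^ p - 1))) = Z * ((X - 1) * (Y - 1)) - (Z - X) * (Z - Y)"
    by (simp only: S1[symmetric] S2[symmetric]) (simp only: algebra_simps)
  also have "\<dots> = Z * (X * Y) - Z * Z + Z - X * Y" by (simp add: algebra_simps)
  also have "\<dots> = Z * ((y - 1) * (Z - 1))" unfolding XY by (simp add: algebra_simps)
  finally show ?thesis using y by (simp add: XYZ)
qed

text \<open>The polynomial of \<open>p * q * r\<close> is that of \<open>p * q\<close> at
  \<open>x ^ r\<close> divided by that of \<open>p * q\<close> at \<open>x\<close>. The reciprocal
  of the latter is \<open>(1 + ... + x ^ (p - 1)) * (1 - x ^ q) / (1 - x ^ (p * q))\<close>.\<close>

lemma cyclotomic_ternary_fps: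
  assumes pqr: "prime p" "prime q" "prime r" "distinct [p, q, r]"
    and QR: "Q * q + R * p = p * q + 1" "Q \<le> p" "R \<le> q"
  shows "fps_of_poly (cyclotomic_poly (p * q * r)) * (1 - fps_X ^ (p * q)) =
    ((\<Sum>u<Q. \<Sum>v<R. fps_X ^ (r * (u * q + v * p))) -
      (\<Sum>u=Q..<p. \<Sum>v=R..<q. fps_X ^ (r * (u * q + v * p - p * q)))) *
    ((\<Sum>m<p. fps_X ^ m) * (1 - fps_X ^ q))"
    (is "?F * _ = ?B * _")
proof -
  let ?X = "fps_X :: complex fps"
  have pos: "0 < p" "0 < q" "0 < r" using pqr by (auto simp: prime_gt_0_nat)
  have nz: "?X ^ n - 1 \<noteq> 0" if "0 < n" for n
  proof -
    have "fps_nth (?X ^ n - 1) 0 \<noteq> 0" using that by (simp add: fps_X_power_nth)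
    then show ?thesis by (metis fps_zero_nth)
  qed
  have B: "?B * ((?X ^ (q * r) - 1) * (?X ^ (p * r) - 1)) = (?X ^ r - 1) * (?X ^ (p * q * r) - 1)"
    using binary_sum_identity[of "?X ^ r", OF _ QR] pos
    unfolding power_mult[symmetric, of ?X r]
    by (simp only: mult.commute[of q r] mult.commute[of p r] mult.commute[of "p * q" r]) simp
  have "?F * ((?X ^ (q * r) - 1) * (?X ^ (p * r) - 1) * (?X ^ (p * q) - 1) * (?X - 1)) =
      (?X ^ (p * q * r) - 1) * (?X ^ r - 1) * (?X ^ q - 1) * (?X ^ p - 1)"
    using arg_cong[OF cyclotomic_poly_ternary[OF pqr], of fps_of_poly]
    by (simp add: fps_of_poly_mult fps_of_poly_diff fps_of_poly_monom')
  also have "\<dots> = ((?X ^ r - 1) * (?X ^ (p * q * r) - 1)) * (?X ^ q - 1) * ((?X - 1) * (\<Sum>m<p. ?X ^ m))"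
    by (simp only: power_diff_1_eq[of ?X p, symmetric] mult_ac)
  finally have "(?F * (?X ^ (p * q) - 1)) * ((?X ^ (q * r) - 1) * (?X ^ (p * r) - 1) * (?X - 1)) =
      (?B * ((\<Sum>m<p. ?X ^ m) * (?X ^ q - 1))) * ((?X ^ (q * r) - 1) * (?X ^ (p * r) - 1) * (?X - 1))"
    unfolding B[symmetric] by (simp only: mult_ac)
  moreover have "(?X ^ (q * r) - 1) * (?X ^ (p * r) - 1) * (?X - 1) \<noteq> 0"
    using pos nz[of "q * r"] nz[of "p * r"] nz[of 1] by simp
  ultimately have "?F * (?X ^ (p * q) - 1) = ?B * ((\<Sum>m<p. ?X ^ m) * (?X ^ q - 1))"
    using mult_right_cancel by blast
  then have "- (?F * (?X ^ (p * q) - 1)) = - (?B * ((\<Sum>m<p. ?X ^ m) * (?X ^ q - 1)))" by simp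
  then show ?thesis by (simp only: mult_minus_right[symmetric] minus_diff_eq)
qed

text \<open>The expansion of \<open>x ^ a / (1 - x ^ N)\<close>: division by
  \<open>1 - x ^ N\<close> replaces an exponent by its residue class, and this is how congruences
  enter the coefficient formula.\<close>

lemma inverse_one_minus_X_power:
  fixes a N :: nat
  assumes "0 < N"
  defines "M \<equiv> Abs_fps (\<lambda>n. if a \<le> n \<and> [a = n] (mod N) then 1 else 0 :: complex)"
  shows "M * (1 - fps_X ^ N) = fps_X ^ a"
proof (rule fps_ext)
  fix n
  have "M * (1 - fps_X ^ N) = M - fps_X ^ N * M" by (simp add: algebra_simps)
  then have "fps_nth (M * (1 - fps_X ^ N)) n = fps_nth M n - (if n < N then 0 else fps_nth M (n - N))"
    by (simp add: fps_X_power_mult_nth)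
  also have "\<dots> = (if n = a then 1 else 0)"
  proof (cases "a + N \<le> n")
    case True
    then have "[a = n] (mod N) \<longleftrightarrow> [a = n - N] (mod N)"
      by (metis add_leD2 Cong.cong_def le_add_diff_inverse2 mod_add_self2)
    then show ?thesis using True assms(1) by (auto simp: M_def)
  next
    case False
    have "n = a" if "a \<le> n" "[a = n] (mod N)"
    proof -
      from that have "N dvd n - a" by (simp add: cong_altdef_nat cong_sym_eq[of _ n])
      then show ?thesis using False that by (auto dest: dvd_imp_le)
    qed
    then show ?thesis using False by (auto simp: M_def)
  qed
  finally show "fps_nth (M * (1 - fps_X ^ N)) n = fps_nth (fps_X ^ a) n" by (simp add: fps_X_power_nth)
qed

text \<open>
  When \<open>Q * q + R * p = p * q + 1\<close>, this is the coefficient of \<open>x ^ i\<close> in the cyclotomic polynomial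
  of \<open>p * q\<close>, truncated at \<open>i \<le> K\<close>, where \<open>i < p * q\<close> is congruent to \<open>u * q + v * p\<close>.
\<close>

definition binary_coeff :: "nat \<Rightarrow> nat \<Rightarrow> nat \<Rightarrow> nat \<Rightarrow> nat \<Rightarrow> nat \<Rightarrow> nat \<Rightarrow> int" where
  "binary_coeff p q Q R K u v =
    (if u < Q \<and> v < R \<and> u * q + v * p \<le> K then 1
     else if Q \<le> u \<and> R \<le> v \<and> u * q + v * p \<le> K + p * q then - 1 else 0)"

lemma sum_delta_pair:
  fixes c :: "'a :: comm_monoid_add"
  assumes "finite A" "finite B"
  shows "(\<Sum>u\<in>A. \<Sum>v\<in>B. if u = u0 \<and> v = v0 then c else 0) = (if u0 \<in> A \<and> v0 \<in> B then c else 0)"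
proof -
  have "(\<Sum>v\<in>B. if u = u0 \<and> v = v0 then c else 0) = (if u = u0 then if v0 \<in> B then c else 0 else 0)" for u
    using assms by (cases "u = u0") (simp_all add: sum.delta)
  then show ?thesis using assms by (simp add: sum.delta)
qed

lemma cong_coordinates_unique:
  fixes p q r :: nat
  assumes "coprime p q" "coprime r (p * q)" "u < p" "v < q" "u' < p" "v' < q"
    and "[r * (u * q + v * p) = r * (u' * q + v' * p)] (mod p * q)"
  shows "u = u' \<and> v = v'"
proof -
  have *: "[u * q + v * p = u' * q + v' * p] (mod p * q)"
    using assms(2,7) by (simp add: cong_mult_lcancel_nat)
  have "[u * q = u' * q] (mod p)"
    using cong_modulus_mult_nat[OF *] by (simp add: Cong.cong_def)
  then have u: "[u = u'] (mod p)"
    using assms(1) by (simp add: cong_mult_rcancel_nat coprime_commute)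
  have "[v * p = v' * p] (mod q)"
    using cong_modulus_mult_nat[OF *[unfolded mult.commute[of p q]]] by (simp add: Cong.cong_def)
  then have "[v = v'] (mod q)"
    using assms(1) by (simp add: cong_mult_rcancel_nat)
  with u show ?thesis
    using assms(3-6) cong_less_modulus_unique_nat by blast
qed

text \<open>Kaplan's reduction. For each \<open>m\<close> exactly one pair \<open>(u, v)\<close>
  solves the congruence modulo \<open>p * q\<close>; replacing \<open>m\<close> by
  \<open>m + q\<close> lowers \<open>u\<close> by \<open>\<rho>\<close> and keeps \<open>v\<close>,
  because \<open>r * \<rho>\<close> is 1 modulo \<open>p\<close>.\<close>

lemma coeff_cyclotomic_ternary:
  assumes pqr: "prime p" "prime q" "prime r" "distinct [p, q, r]" "p < q"
    and QR: "Q * q + R * p = p * q + 1" "Q \<le> p" "R \<le> q"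
    and UV: "\<And>m. m < p \<Longrightarrow> U m < p \<and> V m < q \<and> [r * (U m * q + V m * p) + m = k] (mod p * q)"
    and \<rho>: "[r * \<rho> = 1] (mod p)" "\<rho> \<le> p"
  shows "poly.coeff (cyclotomic_poly (p * q * r)) k =
    of_int (\<Sum>m<p. binary_coeff p q Q R (k div r) (U m) (V m) -
      binary_coeff p q Q R (k div r) ((U m + (p - \<rho>)) mod p) (V m))"
proof -
  define N where "N = p * q"
  define M where "M a = Abs_fps (\<lambda>n. if a \<le> n \<and> [a = n] (mod N) then 1 else 0 :: complex)" for a
  define B where "B = (\<Sum>u<Q. \<Sum>v<R. M (r * (u * q + v * p))) -
      (\<Sum>u=Q..<p. \<Sum>v=R..<q. M (r * (u * q + v * p - p * q)))"
  let ?F = "fps_of_poly (cyclotomic_poly (p * q * r))" and ?X = "fps_X :: complex fps"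
  let ?e = "binary_coeff p q Q R (k div r)"
  have pos: "0 < p" "0 < q" "0 < r" "0 < N" "1 < p" "1 < q"
    using pqr by (simp_all add: prime_gt_0_nat prime_gt_Suc_0_nat N_def)
  have cop: "coprime p q" "coprime r N"
    using pqr by (auto simp: primes_coprime N_def coprime_mult_right_iff)
  have "B * (1 - ?X ^ N) = (\<Sum>u<Q. \<Sum>v<R. ?X ^ (r * (u * q + v * p))) -
      (\<Sum>u=Q..<p. \<Sum>v=R..<q. ?X ^ (r * (u * q + v * p - p * q)))"
    unfolding B_def M_def
    by (simp only: left_diff_distrib sum_distrib_right inverse_one_minus_X_power[OF pos(4)])
  then have "?F * (1 - ?X ^ N) = (B * (1 - ?X ^ N)) * ((\<Sum>m<p. ?X ^ m) * (1 - ?X ^ q))"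
    using cyclotomic_ternary_fps[OF pqr(1-4) QR] by (simp only: N_def)
  then have "?F * (1 - ?X ^ N) = (B * ((\<Sum>m<p. ?X ^ m) * (1 - ?X ^ q))) * (1 - ?X ^ N)"
    by (simp only: mult_ac)
  moreover have "1 - ?X ^ N \<noteq> 0"
  proof -
    have "fps_nth (1 - ?X ^ N) 0 \<noteq> 0" using pos by (simp add: fps_X_power_nth)
    then show ?thesis by (metis fps_zero_nth)
  qed
  ultimately have "?F = B * ((\<Sum>m<p. ?X ^ m) * (1 - ?X ^ q))"
    using mult_right_cancel by blast
  also have "(\<Sum>m<p. ?X ^ m) * (1 - ?X ^ q) = (\<Sum>m<p. ?X ^ m - ?X ^ (m + q))"
    by (simp add: sum_distrib_right right_diff_distrib power_add sum_subtractf)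
  also have "B * \<dots> = (\<Sum>m<p. ?X ^ m * B - ?X ^ (m + q) * B)"
    by (simp only: sum_distrib_left) (intro sum.cong refl, simp only: algebra_simps)
  finally have F: "poly.coeff (cyclotomic_poly (p * q * r)) k =
      (\<Sum>m<p. fps_nth (?X ^ m * B) k - fps_nth (?X ^ (m + q) * B) k)"
    by (metis (no_types, lifting) fps_of_poly_nth fps_sub_nth fps_sum_nth sum.cong)
  have H: "fps_nth (?X ^ m * B) k = of_int (?e u0 v0)"
    if m: "m < N" and uv: "u0 < p" "v0 < q" "[r * (u0 * q + v0 * p) + m = k] (mod N)" for m u0 v0
  proof -
    \<comment> \<open>The true condition is \<open>a + m \<le> k\<close>. It may be weakened to
      \<open>a \<le> k\<close>: otherwise \<open>a + m - k\<close> would be a positive multiple of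
      \<open>N\<close> not exceeding \<open>m < N\<close>. Hence the truncation point
      \<open>k div r\<close> is the same for all \<open>m\<close>.\<close>
    have XM: "fps_nth (?X ^ m * M a) k = (if a \<le> k \<and> [a + m = k] (mod N) then 1 else 0)" for a
    proof (cases "a + m \<le> k")
      case True
      then have "[a = k - m] (mod N) \<longleftrightarrow> [a + m = k] (mod N)"
        by (metis add_leD2 cong_add_rcancel_nat le_add_diff_inverse2)
      then show ?thesis using True by (auto simp: fps_X_power_mult_nth M_def)
    next
      case False
      have "\<not> [a + m = k] (mod N)" if "a \<le> k"
      proof
        assume "[a + m = k] (mod N)"
        then have "N dvd a + m - k" using False by (simp add: cong_altdef_nat)
        then show False using False that m by (auto dest!: dvd_imp_le)
      qed
      then show ?thesis using False by (auto simp: fps_X_power_mult_nth M_def)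
    qed
    have uniq: "[r * (u * q + v * p) + m = k] (mod N) \<longleftrightarrow> u = u0 \<and> v = v0" if "u < p" "v < q" for u v
    proof
      assume "[r * (u * q + v * p) + m = k] (mod N)"
      then have "[r * (u * q + v * p) + m = r * (u0 * q + v0 * p) + m] (mod N)"
        using uv(3) by (simp add: Cong.cong_def)
      then have "[r * (u * q + v * p) = r * (u0 * q + v0 * p)] (mod p * q)"
        by (simp add: cong_add_rcancel_nat N_def)
      then show "u = u0 \<and> v = v0"
        using cong_coordinates_unique cop that uv by (metis N_def)
    qed (use uv in auto)
    have div: "r * x \<le> k \<longleftrightarrow> x \<le> k div r" for x
      using pos by (simp add: less_eq_div_iff_mult_less_eq mult.commute)
    have t1: "fps_nth (?X ^ m * M (r * (u * q + v * p))) k =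
        (if u = u0 \<and> v = v0 then if u0 * q + v0 * p \<le> k div r then 1 else 0 else 0)"
      if "u \<in> {..<Q}" "v \<in> {..<R}" for u v
      using that QR uniq[of u v] by (auto simp: XM div)
    have t2: "fps_nth (?X ^ m * M (r * (u * q + v * p - p * q))) k =
        (if u = u0 \<and> v = v0 then if u0 * q + v0 * p \<le> k div r + p * q then 1 else 0 else 0)"
      if "u \<in> {Q..<p}" "v \<in> {R..<q}" for u v
    proof -
      have "Q * q + R * p \<le> u * q + v * p" using that by (intro add_mono mult_right_mono) auto
      then have le: "p * q \<le> u * q + v * p" using QR(1) by simp
      have "r * (u * q + v * p) + m = r * (u * q + v * p - p * q) + m + r * N"
        using arg_cong[OF le_add_diff_inverse2[OF le], of "\<lambda>x. r * x"]
        by (simp only: distrib_left N_def)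
      then have "[r * (u * q + v * p - p * q) + m = k] (mod N) \<longleftrightarrow> [r * (u * q + v * p) + m = k] (mod N)"
        by (simp only: Cong.cong_def mod_mult_self1)
      also have "\<dots> \<longleftrightarrow> u = u0 \<and> v = v0" using that by (intro uniq) auto
      finally show ?thesis using le by (auto simp: XM div le_diff_conv)
    qed
    have "fps_nth (?X ^ m * B) k =
        (\<Sum>u<Q. \<Sum>v<R. fps_nth (?X ^ m * M (r * (u * q + v * p))) k) -
        (\<Sum>u=Q..<p. \<Sum>v=R..<q. fps_nth (?X ^ m * M (r * (u * q + v * p - p * q))) k)"
      by (simp add: B_def right_diff_distrib sum_distrib_left fps_sum_nth)
    also have "\<dots> = (\<Sum>u<Q. \<Sum>v<R. if u = u0 \<and> v = v0 then if u0 * q + v0 * p \<le> k div r then 1 else 0 else 0) -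
        (\<Sum>u=Q..<p. \<Sum>v=R..<q. if u = u0 \<and> v = v0 then if u0 * q + v0 * p \<le> k div r + p * q then 1 else 0 else 0)"
      by (intro arg_cong2[where f = "(-)"] sum.cong refl t1 t2)
    also have "\<dots> = of_int (?e u0 v0)"
      using uv unfolding sum_delta_pair[OF finite_lessThan finite_lessThan]
        sum_delta_pair[OF finite_atLeastLessThan finite_atLeastLessThan] binary_coeff_def by auto
    finally show ?thesis .
  qed
  have "fps_nth (?X ^ m * B) k - fps_nth (?X ^ (m + q) * B) k =
      of_int (?e (U m) (V m) - ?e ((U m + (p - \<rho>)) mod p) (V m))" if "m < p" for m
  proof -
    have "2 * q \<le> p * q" using pos by (intro mult_right_mono) auto
    then have mN: "m < N" "m + q < N" using that pqr(5) unfolding N_def by linarith+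
    define u where "u = (U m + (p - \<rho>)) mod p"
    have "[r * u = r * (U m + (p - \<rho>))] (mod p)" by (simp add: u_def Cong.cong_def mod_mult_right_eq)
    then have "[r * u + r * \<rho> = r * (U m + (p - \<rho>)) + r * \<rho>] (mod p)" by (rule cong_add) simp
    moreover have "r * (U m + (p - \<rho>)) + r * \<rho> = r * U m + r * p"
      using \<rho>(2) by (simp add: distrib_left[symmetric])
    ultimately have "(r * u + r * \<rho>) mod p = r * U m mod p" by (simp add: Cong.cong_def)
    moreover have "(r * u + 1) mod p = (r * u + r * \<rho>) mod p"
      using \<rho>(1) by (metis Cong.cong_def mod_add_right_eq)
    ultimately have "[r * u + 1 = r * U m] (mod p)" by (simp only: Cong.cong_def)
    then have "[(r * u + 1) * q = r * U m * q] (mod p * q)"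
      by (simp only: Cong.cong_def mult_mod_left[symmetric])
    then have "[(r * u + 1) * q + (r * V m * p + m) = r * U m * q + (r * V m * p + m)] (mod p * q)"
      by (rule cong_add) simp
    then have "[r * (u * q + V m * p) + (m + q) = r * (U m * q + V m * p) + m] (mod N)"
      by (simp add: algebra_simps N_def)
    then have "[r * (u * q + V m * p) + (m + q) = k] (mod N)"
      using UV[OF that] by (simp add: Cong.cong_def N_def)
    moreover have "u < p" using pos by (simp add: u_def)
    ultimately show ?thesis
      using H[OF mN(1), of "U m" "V m"] H[OF mN(2), of u "V m"] UV[OF that] by (simp add: N_def u_def)
  qed
  then show ?thesis by (simp add: F)
qed

section \<open>Extremal coefficients\<close>

text \<open>
  For fixed \<open>v\<close> the function \<open>u \<mapsto> binary_coeff p q Q R K u v\<close> is, up to a constant, the indicator of an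
  initial segment of the order \<open>0, 1, \<dots>, Q - 1, p - 1, p - 2, \<dots>, Q\<close>. This order is encoded by \<open>\<pi>\<close>.
\<close>

lemma binary_coeff_antimono:
  fixes p q Q R K v :: nat
  defines "\<pi> \<equiv> \<lambda>u. if u < Q then int u else int Q + int p - 1 - int u"
  assumes "u < p" "u' < p" "\<pi> u < \<pi> u'"
  shows "binary_coeff p q Q R K u v - binary_coeff p q Q R K u' v \<in> {0, 1}"
proof (cases "v < R")
  case True
  have "u < Q \<and> u * q + v * p \<le> K" if "u' < Q" "u' * q + v * p \<le> K"
  proof -
    have "u < u'" using assms(2-4) that by (auto simp: \<pi>_def split: if_splits)
    moreover from this have "u * q \<le> u' * q" by (intro mult_right_mono) auto
    ultimately show ?thesis using that by (intro conjI; linarith)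
  qed
  then show ?thesis using True by (auto simp: binary_coeff_def)
next
  case False
  have "Q \<le> u' \<and> u' * q + v * p \<le> K + p * q" if "Q \<le> u" "u * q + v * p \<le> K + p * q"
  proof -
    have "Q \<le> u'" "u' < u" using assms(2-4) that by (auto simp: \<pi>_def split: if_splits)
    moreover from this have "u' * q \<le> u * q" by (intro mult_right_mono) auto
    ultimately show ?thesis using that by (intro conjI; linarith)
  qed
  then show ?thesis using False by (auto simp: binary_coeff_def)
qed

text \<open>A term can be positive only at an ascent (\<open>Lo\<close>), negative only at a descent
  (\<open>Hi\<close>), and has absolute value at most 1. Each of these disjoint sets has at least
  \<open>p - Q\<close> elements, so neither exceeds \<open>Q\<close>. The cases place
  \<open>\<rho>\<close> relative to the two branches of \<open>\<pi>\<close>.\<close>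

lemma ternary_window_sum_bound:
  fixes p q Q R K \<rho> :: nat
  assumes "bij_betw U {..<p} {..<p}" "0 < \<rho>" "\<rho> < p" "Q < p" "p \<le> 2 * Q"
  shows "\<bar>\<Sum>m<p. binary_coeff p q Q R K (U m) (V m) -
      binary_coeff p q Q R K ((U m + (p - \<rho>)) mod p) (V m)\<bar> \<le> int Q"
proof -
  define \<pi> where "\<pi> = (\<lambda>u. if u < Q then int u else int Q + int p - 1 - int u)"
  define s where "s u = (u + (p - \<rho>)) mod p" for u
  define Lo Hi where "Lo = {u. u < p \<and> \<pi> u < \<pi> (s u)}" and "Hi = {u. u < p \<and> \<pi> (s u) < \<pi> u}"
  let ?e = "binary_coeff p q Q R K"
  have s_less: "s u < p" for u using assms by (simp add: s_def)
  have s_eq: "s u = (if u < \<rho> then u + (p - \<rho>) else u - \<rho>)" if "u < p" for u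
  proof (cases "u < \<rho>")
    case False
    then have "u + (p - \<rho>) = (u - \<rho>) + p" using assms by simp
    then show ?thesis using False that by (simp only: s_def mod_add_self2) simp
  qed (use assms in \<open>simp add: s_def\<close>)
  have "p - Q \<le> card Lo \<and> p - Q \<le> card Hi"
  proof -
    have *: "p - Q \<le> card A" if "S \<subseteq> A" "A \<subseteq> {..<p}" "p - Q \<le> card S" for S A :: "nat set"
      using that by (meson card_mono finite_lessThan finite_subset order_trans)
    have sub: "Lo \<subseteq> {..<p}" "Hi \<subseteq> {..<p}" by (auto simp: Lo_def Hi_def)
    consider "\<rho> \<le> p - Q" | "p - Q < \<rho>" "\<rho> \<le> Q" | "Q < \<rho>" by linarith
    then show ?thesis
    proof cases
      case 1
      \<comment> \<open>The ascents here are the \<open>\<rho>\<close> residues that wrap around and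
        those that move within the decreasing branch of \<open>\<pi>\<close>, in total
        \<open>p - Q\<close>.\<close>
      have "card ({..<\<rho>} \<union> {Q + \<rho>..<p}) = card {..<\<rho>} + card {Q + \<rho>..<p}"
        by (rule card_Un_disjoint) auto
      then have "p - Q \<le> card ({..<\<rho>} \<union> {Q + \<rho>..<p})" using 1 by simp
      moreover have "u \<in> Lo" if "u < \<rho> \<or> Q + \<rho> \<le> u" "u < p" for u
        using that 1 assms(2-5)
        by (auto simp: Lo_def \<pi>_def of_nat_diff s_eq[OF that(2)])
      moreover have "u \<in> Hi" if "\<rho> \<le> u" "u < Q + \<rho>" for u
      proof -
        have "u < p" using that 1 assms(4) by linarith
        then show ?thesis
          using that 1 assms(2-5)
        by (auto simp: Hi_def \<pi>_def of_nat_diff s_eq[OF \<open>u < p\<close>])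
      qed
      moreover have "p - Q \<le> card {\<rho>..<Q + \<rho>}" using assms by simp
      ultimately show ?thesis
        using *[of "{..<\<rho>} \<union> {Q + \<rho>..<p}" Lo] *[of "{\<rho>..<Q + \<rho>}" Hi] sub assms(3)
        by (auto simp: subset_iff)
    next
      case 2
      have "u \<in> Lo" if "u < \<rho>" for u
      proof -
        have "u < p" using that assms(3) by linarith
        then show ?thesis
          using that 2 assms(2-5)
        by (auto simp: Lo_def \<pi>_def of_nat_diff s_eq[OF \<open>u < p\<close>])
      qed
      moreover have "u \<in> Hi" if "\<rho> \<le> u" "u < p" for u
        using that 2 assms(2-5)
        by (auto simp: Hi_def \<pi>_def of_nat_diff s_eq[OF that(2)])
      moreover have "p - Q \<le> card {..<\<rho>}" "p - Q \<le> card {\<rho>..<p}" using 2 assms by simp_all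
      ultimately show ?thesis
        using *[of "{..<\<rho>}" Lo] *[of "{\<rho>..<p}" Hi] sub by (auto simp: subset_iff)
    next
      case 3
      have "u \<in> Lo" if "u < Q" for u
      proof -
        have "u < p" using that assms(4) by linarith
        then show ?thesis
          using that 3 assms(2-5)
        by (auto simp: Lo_def \<pi>_def of_nat_diff s_eq[OF \<open>u < p\<close>])
      qed
      moreover have "u \<in> Hi" if "Q \<le> u" "u < p" for u
        using that 3 assms(2-5)
        by (auto simp: Hi_def \<pi>_def of_nat_diff s_eq[OF that(2)])
      moreover have "p - Q \<le> card {..<Q}" "p - Q \<le> card {Q..<p}" using 3 assms by simp_all
      ultimately show ?thesis
        using *[of "{..<Q}" Lo] *[of "{Q..<p}" Hi] sub by (auto simp: subset_iff)
    qed
  qed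
  moreover have "card Lo + card Hi \<le> p"
  proof -
    have "card Lo + card Hi = card (Lo \<union> Hi)"
      by (subst card_Un_disjoint) (auto simp: Lo_def Hi_def)
    also have "\<dots> \<le> card {..<p}" by (rule card_mono) (auto simp: Lo_def Hi_def)
    finally show ?thesis by simp
  qed
  ultimately have card: "card Lo \<le> Q" "card Hi \<le> Q" using assms by linarith+
  have inj: "\<pi> u \<noteq> \<pi> (s u)" if "u < p" for u
    using that assms by (auto simp: \<pi>_def s_eq split: if_splits)
  have range: "?e u v - ?e (s u) v \<in> {- of_bool (u \<in> Hi)..of_bool (u \<in> Lo)}" if "u < p" for u v
  proof (cases "\<pi> u < \<pi> (s u)")
    case True
    then have "?e u v - ?e (s u) v \<in> {0, 1}"
      using binary_coeff_antimono[of u p "s u" Q] that s_less by (simp add: \<pi>_def)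
    then show ?thesis using True that by (auto simp: Lo_def Hi_def)
  next
    case False
    then have "\<pi> (s u) < \<pi> u" using inj[OF that] by simp
    moreover from this have "?e (s u) v - ?e u v \<in> {0, 1}"
      using binary_coeff_antimono[of "s u" p u Q] that s_less by (simp add: \<pi>_def)
    ultimately show ?thesis using that by (auto simp: Lo_def Hi_def)
  qed
  have U: "U m < p" if "m < p" for m using assms(1) that by (auto simp: bij_betw_def)
  have cnt: "(\<Sum>m<p. of_bool (U m \<in> A) :: int) = int (card A)" if "A \<subseteq> {..<p}" for A
  proof -
    have "(\<Sum>m<p. of_bool (U m \<in> A) :: int) = (\<Sum>u<p. of_bool (u \<in> A))"
      by (rule sum.reindex_bij_betw[OF assms(1)])
    also have "\<dots> = int (card ({..<p} \<inter> A))"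
      by (simp add: of_bool_def sum.If_cases)
    finally show ?thesis using that by (simp add: Int_absorb1)
  qed
  have "(\<Sum>m<p. ?e (U m) (V m) - ?e (s (U m)) (V m)) \<le> (\<Sum>m<p. of_bool (U m \<in> Lo))"
    using range U by (intro sum_mono) auto
  also have "\<dots> = int (card Lo)" by (rule cnt) (auto simp: Lo_def)
  finally have up: "(\<Sum>m<p. ?e (U m) (V m) - ?e (s (U m)) (V m)) \<le> int Q" using card by simp
  have "- int (card Hi) = (\<Sum>m<p. - of_bool (U m \<in> Hi))"
    unfolding sum_negf by (subst cnt) (auto simp: Hi_def)
  also have "\<dots> \<le> (\<Sum>m<p. ?e (U m) (V m) - ?e (s (U m)) (V m))"
    using range U by (intro sum_mono) auto
  finally show ?thesis using up card unfolding s_def by simp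
qed

text \<open>
  The pairs \<open>(u, v)\<close> form an arithmetic progression in which \<open>u\<close> decreases by one and \<open>v\<close> increases
  by \<open>d\<close>. The term is \<open>- 1\<close> for \<open>0 \<le> t\<close> and nonpositive for \<open>t < 0\<close>.
\<close>

lemma ternary_window_sum_extremal:
  fixes p q Q P R d \<rho> :: nat
  assumes PQ: "P + Q = p" "P < Q - 1" "0 < q" and R: "Q * q + R * p = p * q + 1"
    and \<rho>: "0 < \<rho>" "\<rho> \<le> P"
    and d: "0 < d" "(Q - 1) * (d * p) \<le> P * q" "(Q - 1) * q < \<rho> * q + (Q - 1) * (d * p)"
  shows "(\<Sum>t\<in>{- int P..<int Q}.
      binary_coeff p q Q R ((Q - 1) * q) (nat ((int (Q + \<rho>) - 1 - t) mod int p)) (nat (t * int d mod int q)) -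
      binary_coeff p q Q R ((Q - 1) * q) ((nat ((int (Q + \<rho>) - 1 - t) mod int p) + (p - \<rho>)) mod p)
        (nat (t * int d mod int q))) \<le> - int Q"
    (is "(\<Sum>t\<in>_. ?c t) \<le> _")
proof -
  let ?e = "binary_coeff p q Q R ((Q - 1) * q)"
  have dp: "d * p < q"
  proof -
    have "(Q - 1) * (d * p) \<le> P * q" by (rule d)
    also have "\<dots> < (Q - 1) * q" using PQ by simp
    finally show ?thesis by simp
  qed
  have Rp: "R * p = P * q + 1"
  proof -
    have "Q * q + R * p = Q * q + (P * q + 1)" using R PQ(1) by (simp add: distrib_right[symmetric] add.commute)
    then show ?thesis by simp
  qed
  \<comment> \<open>\<open>R * p\<close> exceeds \<open>P * q\<close> by exactly 1, so the strict
    bound on \<open>v\<close> becomes a nonstrict one for exponents.\<close>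
  have vR: "v < R \<longleftrightarrow> v * p \<le> P * q" for v
  proof -
    have "v < R \<longleftrightarrow> v * p < R * p" using PQ(1,2) by auto
    then show ?thesis by (simp add: Rp less_Suc_eq_le)
  qed
  \<comment> \<open>The exponent of the shifted pair \<open>(Q - 1 - i, i * d)\<close> starts at the
    truncation point \<open>(Q - 1) * q\<close> and falls with \<open>i\<close>, as
    \<open>d * p < q\<close>; its coefficient is 1. The unshifted pair gives 0, either because
    \<open>u \<ge> Q\<close> while \<open>v < R\<close>, or because its exponent is
    truncated.\<close>
  have neg: "?c (int i) = - 1" if i: "i < Q" for i
  proof -
    have idp: "i * (d * p) \<le> (Q - 1) * (d * p)" using i by (intro mult_right_mono) auto
    then have v: "i * d < R" unfolding vR mult.assoc using d(2) by linarith
    have "i * d * p < q * p"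
    proof -
      have "i * d * p \<le> P * q" unfolding mult.assoc using idp d(2) by linarith
      also have "\<dots> < p * q" using PQ by simp
      finally show ?thesis by (simp add: mult.commute)
    qed
    then have vq: "nat (int i * int d mod int q) = i * d"
      by (simp add: nat_mod_as_int flip: of_nat_mult)
    have u: "nat ((int (Q + \<rho>) - 1 - int i) mod int p) = Q + \<rho> - 1 - i"
    proof -
      have "int (Q + \<rho>) - 1 - int i = int (Q + \<rho> - 1 - i)" using i \<rho> by simp
      then show ?thesis using PQ \<rho> i by (simp flip: of_nat_mod)
    qed
    have u2: "(Q + \<rho> - 1 - i + (p - \<rho>)) mod p = Q - 1 - i"
    proof -
      have "Q + \<rho> - 1 - i + (p - \<rho>) = (Q - 1 - i) + p" using PQ \<rho> i by simp
      then show ?thesis using PQ i by (simp only: mod_add_self2) simp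
    qed
    have "(Q - 1 - i) * q + i * d * p \<le> (Q - 1) * q"
    proof -
      have "i * d * p \<le> i * q" using dp by (simp add: mult.assoc)
      moreover have "(Q - 1 - i) * q + i * q = (Q - 1) * q" using i by (simp flip: distrib_right)
      ultimately show ?thesis by linarith
    qed
    then have e2: "?e (Q - 1 - i) (i * d) = 1" using v i by (simp add: binary_coeff_def)
    \<comment> \<open>The requirement \<open>i * (q - d * p) < \<rho> * q\<close> is hardest at
      \<open>i = Q - 1\<close>, where it is the last condition on \<open>d\<close>; \<open>j\<close>
      is the distance from there.\<close>
    have "(Q - 1) * q < (Q + \<rho> - 1 - i) * q + i * d * p" if "Q + \<rho> - 1 - i < Q"
    proof -
      have "\<rho> \<le> i" "i \<le> Q - 1" using that i by linarith+
      obtain j where j: "Q - 1 = i + j" using i by (metis Suc_diff_1 gr_implies_not0 less_Suc_eq_le less_imp_Suc_add nat_le_iff_add not_gr_zero)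
      have "j * (d * p) \<le> j * q" using dp by simp
      then have "i * q < \<rho> * q + i * (d * p)"
        using d(3) unfolding j distrib_right by linarith
      moreover have "(Q + \<rho> - 1 - i) * q + i * q = (Q - 1) * q + \<rho> * q"
        using i \<open>\<rho> \<le> i\<close> by (simp flip: distrib_right)
      ultimately show ?thesis by (simp add: mult.assoc)
    qed
    then have "?e (Q + \<rho> - 1 - i) (i * d) = 0" using v by (auto simp: binary_coeff_def)
    then show ?thesis unfolding vq u u2 using e2 by simp
  qed
  \<comment> \<open>A negative \<open>t\<close> wraps \<open>v\<close> to \<open>q - i * d\<close>,
    which is at least \<open>R\<close>, so no coefficient is positive. The shifted pair lies beyond
    the truncation and gives 0, hence subtracting it cannot raise the sum.\<close>
  have nonpos: "?c (- int i) \<le> 0" if i: "0 < i" "i \<le> P" for i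
  proof -
    have "i * (d * p) \<le> i * q" using dp by (intro mult_left_mono) auto
    also have "\<dots> \<le> P * q" using i by simp
    finally have idp: "i * d * p \<le> P * q" by (simp add: mult.assoc)
    also have "\<dots> < p * q" using PQ by simp
    finally have "i * d < q" by (simp add: mult.commute)
    then have "- int i * int d mod int q = int (q - i * d)"
      using i d(1) by (simp add: zmod_zminus1_eq_if of_nat_diff flip: of_nat_mult of_nat_mod)
    then have v: "nat (- int i * int d mod int q) = q - i * d" by simp
    have vp: "(q - i * d) * p + i * d * p = p * q"
      using \<open>i * d < q\<close> by (simp flip: distrib_right)
    have "Q * q + P * q = p * q" "P * q < Q * q" using PQ by (auto simp flip: distrib_right)
    then have vR': "\<not> (q - i * d) < R" unfolding vR using vp idp by linarith
    define u where "u = nat ((int (Q + \<rho>) - 1 - - int i) mod int p)"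
    have "int (Q + \<rho>) - 1 - - int i = int (Q + \<rho> - 1 + i)" using \<rho> by simp
    then have u_eq: "u = (Q + \<rho> - 1 + i) mod p" by (simp only: u_def nat_int flip: of_nat_mod)
    have "(u + (p - \<rho>)) mod p = (Q + \<rho> - 1 + i + (p - \<rho>)) mod p"
      unfolding u_eq by (rule mod_add_left_eq)
    also have "Q + \<rho> - 1 + i + (p - \<rho>) = (Q - 1 + i) + p" using PQ \<rho> by simp
    finally have u2: "(u + (p - \<rho>)) mod p = Q - 1 + i"
      using PQ i by (simp only: mod_add_self2) simp
    have "(Q - 1 + i) * q + (q - i * d) * p > (Q - 1) * q + p * q"
    proof -
      have "i * (d * p) < i * q" using dp i by simp
      then show ?thesis using vp[unfolded mult.assoc] unfolding distrib_right by linarith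
    qed
    then have "?e (Q - 1 + i) (q - i * d) = 0" using vR' by (auto simp: binary_coeff_def)
    moreover have "?e u (q - i * d) \<le> 0" using vR' by (auto simp: binary_coeff_def)
    ultimately show ?thesis unfolding v u_def[symmetric] u2 by simp
  qed
  have split: "(\<Sum>t\<in>{- int P..<int Q}. ?c t) = (\<Sum>t\<in>{- int P..<0}. ?c t) + (\<Sum>t\<in>{0..<int Q}. ?c t)"
    by (subst sum.union_disjoint[symmetric]) (auto intro!: sum.cong)
  have left: "(\<Sum>t\<in>{- int P..<0}. ?c t) \<le> 0"
  proof (intro sum_nonpos)
    fix t assume "t \<in> {- int P..<0}"
    then obtain i where "t = - int i" "0 < i" "i \<le> P"
      by (intro that[of "nat (- t)"]) auto
    then show "?c t \<le> 0" using nonpos by blast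
  qed
  have right: "(\<Sum>t\<in>{0..<int Q}. ?c t) = (\<Sum>t\<in>{0..<int Q}. - 1)"
  proof (intro sum.cong refl)
    fix t assume "t \<in> {0..<int Q}"
    then obtain i where "t = int i" "i < Q"
      by (intro that[of "nat t"]) auto
    then show "?c t = - 1" using neg by blast
  qed
  have "(\<Sum>t\<in>{0..<int Q}. - 1 :: int) = - int Q" by simp
  then show ?thesis using left unfolding split right by linarith
qed

section \<open>Coordinates modulo \<open>p * q\<close> and the height of the ternary
  polynomial\<close>

lemma linear_cong_solution:
  fixes a n m k :: nat
  assumes "coprime a n" "0 < n"
  obtains u where "u < n" "[a * u + m = k] (mod n)"
proof -
  obtain x where x: "[a * x = 1] (mod n)" using cong_solve_coprime_nat[OF assms(1)] by auto
  \<comment> \<open>Represents \<open>k - m\<close> modulo \<open>n\<close> without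
    subtraction.\<close>
  define y where "y = k + (n - 1) * m"
  have "[a * (x * y mod n) = (a * x) * y] (mod n)" by (simp add: Cong.cong_def mod_mult_right_eq mult.assoc)
  also have "[(a * x) * y = 1 * y] (mod n)" by (rule cong_scalar_right[OF x])
  finally have "[a * (x * y mod n) + m = 1 * y + m] (mod n)" by (rule cong_add) simp
  moreover have "1 * y + m = k + n * m" using assms(2) by (cases n) (auto simp: y_def)
  ultimately have "[a * (x * y mod n) + m = k] (mod n)" by (simp add: Cong.cong_def)
  moreover have "x * y mod n < n" using assms(2) by simp
  ultimately show thesis using that by blast
qed

lemma cong_coordinates_iff:
  fixes p q r :: nat
  assumes "coprime p q"
  shows "[r * (u * q + v * p) + m = k] (mod p * q) \<longleftrightarrow>
    [r * q * u + m = k] (mod p) \<and> [r * p * v + m = k] (mod q)"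
proof -
  have "[r * (u * q + v * p) + m = k] (mod p * q) \<longleftrightarrow>
      [r * (u * q + v * p) + m = k] (mod p) \<and> [r * (u * q + v * p) + m = k] (mod q)"
    using assms cong_modulus_mult_nat[of _ _ p q] cong_modulus_mult_nat[of _ _ q p]
      coprime_cong_mult_nat by (metis mult.commute)
  moreover have "[r * (u * q + v * p) + m = k] (mod p) \<longleftrightarrow> [r * q * u + m = k] (mod p)"
  proof -
    have "r * (u * q + v * p) + m = (r * q * u + m) + r * v * p" by (simp add: algebra_simps)
    then show ?thesis by (simp only: Cong.cong_def mod_mult_self1)
  qed
  moreover have "[r * (u * q + v * p) + m = k] (mod q) \<longleftrightarrow> [r * p * v + m = k] (mod q)"
  proof -
    have "r * (u * q + v * p) + m = (r * p * v + m) + r * u * q" by (simp add: algebra_simps)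
    then show ?thesis by (simp only: Cong.cong_def mod_mult_self1)
  qed
  ultimately show ?thesis by simp
qed

lemma coeff_cyclotomic_ternary_bound:
  assumes pqr: "prime p" "prime q" "prime r" "p < q" "q < r"
    and QR: "Q * q + R * p = p * q + 1" "Q < p" "R \<le> q" "p \<le> 2 * Q"
  shows "\<exists>z::int. poly.coeff (cyclotomic_poly (p * q * r)) k = of_int z \<and> \<bar>z\<bar> \<le> int Q"
proof -
  have cop: "coprime p q" "coprime (r * q) p" "coprime (r * p) q" "coprime r p"
    using pqr by (auto simp: primes_coprime coprime_mult_left_iff)
  have pos: "0 < p" "0 < q" using pqr by (auto simp: prime_gt_0_nat)
  have "\<exists>u v. u < p \<and> v < q \<and> [r * (u * q + v * p) + m = k] (mod p * q)" for m
    using linear_cong_solution[OF cop(2) pos(1), of m k] linear_cong_solution[OF cop(3) pos(2), of m k]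
    unfolding cong_coordinates_iff[OF cop(1)] by metis
  then obtain U V where UV: "U m < p \<and> V m < q \<and> [r * (U m * q + V m * p) + m = k] (mod p * q)" for m
    by metis
  obtain \<rho> where \<rho>: "\<rho> < p" "[r * \<rho> + 0 = 1] (mod p)"
    using linear_cong_solution[OF cop(4) pos(1)] by blast
  have "\<rho> \<noteq> 0"
  proof
    assume "\<rho> = 0"
    then show False using \<rho>(2) prime_gt_1_nat[OF pqr(1)] by (simp add: Cong.cong_def)
  qed
  \<comment> \<open>Modulo \<open>p\<close> the coordinate \<open>U m\<close> determines
    \<open>m\<close>, so the window uses every residue \<open>u\<close> exactly once.\<close>
  have "inj_on U {..<p}"
  proof
    fix m m' assume m: "m \<in> {..<p}" "m' \<in> {..<p}" "U m = U m'"
    have "[r * q * U m + m = k] (mod p)" "[r * q * U m' + m' = k] (mod p)"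
      using UV cong_coordinates_iff[OF cop(1)] by blast+
    then have "[r * q * U m + m = r * q * U m + m'] (mod p)"
      using m(3) by (simp add: Cong.cong_def)
    then have "[m = m'] (mod p)" by (simp add: cong_add_lcancel_nat)
    then show "m = m'" using m cong_less_modulus_unique_nat by auto
  qed
  then have "bij_betw U {..<p} {..<p}"
    using endo_inj_surj[of "{..<p}" U] UV by (auto simp: bij_betw_def)
  then have "\<bar>\<Sum>m<p. binary_coeff p q Q R (k div r) (U m) (V m) -
      binary_coeff p q Q R (k div r) ((U m + (p - \<rho>)) mod p) (V m)\<bar> \<le> int Q"
    using \<rho> \<open>\<rho> \<noteq> 0\<close> QR by (intro ternary_window_sum_bound) auto
  moreover have "poly.coeff (cyclotomic_poly (p * q * r)) k =
    of_int (\<Sum>m<p. binary_coeff p q Q R (k div r) (U m) (V m) -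
      binary_coeff p q Q R (k div r) ((U m + (p - \<rho>)) mod p) (V m))"
    using pqr QR UV \<rho> by (intro coeff_cyclotomic_ternary) auto
  ultimately show ?thesis by blast
qed

lemma finite_coeff_norms: "finite {norm (poly.coeff f k) | k. True}"
proof (rule finite_subset)
  show "{norm (poly.coeff f k) | k. True} \<subseteq> insert 0 ((\<lambda>k. norm (poly.coeff f k)) ` {..degree f})"
    by (auto simp: not_le[symmetric] image_iff intro: coeff_eq_0) (metis atMost_iff coeff_eq_0 norm_zero not_le)
qed auto

lemma cyclotomic_height_ge: "norm (poly.coeff (cyclotomic_poly n) k) \<le> cyclotomic_height n"
  unfolding cyclotomic_height_def by (rule Max_ge[OF finite_coeff_norms]) auto

lemma cyclotomic_height_attained: "\<exists>k. cyclotomic_height n = norm (poly.coeff (cyclotomic_poly n) k)"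
proof -
  have "cyclotomic_height n \<in> {norm (poly.coeff (cyclotomic_poly n) k) | k. True}"
    unfolding cyclotomic_height_def by (rule Max_in[OF finite_coeff_norms]) auto
  then show ?thesis by auto
qed

text \<open>A block of \<open>r > p * q\<close> consecutive integers meets every residue class
  modulo \<open>p * q\<close>, so the truncation point and the coordinates can be prescribed
  independently.\<close>

lemma obtain_index_in_block:
  fixes p q r K a b :: nat
  assumes "coprime p q" "p * q < r" "0 < p" "0 < q"
  obtains k where "k div r = K" "[k = a] (mod p)" "[k = b] (mod q)"
proof -
  obtain x where x: "[x = a] (mod p)" "[x = b] (mod q)"
    using binary_chinese_remainder_nat[OF assms(1)] by blast
  obtain s where s: "s < p * q" "[1 * s + K * r = x] (mod p * q)"
    using linear_cong_solution[of 1 "p * q" "K * r" x] assms by auto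
  have "(s + K * r) div r = K" using s assms by simp
  moreover have "[s + K * r = a] (mod p)" "[s + K * r = b] (mod q)"
    using s(2) x cong_modulus_mult_nat[of _ _ p q] cong_modulus_mult_nat[of _ _ q p]
    by (metis cong_trans mult.commute nat_mult_1)+
  ultimately show thesis by (rule that)
qed

lemma cong_nat_modD:
  assumes "[k = nat (x mod int n)] (mod n)" "0 < n"
  shows "[int k = x] (mod int n)"
proof -
  have "[int k = int (nat (x mod int n))] (mod int n)" using assms(1) by (simp only: cong_int_iff)
  then show ?thesis using assms(2) by (simp add: Cong.cong_def)
qed

text \<open>The congruences on \<open>r\<close> mean that raising \<open>m\<close> by 1 changes
  \<open>u\<close> by \<open>- \<epsilon>\<close> modulo \<open>p\<close> and \<open>v\<close> by
  \<open>\<epsilon> * d\<close> modulo \<open>q\<close>: one step of the extremal progression,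
  forwards or backwards.\<close>

lemma cyclotomic_height_ternary_ge:
  fixes p q Q P R d \<rho> r :: nat
  assumes pqr: "prime p" "prime q" "prime r" "p < q" "p * q < r"
    and PQ: "P + Q = p" "P < Q - 1" and R: "Q * q + R * p = p * q + 1" "R \<le> q"
    and \<rho>: "0 < \<rho>" "\<rho> \<le> P" "[r * \<rho> = 1] (mod p)"
    and d: "0 < d" "(Q - 1) * (d * p) \<le> P * q" "(Q - 1) * q < \<rho> * q + (Q - 1) * (d * p)"
    and \<epsilon>: "\<epsilon> = 1 \<or> \<epsilon> = - 1" "[int (r * q) = \<epsilon>] (mod int p)" "[int (r * p * d) = - \<epsilon>] (mod int q)"
  shows "real Q \<le> cyclotomic_height (p * q * r)"
proof -
  have cop: "coprime p q" using pqr by (auto simp: primes_coprime)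
  have pos: "0 < p" "0 < q" using pqr by (auto simp: prime_gt_0_nat)
  \<comment> \<open>The window is traversed upwards from \<open>- P\<close> or downwards from
    \<open>Q - 1\<close>, according to \<open>\<epsilon>\<close>; the pair at \<open>m = 0\<close>
    then fixes \<open>k\<close> modulo \<open>p\<close> and \<open>q\<close>.\<close>
  define b where "b = (if \<epsilon> = 1 then - int P else int Q - 1)"
  define T where "T m = b + \<epsilon> * int m" for m :: nat
  obtain k where k: "k div r = (Q - 1) * q" "[k = nat (\<epsilon> * (int (Q + \<rho>) - 1 - b) mod int p)] (mod p)"
    "[k = nat (- \<epsilon> * b mod int q)] (mod q)"
    using obtain_index_in_block[OF cop pqr(5) pos] by blast
  have kp: "[int k = \<epsilon> * (int (Q + \<rho>) - 1 - b)] (mod int p)"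
    by (rule cong_nat_modD[OF k(2) pos(1)])
  have kq: "[int k = - \<epsilon> * b] (mod int q)"
    by (rule cong_nat_modD[OF k(3) pos(2)])
  define U V where "U m = nat ((int (Q + \<rho>) - 1 - T m) mod int p)" and "V m = nat (T m * int d mod int q)" for m
  have \<epsilon>\<epsilon>: "\<epsilon> * \<epsilon> = 1" using \<epsilon>(1) by auto
  have UV: "U m < p \<and> V m < q \<and> [r * (U m * q + V m * p) + m = k] (mod p * q)" for m
  proof (intro conjI)
    show "U m < p" "V m < q" using pos by (auto simp: U_def V_def nat_less_iff)
    have "[int (U m) = int (Q + \<rho>) - 1 - T m] (mod int p)"
      using pos by (simp add: U_def Cong.cong_def)
    then have "[int (r * q) * int (U m) = \<epsilon> * (int (Q + \<rho>) - 1 - T m)] (mod int p)"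
      using \<epsilon>(2) by (intro cong_mult)
    then have "[int (r * q) * int (U m) + int m = \<epsilon> * (int (Q + \<rho>) - 1 - T m) + int m] (mod int p)"
      by (intro cong_add cong_refl)
    also have "\<epsilon> * (int (Q + \<rho>) - 1 - T m) + int m = \<epsilon> * (int (Q + \<rho>) - 1 - b) + (1 - \<epsilon> * \<epsilon>) * int m"
      by (simp add: T_def algebra_simps)
    also have "\<dots> = \<epsilon> * (int (Q + \<rho>) - 1 - b)" by (simp add: \<epsilon>\<epsilon>)
    finally have 1: "[int (r * q * U m + m) = int k] (mod int p)"
      using kp by (simp add: Cong.cong_def)
    have "[int (V m) = T m * int d] (mod int q)"
      using pos by (simp add: V_def Cong.cong_def)
    then have "[int (r * p) * int (V m) = int (r * p) * (T m * int d)] (mod int q)"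
      by (intro cong_mult cong_refl)
    also have "int (r * p) * (T m * int d) = int (r * p * d) * T m" by simp
    also have "[\<dots> = - \<epsilon> * T m] (mod int q)" using \<epsilon>(3) by (intro cong_mult cong_refl)
    finally have "[int (r * p) * int (V m) + int m = - \<epsilon> * T m + int m] (mod int q)"
      by (intro cong_add cong_refl)
    also have "- \<epsilon> * T m + int m = - \<epsilon> * b + (1 - \<epsilon> * \<epsilon>) * int m"
      by (simp add: T_def algebra_simps)
    also have "\<dots> = - \<epsilon> * b" by (simp add: \<epsilon>\<epsilon>)
    finally have 2: "[int (r * p * V m + m) = int k] (mod int q)"
      using kq by (simp add: Cong.cong_def)
    show "[r * (U m * q + V m * p) + m = k] (mod p * q)"
      unfolding cong_coordinates_iff[OF cop] using 1 2 by (simp only: cong_int_iff)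
  qed
  let ?e = "binary_coeff p q Q R ((Q - 1) * q)"
  let ?c = "\<lambda>t. ?e (nat ((int (Q + \<rho>) - 1 - t) mod int p)) (nat (t * int d mod int q)) -
      ?e ((nat ((int (Q + \<rho>) - 1 - t) mod int p) + (p - \<rho>)) mod p) (nat (t * int d mod int q))"
  have bij: "bij_betw T {..<p} {- int P..<int Q}"
  proof (cases "\<epsilon> = 1")
    case True
    then show ?thesis using PQ(1)
      by (intro bij_betwI[where g = "\<lambda>t. nat (t + int P)"]) (auto simp: T_def b_def)
  next
    case False
    then have "\<epsilon> = - 1" using \<epsilon>(1) by simp
    then show ?thesis using PQ(1)
      by (intro bij_betwI[where g = "\<lambda>t. nat (int Q - 1 - t)"]) (auto simp: T_def b_def)
  qed
  have dist: "distinct [p, q, r]"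
  proof -
    have "1 * q < p * q" using pqr by (intro mult_strict_right_mono) (auto simp: prime_gt_Suc_0_nat)
    then show ?thesis using pqr by auto
  qed
  have "poly.coeff (cyclotomic_poly (p * q * r)) k = of_int (\<Sum>m<p. ?c (T m))"
    using coeff_cyclotomic_ternary[OF pqr(1-3) dist pqr(4) R(1) _ R(2), of U V k \<rho>] UV PQ \<rho>
    unfolding U_def V_def k(1) by simp
  also have "(\<Sum>m<p. ?c (T m)) = (\<Sum>t\<in>{- int P..<int Q}. ?c t)"
    by (rule sum.reindex_bij_betw[OF bij])
  finally have c: "poly.coeff (cyclotomic_poly (p * q * r)) k = of_int (\<Sum>t\<in>{- int P..<int Q}. ?c t)" .
  have "(\<Sum>t\<in>{- int P..<int Q}. ?c t) \<le> - int Q"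
    by (rule ternary_window_sum_extremal[OF PQ pos(2) R(1) \<rho>(1,2) d])
  then have "real Q \<le> norm (poly.coeff (cyclotomic_poly (p * q * r)) k)"
    unfolding c norm_of_int by linarith
  then show ?thesis using cyclotomic_height_ge order_trans by blast
qed

section \<open>Parameters for the given \<open>l\<close>, \<open>p\<close> and
  \<open>q\<close>\<close>

theorem theorem3:
  fixes l p q :: nat
  assumes "1 \<le> l" and "odd l"
    and "prime p" and "l\<^sup>2 + 3 * l + 5 \<le> p"
    and "prime q" and "(real p + real l) * real p / 2 \<le> real q"
    and "[(l + 2) * q = 2] (mod p)"
  shows "ternary_height_max p q = (real p + real l + 2) / 2"
proof -
  obtain j where j: "l = 2 * j + 1" using assms(2) by (auto elim: oddE)
  have l2p: "l * l + 3 * l + 5 \<le> p" using assms(4) by (simp add: power2_eq_square)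
  have "odd p" using prime_odd_nat[OF assms(3)] l2p by simp
  then have "even (p - (l + 2))" using assms(2) l2p by simp
  then obtain P where "p - (l + 2) = 2 * P" by (rule evenE)
  then have P: "p = 2 * P + l + 2" using l2p by linarith
  define Q where "Q = P + l + 2"
  have PQ: "P + Q = p" "P < Q - 1" "Q - 1 = P + l + 1" "p \<le> 2 * Q" "Q < p"
    using P l2p assms(1) by (auto simp: Q_def)
  have realQ: "real Q = (real p + real l + 2) / 2" using P by (simp add: Q_def)
  have pos: "0 < p" "0 < q" using assms by (auto simp: prime_gt_0_nat)
  \<comment> \<open>Since \<open>Q - 1\<close> is half of \<open>p + l\<close>, this is the
    hypothesis on \<open>q\<close> in integers.\<close>
  have qge: "(Q - 1) * p \<le> q"
  proof -
    have "real ((Q - 1) * p) = (real p + real l) * real p / 2"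
      unfolding PQ(3) of_nat_mult using P by (simp add: field_simps)
    then show ?thesis using assms(6) by linarith
  qed
  have pq: "p < q"
  proof -
    have "1 * p < (Q - 1) * p" using PQ pos assms(1) by (intro mult_strict_right_mono) auto
    then show ?thesis using qge by linarith
  qed
  then have cop: "coprime p q" using assms by (simp add: primes_coprime)
  \<comment> \<open>As \<open>2 * P = p - (l + 2)\<close>, the congruence for \<open>q\<close> says
    that \<open>P * q\<close> is \<open>- 1\<close> modulo \<open>p\<close>. So
    \<open>Q = p - P\<close> inverts \<open>q\<close> modulo \<open>p\<close>, and the quotient
    \<open>R\<close> inverts \<open>p\<close> modulo \<open>q\<close>.\<close>
  have "p dvd P * q + 1"
  proof -
    have "[(l + 2) * q + 2 * (P * q) = 2 + 2 * (P * q)] (mod p)"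
      by (intro cong_add assms(7) cong_refl)
    moreover have "(l + 2) * q + 2 * (P * q) = p * q" unfolding P by (simp add: algebra_simps)
    ultimately have "p dvd 2 * (P * q + 1)"
      by (metis add.commute cong_dvd_iff distrib_left dvd_triv_left mult.right_neutral)
    moreover have "coprime p 2" using \<open>odd p\<close> by simp
    ultimately show ?thesis using coprime_dvd_mult_right_iff by blast
  qed
  then obtain R where R': "P * q + 1 = p * R" by (auto elim: dvdE)
  have R: "Q * q + R * p = p * q + 1"
  proof -
    have "Q * q + R * p = Q * q + (P * q + 1)" using R' by (simp add: mult.commute)
    also have "\<dots> = (P + Q) * q + 1" by (simp add: algebra_simps)
    finally show ?thesis using PQ(1) by simp
  qed
  have "R \<le> q"
  proof (rule ccontr)
    assume "\<not> R \<le> q"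
    then have "p * (q + 1) \<le> p * R" by (intro mult_left_mono) auto
    then have "p * q + p \<le> P * q + 1" using R' by simp
    moreover have "P * q \<le> p * q" using PQ(1) by (intro mult_right_mono) auto
    ultimately show False using l2p by linarith
  qed
  have bound: "\<exists>z::int. poly.coeff (cyclotomic_poly (p * q * r)) k = of_int z \<and> \<bar>z\<bar> \<le> int Q"
    if "prime r" "q < r" for r k
    using coeff_cyclotomic_ternary_bound assms(3,5) pq that R PQ \<open>R \<le> q\<close> by blast
  have upper: "\<exists>z::int. cyclotomic_height (p * q * r) = of_int z \<and> \<bar>z\<bar> \<le> int Q"
    if r: "prime r" "q < r" for r
  proof -
    obtain k where "cyclotomic_height (p * q * r) = norm (poly.coeff (cyclotomic_poly (p * q * r)) k)"
      using cyclotomic_height_attained by blast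
    moreover obtain z :: int where "poly.coeff (cyclotomic_poly (p * q * r)) k = of_int z" "\<bar>z\<bar> \<le> int Q"
      using bound[OF r] by blast
    ultimately have "cyclotomic_height (p * q * r) = of_int \<bar>z\<bar> \<and> \<bar>\<bar>z\<bar>\<bar> \<le> int Q"
      by simp
    then show ?thesis by blast
  qed
  have "\<exists>r. prime r \<and> q < r \<and> real Q \<le> cyclotomic_height (p * q * r)"
  proof -
    define w where "w = q mod p"
    define d where "d = P * q div ((Q - 1) * p)"
    define h where "h = (l + 2) * w div p"
    have "w < p" using pos by (simp add: w_def)
    have "(l + 2) * w mod p = (l + 2) * q mod p" unfolding w_def by (rule mod_mult_right_eq)
    also have "\<dots> = 2 mod p" using assms(7) by (simp only: Cong.cong_def)
    also have "\<dots> = 2" using l2p by simp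
    finally have h: "(l + 2) * w = h * p + 2"
      unfolding h_def by (metis div_mult_mod_eq)
    have "h \<noteq> 0"
    proof
      assume "h = 0"
      then have "(l + 2) * w = 2" using h by simp
      then have "l + 2 dvd 2" by (metis dvd_triv_left)
      then show False using assms(1) by (auto dest: dvd_imp_le)
    qed
    have "(l + 2) * w < (l + 2) * p" using \<open>w < p\<close> by (intro mult_strict_left_mono) auto
    then have "h * p < (l + 2) * p" using h by linarith
    then have "h < l + 2" by (simp only: mult_less_cancel2)
    then have "h \<le> l + 1" by simp
    \<comment> \<open>The residue of \<open>q\<close> yields the multiplier \<open>h\<close>, that
      of \<open>- q\<close> yields \<open>l + 2 - h\<close>. Their sum is odd, so one of them is at
      most \<open>(l + 1) / 2\<close>; the sign selects it as \<open>g\<close>.\<close>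
    define \<epsilon> :: int where "\<epsilon> = (if 2 * h \<le> l + 1 then 1 else - 1)"
    define \<rho> where "\<rho> = (if 2 * h \<le> l + 1 then w else p - w)"
    obtain g where g: "(l + 2) * \<rho> = g * p + 2 \<or> (l + 2) * \<rho> + 2 = g * p" "1 \<le> g" "2 * g \<le> l + 1"
    proof (cases "2 * h \<le> l + 1")
      case True
      then show thesis using that[of h] h \<open>h \<noteq> 0\<close> by (simp add: \<rho>_def)
    next
      case False
      have "(l + 2) * (p - w) + (l + 2) * w = (l + 2) * p"
        using \<open>w < p\<close> by (metis distrib_left le_add_diff_inverse2 less_imp_le)
      also have "\<dots> = (l + 2 - h) * p + h * p"
        using \<open>h < l + 2\<close> by (metis distrib_right le_add_diff_inverse2 less_imp_le)
      finally have "(l + 2) * (p - w) + 2 = (l + 2 - h) * p" using h by linarith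
      then have "(l + 2) * \<rho> + 2 = (l + 2 - h) * p" using False by (simp only: \<rho>_def if_False)
      moreover have "1 \<le> l + 2 - h" "2 * (l + 2 - h) \<le> l + 1"
        using \<open>h \<le> l + 1\<close> False j by presburger+
      ultimately show thesis using that by blast
    qed
    \<comment> \<open>Otherwise \<open>g \<ge> 1\<close> gives
      \<open>p \<le> (l + 2) * (l + 1) + 2\<close>, which falls short of the hypothesis on
      \<open>p\<close> by exactly 1.\<close>
    have "l + 2 \<le> \<rho>"
    proof (rule ccontr)
      assume "\<not> l + 2 \<le> \<rho>"
      then have "(l + 2) * \<rho> \<le> (l + 2) * (l + 1)" by (intro mult_left_mono) auto
      moreover have "1 * p \<le> g * p" using g(2) by (intro mult_right_mono) auto
      ultimately have "p \<le> (l + 2) * (l + 1) + 2" using g(1) by linarith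
      then show False using l2p by (simp add: algebra_simps)
    qed
    \<comment> \<open>Here the choice of the smaller multiplier matters:
      \<open>2 * g \<le> l + 1\<close> keeps \<open>\<rho>\<close> below \<open>p / 2\<close> by a
      margin that grows with \<open>p\<close>.\<close>
    have "\<rho> \<le> P"
    proof (rule ccontr)
      assume "\<not> \<rho> \<le> P"
      then have "(l + 2) * (2 * P + 2) \<le> (l + 2) * (2 * \<rho>)" by (intro mult_left_mono) auto
      moreover have "2 * g * p \<le> (l + 1) * p" using g(3) by (intro mult_right_mono) auto
      ultimately have "(l + 2) * (2 * P + 2) \<le> (l + 1) * p + 4" using g(1) by linarith
      then have "2 * P \<le> l * l + l + 2"
        unfolding P by (simp add: algebra_simps)
      then show False using l2p P by linarith
    qed
    have d1: "(Q - 1) * (d * p) \<le> P * q"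
      using times_div_less_eq_dividend[of "(Q - 1) * p" "P * q"] by (simp add: d_def mult_ac)
    \<comment> \<open>Rounding costs less than \<open>q\<close>. Adding \<open>(l + 1) * q\<close>
      turns \<open>P * q\<close> into \<open>(Q - 1) * q\<close>, and the resulting excess
      \<open>(l + 2) * q\<close> is covered by \<open>\<rho> * q\<close>.\<close>
    have d2: "(Q - 1) * q < \<rho> * q + (Q - 1) * (d * p)"
    proof -
      have "0 < (Q - 1) * p" using pos PQ by simp
      then have "P * q < (Q - 1) * p + d * ((Q - 1) * p)"
        unfolding d_def by (rule dividend_less_div_times)
      moreover have "d * ((Q - 1) * p) = (Q - 1) * (d * p)" by (simp only: mult_ac)
      ultimately have "P * q < (Q - 1) * (d * p) + q" using qge by linarith
      then have "P * q + (l + 1) * q < (Q - 1) * (d * p) + (l + 2) * q"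
        unfolding distrib_right by linarith
      also have "\<dots> \<le> (Q - 1) * (d * p) + \<rho> * q"
        using \<open>l + 2 \<le> \<rho>\<close> by (intro add_mono mult_right_mono) auto
      also have "P * q + (l + 1) * q = (Q - 1) * q" unfolding PQ(3) by (simp add: algebra_simps)
      finally show ?thesis by simp
    qed
    have "0 < d"
    proof (rule ccontr)
      assume "\<not> 0 < d"
      then have "(Q - 1) * q < \<rho> * q" using d2 by simp
      then show False using PQ(2) \<open>\<rho> \<le> P\<close> by simp
    qed
    \<comment> \<open>Makes \<open>p * d\<close> invertible modulo \<open>q\<close>, so that the
      residue class of \<open>r\<close> can be solved for.\<close>
    have "\<not> q dvd d"
    proof
      assume "q dvd d"
      then have "q \<le> d" using \<open>0 < d\<close> by (rule dvd_imp_le)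
      then have "q * 1 \<le> d * p" using pos by (intro mult_mono) auto
      moreover have "(Q - 1) * q \<le> (Q - 1) * (d * p)" using calculation by (intro mult_left_mono) auto
      ultimately have "(Q - 1) * q \<le> P * q" using d1 by linarith
      then show False using PQ(2) pos by simp
    qed
    then have cop_pd: "coprime (p * d) q"
      using cop prime_imp_coprime[OF assms(5)] by (simp add: coprime_mult_left_iff coprime_commute[of d])
    obtain x where x: "x < p" "[q * x + 0 = nat (\<epsilon> mod int p)] (mod p)"
      using linear_cong_solution[of q p 0] cop pos by (metis coprime_commute)
    obtain y where y: "y < q" "[p * d * y + 0 = nat (- \<epsilon> mod int q)] (mod q)"
      using linear_cong_solution[OF cop_pd pos(2)] by metis
    obtain a where a: "[a = x] (mod p)" "[a = y] (mod q)"
      using binary_chinese_remainder_nat[OF cop] by blast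
    have ap: "[int (q * a) = \<epsilon>] (mod int p)"
    proof (rule cong_nat_modD[OF _ pos(1)])
      have "[q * a = q * x] (mod p)" using a by (intro cong_mult cong_refl)
      then show "[q * a = nat (\<epsilon> mod int p)] (mod p)" using x by (auto intro: cong_trans)
    qed
    have aq: "[int (p * d * a) = - \<epsilon>] (mod int q)"
    proof (rule cong_nat_modD[OF _ pos(2)])
      have "[p * d * a = p * d * y] (mod q)" using a by (intro cong_mult cong_refl)
      then show "[p * d * a = nat (- \<epsilon> mod int q)] (mod q)" using y by (auto intro: cong_trans)
    qed
    have unit: "coprime a n" if "[int (b * a) = e] (mod int n)" "e = 1 \<or> e = - 1" for b n e
    proof -
      have "coprime e (int n)" using that(2) by auto
      then have "coprime (int (b * a)) (int n)"
        using that(1) cong_imp_coprime cong_sym by blast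
      then show ?thesis by (simp add: coprime_mult_left_iff)
    qed
    have "\<epsilon> = 1 \<or> \<epsilon> = - 1" by (simp add: \<epsilon>_def)
    then have "coprime a p" "coprime a q"
      using unit[OF ap] unit[OF aq] by auto
    then have "infinite {r. prime r \<and> [r = a] (mod p * q)}"
      using infinite_primes_in_residue_class assms pq by (simp add: coprime_mult_right_iff)
    then obtain r where r: "prime r" "[r = a] (mod p * q)" "p * q < r"
      using infinite_nat_iff_unbounded by (metis (mono_tags, lifting) mem_Collect_eq)
    have rp: "[r = a] (mod p)" and rq: "[r = a] (mod q)"
      using r(2) cong_modulus_mult_nat by (blast, metis cong_modulus_mult_nat mult.commute)
    have "[int (r * q) = int (q * a)] (mod int p)"
      using rp by (simp only: cong_int_iff mult.commute[of r]) (intro cong_mult cong_refl)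
    then have e1: "[int (r * q) = \<epsilon>] (mod int p)" using ap cong_trans by blast
    have "[int (r * p * d) = int (p * d * a)] (mod int q)"
      using rq by (simp only: cong_int_iff mult.commute[of r] mult.assoc mult.left_commute[of r])
        (intro cong_mult cong_refl)
    then have e2: "[int (r * p * d) = - \<epsilon>] (mod int q)" using aq cong_trans by blast
    \<comment> \<open>\<open>\<rho>\<close> is congruent to \<open>\<epsilon> * q\<close> and
      \<open>r * q\<close> to \<open>\<epsilon>\<close>, so the signs cancel.\<close>
    have "[r * \<rho> = 1] (mod p)"
    proof -
      have "[int \<rho> = \<epsilon> * int q] (mod int p)"
      proof (cases "2 * h \<le> l + 1")
        case True
        then show ?thesis by (simp add: \<rho>_def \<epsilon>_def w_def Cong.cong_def zmod_int)
      next
        case False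
        have "int (p - w) = int p + - int w" using \<open>w < p\<close> by simp
        also have "[\<dots> = - int w] (mod int p)" by (simp add: Cong.cong_def)
        also have "[- int w = - int q] (mod int p)"
          by (simp add: w_def Cong.cong_def zmod_int mod_minus_eq)
        finally show ?thesis using False by (simp add: \<rho>_def \<epsilon>_def)
      qed
      then have "[int r * int \<rho> = int r * (\<epsilon> * int q)] (mod int p)" by (intro cong_mult cong_refl)
      also have "int r * (\<epsilon> * int q) = \<epsilon> * int (r * q)" by simp
      also have "[\<dots> = \<epsilon> * \<epsilon>] (mod int p)" using e1 by (intro cong_mult cong_refl)
      also have "\<epsilon> * \<epsilon> = 1" by (simp add: \<epsilon>_def)
      finally have "[int (r * \<rho>) = int 1] (mod int p)" by simp
      then show ?thesis by (simp only: cong_int_iff)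
    qed
    then have "real Q \<le> cyclotomic_height (p * q * r)"
      using cyclotomic_height_ternary_ge[of p q r P Q R \<rho> d \<epsilon>] assms(3,5) r pq PQ R \<open>R \<le> q\<close>
        \<open>l + 2 \<le> \<rho>\<close> \<open>\<rho> \<le> P\<close> \<open>0 < d\<close> d1 d2 e1 e2 \<open>\<epsilon> = 1 \<or> \<epsilon> = - 1\<close> by auto
    moreover have "q < r"
    proof -
      have "1 * q \<le> p * q" using pos by (intro mult_right_mono) auto
      then show ?thesis using r(3) by linarith
    qed
    ultimately show ?thesis using r(1) by blast
  qed
  then obtain r where r: "prime r" "q < r" "real Q \<le> cyclotomic_height (p * q * r)" by blast
  have "ternary_height_max p q = real Q"
    unfolding ternary_height_max_def
  proof (rule Max_eqI)
    \<comment> \<open>\<open>Max\<close> needs a finite set. Infinitely many \<open>r\<close> occur,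
      but all heights are integers of absolute value at most \<open>Q\<close>.\<close>
    have "{cyclotomic_height (p * q * r) | r. prime r \<and> q < r} \<subseteq> of_int ` {- int Q..int Q}"
    proof
      fix y assume "y \<in> {cyclotomic_height (p * q * r) | r. prime r \<and> q < r}"
      then obtain r z where "y = cyclotomic_height (p * q * r)" "cyclotomic_height (p * q * r) = of_int z"
        "\<bar>z\<bar> \<le> int Q" using upper by blast
      then show "y \<in> of_int ` {- int Q..int Q}" by (intro image_eqI[of _ _ z]) auto
    qed
    then show "finite {cyclotomic_height (p * q * r) | r. prime r \<and> q < r}"
      by (rule finite_subset) simp
    have le: "cyclotomic_height (p * q * r') \<le> real Q" if r': "prime r'" "q < r'" for r'
    proof -
      obtain z where "cyclotomic_height (p * q * r') = of_int z" "\<bar>z\<bar> \<le> int Q"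
        using upper[OF r'] by blast
      then show ?thesis by linarith
    qed
    then show "y \<le> real Q" if "y \<in> {cyclotomic_height (p * q * r) | r. prime r \<and> q < r}" for y
      using that by blast
    have "real Q = cyclotomic_height (p * q * r)" using le[OF r(1,2)] r(3) by simp
    then show "real Q \<in> {cyclotomic_height (p * q * r) | r. prime r \<and> q < r}" using r by blast
  qed
  then show ?thesis by (simp add: realQ)
qed

end
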